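(* Let $i,k\ge0$ and $j\ge1$ be integers with $k\le i+j$. Then for all $c\ge0$, $$(\mathrm Ni\mathrm{EXP})^{(j\mathrm{EXP})^{\Sigma^p_c}}\subseteq ((i+j)\mathrm{EXP})^{\Sigma^p_c}\subseteq (\mathrm Nk\mathrm{EXP})^{((i+j-k)\mathrm{EXP})^{\Sigma^p_c}[1]}.$$ Consequently, for integers $i,i'\ge0$, $j,j'\ge1$ with $i+j=\ell=i'+j'$ and all $c\ge0$: $(\mathrm Ni\mathrm{EXP})^{(j\mathrm{EXP})^{\Sigma^p_c}}=(\ell\mathrm{EXP})^{\Sigma^p_c}=(\mathrm Ni'\mathrm{EXP})^{(j'\mathrm{EXP})^{\Sigma^p_c}[1]}$.
   Context: $\Sigma=\{0,1\}$. For an integer $i$, $\exp_i(x)$ denotes the iterated exponential: $\exp_0(x)=x$, $\exp_i(x)=2^{\exp_{i-1}(x)}$ for $i>0$, and $\exp_{-i}(x)=\log_2\cdots\log_2 x$ ($i$ times) for $i>0$. For $i\ge0$, $i\mathrm{EXP}=\bigcup_{k\ge1}\mathrm{DTIME}(\exp_i(n^k))$ and $\mathrm{N}i\mathrm{EXP}=\bigcup_{k\ge1}\mathrm{NTIME}(\exp_i(n^k))$. Thus $0\mathrm{EXP}=\mathrm P$, $\mathrm N0\mathrm{EXP}=\mathrm{NP}$, $1\mathrm{EXP}=\mathrm{EXP}$, $\mathrm N1\mathrm{EXP}=\mathrm{NEXP}$. $\Sigma^p_c$ is the $c$-th level of the polynomial hierarchy ($\Sigma^p_0=\mathrm P$,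 $\Sigma^p_{c+1}=\mathrm{NP}^{\Sigma^p_c}$). For complexity classes $\mathcal C,\mathcal D$, $\mathcal C^{\mathcal D}$ is the class of languages decided by oracle machines of the kind and resource bound of $\mathcal C$ (bounds measured in the input length; each query costs one step) with an oracle for some language in $\mathcal D$; $\mathcal C^{\mathcal D^{\mathcal E}}$ means $\mathcal C^{(\mathcal D^{\mathcal E})}$. $\mathcal C^{\mathcal D[1]}$ restricts the machine to at most one query. *)

theory Defs
  imports Main
begin

fun expi :: "nat \<Rightarrow> nat \<Rightarrow> nat" where
  "expi 0 x = x"
| "expi (Suc i) x = 2 ^ expi i x"

text \<open>Tape symbols are naturals below alph M; 0 is the blank, 1 encodes the bit False
  and 2 the bit True.  Tape 0 is the input tape, tape 1 is the oracle query tape.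
  A transition reads the symbols under all heads and yields a new state, the symbols to
  write and the head moves (-1, 0, +1; moving left on cell 0 stays on cell 0).
  In state qry the machine performs an oracle query (one step): it goes to state yes or
  no depending on whether the word on the query tape is in the oracle, and the query tape
  is erased with its head returned to cell 0.  States acc and rej are halting.\<close>

record otm =
  ntapes :: nat
  nstates :: nat
  alph :: nat
  start :: nat
  acc :: nat
  rej :: nat
  qry :: nat
  yes :: nat
  no :: nat
  delta :: "nat \<Rightarrow> nat list \<Rightarrow> (nat \<times> nat list \<times> int list) set"

definition wf_otm :: "otm \<Rightarrow> bool" where
  "wf_otm M \<longleftrightarrow> ntapes M \<ge> 2 \<and> alph M \<ge> 3 \<and>
     start M < nstates M \<and> acc M < nstates M \<and> rej M < nstates M \<and>
     qry M < nstates M \<and> yes M < nstates M \<and> no M < nstates M \<and>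
     distinct [acc M, rej M, qry M] \<and>
     (\<forall>q syms q' ws mv. (q', ws, mv) \<in> delta M q syms \<longrightarrow>
        q' < nstates M \<and> length ws = ntapes M \<and> length mv = ntapes M \<and>
        (\<forall>s \<in> set ws. s < alph M) \<and> (\<forall>m \<in> set mv. m \<in> {-1, 0, 1}))"

definition deterministic :: "otm \<Rightarrow> bool" where
  "deterministic M \<longleftrightarrow> (\<forall>q syms. \<forall>a \<in> delta M q syms. \<forall>b \<in> delta M q syms. a = b)"

record conf =
  st :: nat
  tp :: "nat \<Rightarrow> nat \<Rightarrow> nat"
  hd :: "nat \<Rightarrow> nat"

definition init_conf :: "otm \<Rightarrow> bool list \<Rightarrow> conf" where
  "init_conf M x = \<lparr> st = start M,
      tp = (\<lambda>t p. if t = 0 \<and> p < length x then (if x ! p then 2 else 1) else 0),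
      hd = (\<lambda>t. 0) \<rparr>"

definition query_word :: "conf \<Rightarrow> bool list" where
  "query_word c = (let m = (LEAST p. tp c 1 p \<notin> {1, 2}) in map (\<lambda>p. tp c 1 p = 2) [0..<m])"

definition answer_step :: "otm \<Rightarrow> bool list set \<Rightarrow> conf \<Rightarrow> conf" where
  "answer_step M A c = \<lparr> st = (if query_word c \<in> A then yes M else no M),
      tp = (\<lambda>t p. if t = 1 then 0 else tp c t p),
      hd = (\<lambda>t. if t = 1 then 0 else hd c t) \<rparr>"

definition trans_step :: "otm \<Rightarrow> conf \<Rightarrow> conf \<Rightarrow> bool" where
  "trans_step M c c' \<longleftrightarrow> st c \<notin> {acc M, rej M, qry M} \<and>
     (\<exists>ws mv. (st c', ws, mv) \<in> delta M (st c) (map (\<lambda>t. tp c t (hd c t)) [0..<ntapes M]) \<and>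
        tp c' = (\<lambda>t p. if t < ntapes M \<and> p = hd c t then ws ! t else tp c t p) \<and>
        hd c' = (\<lambda>t. if t < ntapes M then nat (int (hd c t) + mv ! t) else hd c t))"

inductive reach :: "otm \<Rightarrow> bool list set \<Rightarrow> bool list \<Rightarrow> nat \<Rightarrow> nat \<Rightarrow> conf \<Rightarrow> bool"
  for M A x where
  reach_init: "reach M A x 0 0 (init_conf M x)"
| reach_trans: "reach M A x n q c \<Longrightarrow> trans_step M c c' \<Longrightarrow> reach M A x (Suc n) q c'"
| reach_query: "reach M A x n q c \<Longrightarrow> st c = qry M \<Longrightarrow>
                reach M A x (Suc n) (Suc q) (answer_step M A c)"

definition time_bounded :: "otm \<Rightarrow> bool list set \<Rightarrow> (nat \<Rightarrow> nat) \<Rightarrow> bool" where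
  "time_bounded M A T \<longleftrightarrow> (\<forall>x n q c. reach M A x n q c \<longrightarrow> n \<le> T (length x))"

definition at_most_one_query :: "otm \<Rightarrow> bool list set \<Rightarrow> bool" where
  "at_most_one_query M A \<longleftrightarrow> (\<forall>x n q c. reach M A x n q c \<longrightarrow> q \<le> 1)"

definition accepts :: "otm \<Rightarrow> bool list set \<Rightarrow> bool list \<Rightarrow> bool" where
  "accepts M A x \<longleftrightarrow> (\<exists>n q c. reach M A x n q c \<and> st c = acc M)"

definition decides :: "otm \<Rightarrow> bool list set \<Rightarrow> bool list set \<Rightarrow> bool" where
  "decides M A L \<longleftrightarrow> (\<forall>x. x \<in> L \<longleftrightarrow> accepts M A x)"

definition DTIME_O :: "(nat \<Rightarrow> nat) \<Rightarrow> bool list set \<Rightarrow> bool list set set" where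
  "DTIME_O T A = {L. \<exists>M. wf_otm M \<and> deterministic M \<and> time_bounded M A T \<and> decides M A L}"

definition NTIME_O :: "(nat \<Rightarrow> nat) \<Rightarrow> bool list set \<Rightarrow> bool list set set" where
  "NTIME_O T A = {L. \<exists>M. wf_otm M \<and> time_bounded M A T \<and> decides M A L}"

definition NTIME_O1 :: "(nat \<Rightarrow> nat) \<Rightarrow> bool list set \<Rightarrow> bool list set set" where
  "NTIME_O1 T A = {L. \<exists>M. wf_otm M \<and> time_bounded M A T \<and> at_most_one_query M A \<and> decides M A L}"

text \<open>Time bound exp_i(n^k), up to the usual constant factor/additive slack.\<close>
definition expbound :: "nat \<Rightarrow> nat \<Rightarrow> nat \<Rightarrow> nat" where
  "expbound i k n = k * expi i (n ^ k) + k"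

definition EXPO :: "nat \<Rightarrow> bool list set \<Rightarrow> bool list set set" where
  "EXPO i A = (\<Union>k. DTIME_O (expbound i k) A)"

definition NEXPO :: "nat \<Rightarrow> bool list set \<Rightarrow> bool list set set" where
  "NEXPO i A = (\<Union>k. NTIME_O (expbound i k) A)"

definition NEXPO1 :: "nat \<Rightarrow> bool list set \<Rightarrow> bool list set set" where
  "NEXPO1 i A = (\<Union>k. NTIME_O1 (expbound i k) A)"

definition rel :: "(bool list set \<Rightarrow> bool list set set) \<Rightarrow> bool list set set \<Rightarrow> bool list set set" where
  "rel C D = (\<Union>A \<in> D. C A)"

text \<open>Polynomial hierarchy: Sigma_0 = P (oracle-free, i.e. empty oracle), Sigma_{c+1} = NP^{Sigma_c}.\<close>
fun SigmaP :: "nat \<Rightarrow> bool list set set" where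
  "SigmaP 0 = EXPO 0 {}"
| "SigmaP (Suc c) = rel (NEXPO 0) (SigmaP c)"

end

theory Submission
  imports Defs
begin

text \<open>Both inclusions hold relative to any fixed oracle A in place of a language of the polynomial hierarchy.

  First inclusion: a nondeterministic machine N with time bound T and an oracle B in jEXP^A is simulated
  deterministically by a depth-first search through its choice sequences. There are only 2^O(T) of them, and the
  queries of N have length at most T, so B can be replaced by its decider, which costs exp_j(poly(T)) per query;
  as j > 0, both bounds are of the form exp_(i+j)(poly(n)).

  Second inclusion: x is padded with t(x) symbols, where t(x) is the running time of a clock machine P that takes
  at least exp_k(n^m) and at most exp_k(poly(n)) steps. The base machine runs P, writes one padding symbol per step,
  and then asks its only query. The oracle machine reruns P against the padding, rejects unless P halts within it,
  and otherwise has a long enough input to simulate the given machine on x.\<close>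

section \<open>Structured tape programs and their compilation\<close>

text \<open>Clock and padding answer to one asymmetry: the base machine may spend exp_k(poly(n))
  steps on x, whereas the oracle machine must halt on every word, also on words that are no padding,
  within a bound in the length of that word alone. Computing exp_k(n^m) there would be too expensive
  for a long x with a short tail. A padding length equal to the exact running time of a
  deterministic clock removes the obstacle: checking it takes one move per padding symbol and can be
  broken off when the input ends.

  The model bounds the length of all runs relative to the given oracle. So the bound of N holds
  along every choice sequence of the search, and no bound has to be computed in order to cut off
  branches.

  Concrete machines are obtained from a small imperative language. Two features of the model shape
  its compilation and the tape formats: a query leads to a fixed state and so loses the control
  state, and a head cannot sense the left end of its tape, so that a work tape needs a mark in cell
  0 before it can be rewound or erased for the next simulation.\<close>

type_synonym tape = "(nat \<Rightarrow> nat) \<times> nat"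
type_synonym store = "nat \<Rightarrow> tape"
type_synonym action = "nat \<rightharpoonup> nat \<times> int"

definition cur :: "tape \<Rightarrow> nat" where
  "cur s = fst s (snd s)"

definition act :: "nat \<times> int \<Rightarrow> tape \<Rightarrow> tape" where
  "act wd s = ((fst s)(snd s := fst wd), nat (int (snd s) + snd wd))"

definition upd :: "store \<Rightarrow> action \<Rightarrow> store" where
  "upd \<sigma> m = (\<lambda>t. case m t of None \<Rightarrow> \<sigma> t | Some wd \<Rightarrow> act wd (\<sigma> t))"

definition rd :: "nat \<Rightarrow> store \<Rightarrow> nat \<Rightarrow> nat" where
  "rd k \<sigma> t = (if t < k then cur (\<sigma> t) else 0)"

definition okact :: "nat \<Rightarrow> nat \<Rightarrow> action \<Rightarrow> bool" where
  "okact k a m \<longleftrightarrow> (\<forall>t w d. m t = Some (w, d) \<longrightarrow> t < k \<and> w < a \<and> d \<in> {-1, 0, 1})"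

definition word_of :: "tape \<Rightarrow> bool list" where
  "word_of s = (let m = (LEAST p. fst s p \<notin> {1, 2}) in map (\<lambda>p. fst s p = 2) [0..<m])"

definition blank :: tape where
  "blank = ((\<lambda>_. 0), 0)"

definition inp :: "bool list \<Rightarrow> nat \<Rightarrow> nat" where
  "inp x p = (if p < length x then (if x ! p then 2 else 1) else 0)"

definition init_store :: "bool list \<Rightarrow> store" where
  "init_store x t = (if t = 0 then (inp x, 0) else blank)"

datatype cmd =
    Act "(nat \<Rightarrow> nat) \<Rightarrow> action"
  | Ask
  | Then cmd cmd  (infixr ";;" 60)
  | Cond "(nat \<Rightarrow> nat) \<Rightarrow> bool" cmd cmd
  | Loop "(nat \<Rightarrow> nat) \<Rightarrow> bool" cmd

text \<open>Time is the exact number of steps of the compiled code: sequencing and every test cost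
  one idle transition, and \<open>Ask\<close> costs three, namely saving the return address, the
  query and the return. The second number counts queries. \<open>Act\<close> has no derivation
  unless \<open>okact\<close> holds, so a derivation also shows that tapes and symbols stay in
  range.\<close>

inductive big :: "nat \<Rightarrow> nat \<Rightarrow> bool list set \<Rightarrow> cmd \<Rightarrow> store \<Rightarrow> nat \<Rightarrow> nat \<Rightarrow> store \<Rightarrow> bool"
  for k a A where
  big_Act: "okact k a (f (rd k \<sigma>)) \<Longrightarrow> big k a A (Act f) \<sigma> 1 0 (upd \<sigma> (f (rd k \<sigma>)))"
| big_Ask: "big k a A Ask \<sigma> 3 1
    (\<sigma>(1 := blank, 2 := act (if word_of (\<sigma> 1) \<in> A then 1 else 2, 0) (\<sigma> 2)))"
| big_Then: "big k a A c \<sigma> t q \<sigma>' \<Longrightarrow> big k a A c' \<sigma>' t' q' \<sigma>'' \<Longrightarrow>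
    big k a A (c ;; c') \<sigma> (1 + t + t') (q + q') \<sigma>''"
| big_Cond: "big k a A (if P (rd k \<sigma>) then c else c') \<sigma> t q \<sigma>' \<Longrightarrow>
    big k a A (Cond P c c') \<sigma> (1 + t) q \<sigma>'"
| big_Loop_end: "\<not> P (rd k \<sigma>) \<Longrightarrow> big k a A (Loop P c) \<sigma> 1 0 \<sigma>"
| big_Loop_step: "P (rd k \<sigma>) \<Longrightarrow> big k a A c \<sigma> t q \<sigma>' \<Longrightarrow> big k a A (Loop P c) \<sigma>' t' q' \<sigma>'' \<Longrightarrow>
    big k a A (Loop P c) \<sigma> (1 + t + t') (q + q') \<sigma>''"

text \<open>The control state of the compiled machine is the stack of commands still to be executed.
  This finite set contains every stack that can occur while \<open>c\<close> runs above
  \<open>C\<close>; a loop pushes only itself back, so stacks do not grow with the number of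
  rounds.\<close>

fun conts :: "cmd \<Rightarrow> cmd list \<Rightarrow> cmd list set" where
  "conts (Act f) C = {Act f # C, C}"
| "conts Ask C = {Ask # C, C}"
| "conts (c ;; c') C = insert ((c ;; c') # C) (conts c (c' # C) \<union> conts c' C)"
| "conts (Cond P c c') C = insert (Cond P c c' # C) (conts c C \<union> conts c' C)"
| "conts (Loop P c) C = insert (Loop P c # C) (insert C (conts c (Loop P c # C)))"

lemma finite_conts: "finite (conts c C)"
  by (induction c arbitrary: C) auto

lemma conts_self: "c # C \<in> conts c C"
  by (cases c) auto

lemma conts_rest: "C \<in> conts c C"
  by (induction c arbitrary: C) auto

text \<open>States 0 to 4 are accept, reject, query, yes and no, whence the shift by 5. On the empty
  stack the machine halts with the verdict read from tape 2.\<close>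

fun control :: "(cmd list \<Rightarrow> nat) \<Rightarrow> cmd list \<Rightarrow> (nat \<Rightarrow> nat) \<Rightarrow> nat \<times> action" where
  "control e [] r = (if r 2 = 1 then 0 else 1, Map.empty)"
| "control e (Act f # C) r = (e C + 5, f r)"
| "control e (Ask # C) r = (2, [2 \<mapsto> (e C, 0)])"
| "control e ((c ;; c') # C) r = (e (c # c' # C) + 5, Map.empty)"
| "control e (Cond P c c' # C) r = (e ((if P r then c else c') # C) + 5, Map.empty)"
| "control e (Loop P c # C) r = ((if P r then e (c # Loop P c # C) else e C) + 5, Map.empty)"

text \<open>An oracle query forgets the control state, so the continuation of a query is
  saved as a symbol on tape 2, and recovered from there in the states yes and no.\<close>

definition mstep :: "(cmd list \<Rightarrow> nat) \<Rightarrow> cmd list set \<Rightarrow> nat \<Rightarrow> (nat \<Rightarrow> nat) \<Rightarrow> nat \<times> action" where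
  "mstep e S q r = (if q = 3 then (r 2 + 5, [2 \<mapsto> (1, 0)])
     else if q = 4 then (r 2 + 5, [2 \<mapsto> (2, 0)])
     else control e (inv_into S e (q - 5)) r)"

definition wfres :: "nat \<Rightarrow> nat \<Rightarrow> nat \<Rightarrow> nat \<times> nat list \<times> int list \<Rightarrow> bool" where
  "wfres n k a res = (case res of (q, ws, mv) \<Rightarrow> q < n \<and> length ws = k \<and> length mv = k \<and>
     (\<forall>s \<in> set ws. s < a) \<and> (\<forall>d \<in> set mv. d \<in> {-1, 0, 1}))"

definition raw :: "nat \<Rightarrow> nat \<times> action \<Rightarrow> nat list \<Rightarrow> nat \<times> nat list \<times> int list" where
  "raw k qm syms = (fst qm,
     map (\<lambda>t. case snd qm t of None \<Rightarrow> syms ! t | Some wd \<Rightarrow> fst wd) [0..<k],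
     map (\<lambda>t. case snd qm t of None \<Rightarrow> 0 | Some wd \<Rightarrow> snd wd) [0..<k])"

text \<open>While a query is pending, the number of a stack is a tape symbol, so the alphabet has at
  least \<open>card S\<close> symbols. Filtering by \<open>wfres\<close> keeps the transitions
  well-formed for every program, whatever its actions do.\<close>

definition compile :: "nat \<Rightarrow> nat \<Rightarrow> (cmd list \<Rightarrow> nat) \<Rightarrow> cmd list set \<Rightarrow> cmd \<Rightarrow> otm" where
  "compile k a e S c = \<lparr> ntapes = k, nstates = card S + 5, alph = max a (card S),
     start = e [c] + 5, acc = 0, rej = 1, qry = 2, yes = 3, no = 4,
     delta = (\<lambda>q syms. {res. res = raw k (mstep e S q (\<lambda>t. if t < k then syms ! t else 0)) syms \<and>
                wfres (card S + 5) k (max a (card S)) res}) \<rparr>"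

lemma compile_sel [simp]:
  "ntapes (compile k a e S c) = k" "nstates (compile k a e S c) = card S + 5"
  "alph (compile k a e S c) = max a (card S)" "start (compile k a e S c) = e [c] + 5"
  "acc (compile k a e S c) = 0" "rej (compile k a e S c) = 1" "qry (compile k a e S c) = 2"
  "yes (compile k a e S c) = 3" "no (compile k a e S c) = 4"
  by (auto simp: compile_def)

lemma deterministic_compile: "deterministic (compile k a e S c)"
  by (auto simp: deterministic_def compile_def)

lemma wf_compile:
  assumes "k \<ge> 3" "a \<ge> 3" "e [c] < card S"
  shows "wf_otm (compile k a e S c)"
  using assms by (auto simp: wf_otm_def compile_def wfres_def)

definition cf :: "nat \<Rightarrow> store \<Rightarrow> conf" where
  "cf q \<sigma> = \<lparr> st = q, tp = (\<lambda>t. fst (\<sigma> t)), hd = (\<lambda>t. snd (\<sigma> t)) \<rparr>"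

lemma cf_sel [simp]: "st (cf q \<sigma>) = q" "tp (cf q \<sigma>) = (\<lambda>t. fst (\<sigma> t))" "conf.hd (cf q \<sigma>) = (\<lambda>t. snd (\<sigma> t))"
  by (auto simp: cf_def)

text \<open>A transition writes on all tapes, and a tape outside the action gets its scanned symbol
  back; \<open>wfres\<close> accepts that only if this symbol already lies in the alphabet.\<close>

definition small_syms :: "nat \<Rightarrow> store \<Rightarrow> bool" where
  "small_syms a \<sigma> \<longleftrightarrow> (\<forall>t p. fst (\<sigma> t) p < a)"

lemma small_syms_upd: "small_syms a \<sigma> \<Longrightarrow> okact k a m \<Longrightarrow> small_syms a (upd \<sigma> m)"
  by (auto simp: small_syms_def upd_def okact_def act_def split: option.splits)

lemma okact_mono: "okact k a m \<Longrightarrow> a \<le> b \<Longrightarrow> okact k b m"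
  by (fastforce simp: okact_def)

lemma trans_step_compile:
  assumes q: "q \<ge> 3" and m: "mstep e S q (rd k \<sigma>) = (q', m)" and q': "q' < card S + 5"
    and ok: "okact k (max a (card S)) m" and sm: "small_syms (max a (card S)) \<sigma>"
  shows "trans_step (compile k a e S c) (cf q \<sigma>) (cf q' (upd \<sigma> m))"
proof -
  let ?syms = "map (\<lambda>t. cur (\<sigma> t)) [0..<k]"
  let ?res = "raw k (q', m) ?syms"
  have r: "(\<lambda>t. if t < k then ?syms ! t else 0) = rd k \<sigma>"
    by (auto simp: rd_def fun_eq_iff)
  have s: "cur (\<sigma> t) < max a (card S)" for t
    using sm by (simp only: small_syms_def cur_def)
  have "wfres (card S + 5) k (max a (card S)) ?res"
    using q' ok s unfolding wfres_def raw_def okact_def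
    by (auto split: option.splits)
  then have d: "?res \<in> delta (compile k a e S c) q ?syms"
    unfolding compile_def using m r by simp
  have tpe: "(\<lambda>t. fst (upd \<sigma> m t)) = (\<lambda>t p. if t < k \<and> p = snd (\<sigma> t) then fst (snd ?res) ! t else fst (\<sigma> t) p)"
    using ok by (auto simp: fun_eq_iff upd_def act_def raw_def okact_def cur_def split: option.splits)
  have hde: "(\<lambda>t. snd (upd \<sigma> m t)) = (\<lambda>t. if t < k then nat (int (snd (\<sigma> t)) + snd (snd ?res) ! t) else snd (\<sigma> t))"
    using ok by (auto simp: fun_eq_iff upd_def act_def raw_def okact_def cur_def split: option.splits)
  show ?thesis
    unfolding trans_step_def cf_sel compile_sel
    using q d tpe hde
    by (intro conjI exI[of _ "fst (snd ?res)"] exI[of _ "snd (snd ?res)"]) (auto simp: raw_def cur_def)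
qed

lemma upd_empty [simp]: "upd \<sigma> Map.empty = \<sigma>"
  by (auto simp: upd_def)

lemma upd_update [simp]: "upd \<sigma> (m(v \<mapsto> wd)) = (upd \<sigma> m)(v := act wd (\<sigma> v))"
  by (auto simp: upd_def)

lemma okact_empty [simp]: "okact k a Map.empty"
  by (auto simp: okact_def)

lemma okact_update [intro]: "okact k a m \<Longrightarrow> v < k \<Longrightarrow> w < a \<Longrightarrow> d \<in> {-1, 0, 1} \<Longrightarrow> okact k a (m(v \<mapsto> (w, d)))"
  by (auto simp: okact_def)

lemma answer_step_cf:
  "answer_step M A (cf q \<sigma>) = cf (if word_of (\<sigma> 1) \<in> A then yes M else no M) (\<sigma>(1 := blank))"
  by (auto simp: answer_step_def cf_def query_word_def word_of_def blank_def fun_eq_iff)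

text \<open>Induction on the derivation, with the stack \<open>C\<close> and the time and query
  counts so far left arbitrary: executing \<open>c\<close> pops it off the stack. Generality in
  \<open>C\<close> lets loop bodies and first halves of sequences be treated as calls.\<close>

lemma reach_compile:
  assumes inj: "inj_on e S" and rng: "\<And>C. C \<in> S \<Longrightarrow> e C < card S" and k: "k \<ge> 3"
    and b: "big k a A c \<sigma> t q \<sigma>'"
  shows "a \<ge> 3 \<Longrightarrow> conts c C \<subseteq> S \<Longrightarrow> small_syms (max a (card S)) \<sigma> \<Longrightarrow>
     reach (compile k a e S c0) A x n q0 (cf (e (c # C) + 5) \<sigma>) \<Longrightarrow>
     reach (compile k a e S c0) A x (n + t) (q0 + q) (cf (e C + 5) \<sigma>') \<and> small_syms (max a (card S)) \<sigma>'"
  using b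
proof (induction arbitrary: C n q0 rule: big.induct)
  case (big_Act f \<sigma>)
  let ?M = "compile k a e S c0" and ?a = "max a (card S)"
  have S: "Act f # C \<in> S" "C \<in> S" using big_Act by auto
  have ok: "okact k ?a (f (rd k \<sigma>))" using okact_mono[OF big_Act(1)] by simp
  have "trans_step ?M (cf (e (Act f # C) + 5) \<sigma>) (cf (e C + 5) (upd \<sigma> (f (rd k \<sigma>))))"
    by (rule trans_step_compile) (use big_Act S ok inj rng in \<open>auto simp: mstep_def\<close>)
  from reach_trans[OF big_Act(5) this] show ?case using small_syms_upd[OF big_Act(4) ok] by simp
next
  case (big_Ask \<sigma>)
  let ?M = "compile k a e S c0" and ?a = "max a (card S)"
  let ?\<sigma>1 = "upd \<sigma> [2 \<mapsto> (e C, 0)]"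
  let ?y = "if word_of (\<sigma> 1) \<in> A then 1 else 2 :: nat"
  let ?s = "if word_of (\<sigma> 1) \<in> A then 3 else 4 :: nat"
  have S: "Ask # C \<in> S" "C \<in> S" using big_Ask by auto
  have ok: "okact k ?a [2 \<mapsto> (e C, 0)]" using k rng[OF S(2)] by (intro okact_update) auto
  have ok2: "okact k ?a [2 \<mapsto> (?y, 0)]" using k big_Ask(1) by (intro okact_update) auto
  have "trans_step ?M (cf (e (Ask # C) + 5) \<sigma>) (cf 2 ?\<sigma>1)"
    by (rule trans_step_compile) (use big_Ask S ok inj rng in \<open>auto simp: mstep_def\<close>)
  from reach_trans[OF big_Ask(4) this] have r1: "reach ?M A x (Suc n) q0 (cf 2 ?\<sigma>1)" .
  have sm1: "small_syms ?a ?\<sigma>1" using small_syms_upd[OF big_Ask(3) ok] .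
  from reach_query[OF r1] have r2: "reach ?M A x (Suc (Suc n)) (Suc q0) (cf ?s (?\<sigma>1(1 := blank)))"
    by (auto simp: answer_step_cf split: if_splits)
  have sm2: "small_syms ?a (?\<sigma>1(1 := blank))"
    using sm1 big_Ask(1) unfolding small_syms_def by (auto simp: blank_def)
  have rd2: "rd k (?\<sigma>1(1 := blank)) 2 = e C" using k by (auto simp: rd_def cur_def act_def)
  have "trans_step ?M (cf ?s (?\<sigma>1(1 := blank))) (cf (e C + 5) (upd (?\<sigma>1(1 := blank)) [2 \<mapsto> (?y, 0)]))"
    by (rule trans_step_compile) (use ok2 rng S sm2 rd2 in \<open>auto simp: mstep_def split: if_splits\<close>)
  from reach_trans[OF r2 this]
  have r3: "reach ?M A x (n + 3) (q0 + 1) (cf (e C + 5) (upd (?\<sigma>1(1 := blank)) [2 \<mapsto> (?y, 0)]))"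
    by (simp add: numeral_3_eq_3)
  \<comment> \<open>The answer overwrites the saved return address in the same cell of tape 2, so
    the detour leaves no trace in the store.\<close>
  have eq: "upd (?\<sigma>1(1 := blank)) [2 \<mapsto> (?y, 0)] = \<sigma>(1 := blank, 2 := act (?y, 0) (\<sigma> 2))"
    by (rule ext) (simp add: act_def)
  show ?case using r3 small_syms_upd[OF sm2 ok2] unfolding eq by blast
next
  case (big_Then c \<sigma> t q \<sigma>' c' t' q' \<sigma>'')
  let ?M = "compile k a e S c0" and ?a = "max a (card S)"
  have S: "(c ;; c') # C \<in> S" "c # c' # C \<in> S" using big_Then.prems conts_self[of c "c' # C"] by auto
  have "trans_step ?M (cf (e ((c ;; c') # C) + 5) \<sigma>) (cf (e (c # c' # C) + 5) (upd \<sigma> Map.empty))"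
    by (rule trans_step_compile) (use big_Then.prems S inj rng in \<open>auto simp: mstep_def\<close>)
  from reach_trans[OF big_Then.prems(4) this]
  have "reach ?M A x (Suc n) q0 (cf (e (c # c' # C) + 5) \<sigma>)" by simp
  from big_Then.IH(1)[OF _ _ _ this] big_Then.prems
  have 1: "reach ?M A x (Suc n + t) (q0 + q) (cf (e (c' # C) + 5) \<sigma>')" and
     2: "small_syms ?a \<sigma>'" by auto
  from big_Then.IH(2)[OF _ _ 2 1] big_Then.prems show ?case by (auto simp: ac_simps)
next
  case (big_Cond P \<sigma> c c' t q \<sigma>')
  let ?M = "compile k a e S c0"
  let ?c = "if P (rd k \<sigma>) then c else c'"
  have S: "Cond P c c' # C \<in> S" "?c # C \<in> S" "conts ?c C \<subseteq> S"
    using big_Cond.prems conts_self[of c "C"] conts_self[of c' "C"] by auto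
  have "trans_step ?M (cf (e (Cond P c c' # C) + 5) \<sigma>) (cf (e (?c # C) + 5) (upd \<sigma> Map.empty))"
    by (rule trans_step_compile) (use big_Cond.prems S inj rng in \<open>auto simp: mstep_def\<close>)
  from reach_trans[OF big_Cond.prems(4) this]
  have "reach ?M A x (Suc n) q0 (cf (e (?c # C) + 5) \<sigma>)" by simp
  from big_Cond.IH[OF _ S(3) _ this] big_Cond.prems show ?case by auto
next
  case (big_Loop_end P \<sigma> c)
  let ?M = "compile k a e S c0"
  have S: "Loop P c # C \<in> S" "C \<in> S" using big_Loop_end.prems by auto
  have "trans_step ?M (cf (e (Loop P c # C) + 5) \<sigma>) (cf (e C + 5) (upd \<sigma> Map.empty))"
    by (rule trans_step_compile) (use big_Loop_end S inj rng in \<open>auto simp: mstep_def\<close>)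
  from reach_trans[OF big_Loop_end.prems(4) this] big_Loop_end.prems show ?case by simp
next
  case (big_Loop_step P \<sigma> c t q \<sigma>' t' q' \<sigma>'')
  let ?M = "compile k a e S c0" and ?a = "max a (card S)"
  have S: "Loop P c # C \<in> S" "c # Loop P c # C \<in> S"
    using big_Loop_step.prems conts_self[of c "Loop P c # C"] by auto
  have "trans_step ?M (cf (e (Loop P c # C) + 5) \<sigma>) (cf (e (c # Loop P c # C) + 5) (upd \<sigma> Map.empty))"
    by (rule trans_step_compile) (use big_Loop_step S inj rng in \<open>auto simp: mstep_def\<close>)
  from reach_trans[OF big_Loop_step.prems(4) this]
  have "reach ?M A x (Suc n) q0 (cf (e (c # Loop P c # C) + 5) \<sigma>)" by simp
  from big_Loop_step.IH(1)[OF _ _ _ this] big_Loop_step.prems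
  have 1: "reach ?M A x (Suc n + t) (q0 + q) (cf (e (Loop P c # C) + 5) \<sigma>')" and
     2: "small_syms ?a \<sigma>'" by auto
  from big_Loop_step.IH(2)[OF _ _ 2 1] big_Loop_step.prems show ?case by (auto simp: ac_simps)
qed

section \<open>Uniqueness of deterministic runs\<close>

lemma trans_step_unique:
  assumes "deterministic M" "trans_step M c c1" "trans_step M c c2"
  shows "c1 = c2"
proof -
  let ?s = "delta M (st c) (map (\<lambda>t. tp c t (conf.hd c t)) [0..<ntapes M])"
  obtain ws mv where 1: "(st c1, ws, mv) \<in> ?s"
    "tp c1 = (\<lambda>t p. if t < ntapes M \<and> p = conf.hd c t then ws ! t else tp c t p)"
    "conf.hd c1 = (\<lambda>t. if t < ntapes M then nat (int (conf.hd c t) + mv ! t) else conf.hd c t)"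
    using assms(2) unfolding trans_step_def by blast
  obtain ws' mv' where 2: "(st c2, ws', mv') \<in> ?s"
    "tp c2 = (\<lambda>t p. if t < ntapes M \<and> p = conf.hd c t then ws' ! t else tp c t p)"
    "conf.hd c2 = (\<lambda>t. if t < ntapes M then nat (int (conf.hd c t) + mv' ! t) else conf.hd c t)"
    using assms(3) unfolding trans_step_def by blast
  have "(st c1, ws, mv) = (st c2, ws', mv')"
    using assms(1) 1(1) 2(1) unfolding deterministic_def by blast
  then show ?thesis using 1 2 by (intro conf.equality) auto
qed

lemma reach_zero: "reach M A x n q c \<Longrightarrow> n = 0 \<Longrightarrow> q = 0 \<and> c = init_conf M x"
  by (induction rule: reach.induct) auto

lemma reach_unique:
  assumes "deterministic M" "reach M A x n q c"
  shows "reach M A x n q' c' \<Longrightarrow> q = q' \<and> c = c'"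
  using assms(2)
proof (induction arbitrary: q' c' rule: reach.induct)
  case reach_init
  then show ?case using reach_zero by metis
next
  case (reach_trans n q c c1)
  from reach_trans.prems show ?case
  proof (cases rule: reach.cases)
    case (reach_trans c2)
    with reach_trans.IH \<open>trans_step M c c1\<close> assms(1) show ?thesis by (metis trans_step_unique)
  next
    case (reach_query q2 c2)
    with reach_trans.IH \<open>trans_step M c c1\<close> show ?thesis unfolding trans_step_def by blast
  qed
next
  case (reach_query n q c)
  from reach_query.prems show ?case
  proof (cases rule: reach.cases)
    case (reach_trans c2)
    with reach_query.IH \<open>st c = qry M\<close> show ?thesis unfolding trans_step_def by blast
  next
    case (reach_query q2 c2)
    with reach_query.IH show ?thesis by blast
  qed
qed

text \<open>The run is a single line and a halting configuration has no successor, so it comes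
  last.\<close>

lemma reach_halted_last:
  assumes d: "deterministic M" and wf: "wf_otm M" and h: "reach M A x n q c" "st c = acc M \<or> st c = rej M"
  shows "reach M A x n' q' c' \<Longrightarrow> n' \<le> n \<and> q' \<le> q"
proof (induction rule: reach.induct)
  case (reach_trans n1 q1 c1 c2)
  then have "n1 \<noteq> n" using reach_unique[OF d h(1)] h(2) unfolding trans_step_def by blast
  with reach_trans show ?case by auto
next
  case (reach_query n1 q1 c1)
  then have "n1 \<noteq> n" using reach_unique[OF d h(1)] h(2) wf unfolding wf_otm_def by fastforce
  then have "Suc n1 \<le> n" using reach_query by auto
  \<comment> \<open>The query counter never decreases along the unique run, so at any time after
    step \<open>n1\<close> it includes the query made there.\<close>
  moreover have "Suc q1 \<le> q" if "reach M A x n q c" "n \<ge> Suc n1" for n q c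
    using that
  proof (induction rule: reach.induct)
    case (reach_trans n q c c')
    show ?case
    proof (cases "n = n1")
      case True
      then show ?thesis using reach_unique[OF d reach_query(1)] reach_trans reach_query(2) unfolding trans_step_def by blast
    next
      case False then show ?thesis using reach_trans by auto
    qed
  next
    case (reach_query n q c)
    then show ?case using reach_unique[OF d \<open>reach M A x n1 q1 c1\<close>] by (cases "n = n1") auto
  qed auto
  ultimately show ?case using h(1) by blast
qed auto

text \<open>\<open>M\<close> is fixed before the oracle, the input and the outcome are given. The
  extra step is the final transition from the empty stack to the verdict.\<close>

theorem compile_correct:
  assumes k: "k \<ge> 3" and a: "a \<ge> 3"
  obtains M where "wf_otm M" "deterministic M"
    "\<And>A x t q \<sigma>'. big k a A c (init_store x) t q \<sigma>' \<Longrightarrow>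
        \<exists>cc. reach M A x (Suc t) q cc \<and> st cc = (if cur (\<sigma>' 2) = 1 then acc M else rej M)"
proof -
  let ?S = "conts c []"
  obtain e :: "cmd list \<Rightarrow> nat" and n where e: "e ` ?S = {i. i < n}" "inj_on e ?S"
    using finite_imp_inj_to_nat_seg[OF finite_conts] by metis
  have n: "n = card ?S" using card_image[OF e(2)] e(1) by simp
  have rng: "e C < card ?S" if "C \<in> ?S" for C using e(1) n that by auto
  let ?M = "compile k a e ?S c"
  show ?thesis
  proof (rule that[of ?M])
    show "wf_otm ?M" using wf_compile[OF k a] rng conts_self by blast
    show "deterministic ?M" by (rule deterministic_compile)
    fix A x t q \<sigma>' assume b: "big k a A c (init_store x) t q \<sigma>'"
    have i: "init_conf ?M x = cf (e [c] + 5) (init_store x)"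
      by (auto simp: init_conf_def cf_def init_store_def inp_def blank_def fun_eq_iff)
    have "small_syms (max a (card ?S)) (init_store x)"
      using a by (auto simp: small_syms_def init_store_def inp_def blank_def)
    from reach_compile[OF e(2) rng k b a _ this, of "[]" c x 0 0] reach_init[of ?M A x] i
    have 1: "reach ?M A x t q (cf (e [] + 5) \<sigma>')" and 2: "small_syms (max a (card ?S)) \<sigma>'" by auto
    have "[] \<in> ?S" by (rule conts_rest)
    then have "trans_step ?M (cf (e [] + 5) \<sigma>') (cf (if cur (\<sigma>' 2) = 1 then 0 else 1) (upd \<sigma>' Map.empty))"
      by (intro trans_step_compile) (use k e(2) 2 in \<open>auto simp: mstep_def rd_def\<close>)
    from reach_trans[OF 1 this] show "\<exists>cc. reach ?M A x (Suc t) q cc \<and> st cc = (if cur (\<sigma>' 2) = 1 then acc ?M else rej ?M)"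
      by (auto intro!: exI)
  qed
qed

section \<open>Cost calculus and elementary programs\<close>

locale env =
  fixes k K :: nat and A :: "bool list set"
  assumes k3: "k \<ge> 3" and K3: "K \<ge> 3"
begin

text \<open>The query count is dropped here and recovered later from the program text. The alphabet
  size \<open>2 * K + 2\<close> has room for two copies, plain and flagged, of \<open>K\<close>
  shifted symbols besides the unvisited blank 0.\<close>

definition runs :: "cmd \<Rightarrow> store \<Rightarrow> nat \<Rightarrow> store \<Rightarrow> bool" where
  "runs c \<sigma> T \<sigma>' \<longleftrightarrow> (\<exists>t q. t \<le> T \<and> big k (2 * K + 2) A c \<sigma> t q \<sigma>')"

lemma runs_mono: "runs c \<sigma> T \<sigma>' \<Longrightarrow> T \<le> T' \<Longrightarrow> runs c \<sigma> T' \<sigma>'"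
  by (auto simp: runs_def intro: order_trans)

lemma runs_Act:
  assumes "okact k (2 * K + 2) (f (rd k \<sigma>))" "upd \<sigma> (f (rd k \<sigma>)) = \<sigma>'"
  shows "runs (Act f) \<sigma> 1 \<sigma>'"
  using big_Act[where f = f, OF assms(1)] assms(2) by (auto simp: runs_def)

lemma runs_Ask:
  "runs Ask \<sigma> 3 (\<sigma>(1 := blank, 2 := act (if word_of (\<sigma> 1) \<in> A then 1 else 2, 0) (\<sigma> 2)))"
  unfolding runs_def using big_Ask by blast

lemma runs_Then:
  assumes "runs c \<sigma> T \<sigma>'" "runs c' \<sigma>' T' \<sigma>''"
  shows "runs (c ;; c') \<sigma> (T + T' + 1) \<sigma>''"
proof -
  obtain t q where 1: "t \<le> T" "big k (2 * K + 2) A c \<sigma> t q \<sigma>'" using assms(1) by (auto simp: runs_def)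
  obtain t' q' where 2: "t' \<le> T'" "big k (2 * K + 2) A c' \<sigma>' t' q' \<sigma>''" using assms(2) by (auto simp: runs_def)
  have "1 + t + t' \<le> T + T' + 1" using 1(1) 2(1) by simp
  then show ?thesis using big_Then[OF 1(2) 2(2)] unfolding runs_def by blast
qed

lemma runs_Cond:
  assumes "runs (if P (rd k \<sigma>) then c else c') \<sigma> T \<sigma>'"
  shows "runs (Cond P c c') \<sigma> (T + 1) \<sigma>'"
proof -
  obtain t q where 1: "t \<le> T" "big k (2 * K + 2) A (if P (rd k \<sigma>) then c else c') \<sigma> t q \<sigma>'"
    using assms(1) by (auto simp: runs_def)
  show ?thesis using big_Cond[where P = P, OF 1(2)] 1(1) unfolding runs_def by (metis add.commute add_le_mono1)
qed

lemma runs_Loop_end: "\<not> P (rd k \<sigma>) \<Longrightarrow> runs (Loop P c) \<sigma> 1 \<sigma>"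
  using big_Loop_end unfolding runs_def by blast

lemma runs_Loop_step:
  assumes "P (rd k \<sigma>)" "runs c \<sigma> T \<sigma>'" "runs (Loop P c) \<sigma>' T' \<sigma>''"
  shows "runs (Loop P c) \<sigma> (T + T' + 1) \<sigma>''"
proof -
  obtain t q where 1: "t \<le> T" "big k (2 * K + 2) A c \<sigma> t q \<sigma>'" using assms(2) by (auto simp: runs_def)
  obtain t' q' where 2: "t' \<le> T'" "big k (2 * K + 2) A (Loop P c) \<sigma>' t' q' \<sigma>''" using assms(3) by (auto simp: runs_def)
  have "1 + t + t' \<le> T + T' + 1" using 1(1) 2(1) by simp
  then show ?thesis using big_Loop_step[OF assms(1) 1(2) 2(2)] unfolding runs_def by blast
qed

lemma runs_Loop_inv:
  assumes step: "\<And>i \<sigma>. i < n \<Longrightarrow> I i \<sigma> \<Longrightarrow> P (rd k \<sigma>) \<and> (\<exists>\<sigma>'. runs c \<sigma> T \<sigma>' \<and> I (Suc i) \<sigma>')"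
    and fin: "\<And>\<sigma>. I n \<sigma> \<Longrightarrow> \<not> P (rd k \<sigma>)"
    and init: "I 0 \<sigma>"
  shows "\<exists>\<sigma>'. runs (Loop P c) \<sigma> (n * (T + 1) + 1) \<sigma>' \<and> I n \<sigma>'"
proof -
  have "I (n - j) \<sigma> \<Longrightarrow> j \<le> n \<Longrightarrow> \<exists>\<sigma>'. runs (Loop P c) \<sigma> (j * (T + 1) + 1) \<sigma>' \<and> I n \<sigma>'" for j \<sigma>
  proof (induction j arbitrary: \<sigma>)
    case 0
    then show ?case using fin runs_Loop_end[of P \<sigma> c] by auto
  next
    case (Suc j)
    from step[OF _ Suc.prems(1)] Suc.prems(2) obtain \<sigma>1 where
      1: "P (rd k \<sigma>)" "runs c \<sigma> T \<sigma>1" "I (Suc (n - Suc j)) \<sigma>1" by auto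
    have "I (n - j) \<sigma>1" using 1(3) Suc.prems(2) by (simp add: Suc_diff_Suc)
    with Suc.IH Suc.prems(2) obtain \<sigma>' where 2: "runs (Loop P c) \<sigma>1 (j * (T + 1) + 1) \<sigma>'" "I n \<sigma>'" by auto
    have "runs (Loop P c) \<sigma> (Suc j * (T + 1) + 1) \<sigma>'"
      using runs_Loop_step[OF 1(1,2) 2(1)] by (rule runs_mono) simp
    then show ?case using 2(2) by blast
  qed
  from this[of n] init show ?thesis by simp
qed

lemma runs_Loop_count:
  assumes "\<And>i. i < n \<Longrightarrow> P (rd k (s i))" "\<And>i. i < n \<Longrightarrow> runs c (s i) T (s (Suc i))" "\<not> P (rd k (s n))"
  shows "runs (Loop P c) (s 0) (n * (T + 1) + 1) (s n)"
  using runs_Loop_inv[of n "\<lambda>i \<sigma>. \<sigma> = s i" P c T "s 0"] assms by auto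

text \<open>For loops whose number of rounds is not known beforehand: each round lowers the measure
  by an unspecified amount, so its initial value bounds the number of rounds.\<close>

lemma runs_Loop_measure:
  assumes step: "\<And>m \<sigma>. I m \<sigma> \<Longrightarrow> P (rd k \<sigma>) \<Longrightarrow> \<exists>\<sigma>'. runs c \<sigma> T \<sigma>' \<and> (\<exists>m' < m. I m' \<sigma>')"
    and init: "I (m :: nat) \<sigma>"
  shows "\<exists>\<sigma>'. runs (Loop P c) \<sigma> (m * (T + 1) + 1) \<sigma>' \<and> (\<exists>m'. I m' \<sigma>') \<and> \<not> P (rd k \<sigma>')"
  using init
proof (induction m arbitrary: \<sigma> rule: less_induct)
  case (less m)
  show ?case
  proof (cases "P (rd k \<sigma>)")
    case False
    then show ?thesis using runs_mono[OF runs_Loop_end[of P \<sigma> c, OF False]] less(2) by (meson le_add2)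
  next
    case True
    from step[OF less(2) True] obtain \<sigma>1 m' where 1: "runs c \<sigma> T \<sigma>1" "I m' \<sigma>1" "m' < m" by blast
    from less(1)[OF 1(3,2)] obtain \<sigma>' where 2: "runs (Loop P c) \<sigma>1 (m' * (T + 1) + 1) \<sigma>'" "\<exists>m'. I m' \<sigma>'" "\<not> P (rd k \<sigma>')" by blast
    have "Suc m' * (T + 1) \<le> m * (T + 1)" using 1(3) by (intro mult_le_mono1) simp
    then have "runs (Loop P c) \<sigma> (m * (T + 1) + 1) \<sigma>'"
      by (intro runs_mono[OF runs_Loop_step[of P \<sigma>, OF True 1(1) 2(1)]]) simp
    then show ?thesis using 2 by blast
  qed
qed

lemma rd_simp [simp]: "v < k \<Longrightarrow> rd k \<sigma> v = cur (\<sigma> v)"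
  by (simp add: rd_def)

lemma cur_pair [simp]: "cur (g, h) = g h"
  by (simp add: cur_def)

lemma act_keep [simp]: "act (cur s, d) s = (fst s, nat (int (snd s) + d))"
  by (simp add: act_def cur_def)

lemma pred: "i < h \<Longrightarrow> nat (int h - int i - 1) = h - Suc i"
  by arith

lemma cur_act0 [simp]: "cur (act (w, 0) s) = w"
  by (simp add: act_def cur_def)

lemma act_pair: "act (w, d) (g, h) = (g(h := w), nat (int h + d))"
  by (simp add: act_def)

text \<open>Work tapes are kept in a format that allows them to be erased: cell 0 is flagged
  (its symbol exceeds K), the cells visited so far carry nonzero symbols.\<close>

definition dec :: "nat \<Rightarrow> nat" where
  "dec v = (if v = 0 then 0 else if v \<le> K then v - 1 else v - 1 - K)"

text \<open>The first argument is the symbol being overwritten, of which only the flag survives. The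
  shift by one distinguishes a visited blank from a cell never visited.\<close>

definition enc :: "nat \<Rightarrow> nat \<Rightarrow> nat" where
  "enc v s = (if v > K then s + 1 + K else s + 1)"

lemma dec_enc [simp]: "s < K \<Longrightarrow> dec (enc v s) = s"
  by (auto simp: dec_def enc_def)

lemma dec_0 [simp]: "dec 0 = 0" by (simp add: dec_def)

lemma enc_less: "s < K \<Longrightarrow> enc v s \<le> 2 * K"
  by (auto simp: enc_def)

lemma enc_flag [simp]: "s < K \<Longrightarrow> enc v s > K \<longleftrightarrow> v > K"
  by (auto simp: enc_def)

lemma enc_nonzero [simp]: "enc v s \<noteq> 0" "0 < enc v s"
  by (auto simp: enc_def)

definition tok :: "(nat \<Rightarrow> nat) \<Rightarrow> nat \<Rightarrow> bool" where
  "tok g e \<longleftrightarrow> e \<ge> 1 \<and> (\<forall>p. g p \<le> 2 * K \<and> (g p \<noteq> 0 \<longleftrightarrow> p < e) \<and> (g p > K \<longleftrightarrow> p = 0))"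

lemma tok_write:
  assumes "tok g e" "h \<le> e" "s < K"
  shows "tok (g(h := enc (g h) s)) (max e (h + 1))"
  using assms enc_less[OF assms(3)] by (auto simp: tok_def max_def)

definition fresh :: "nat \<Rightarrow> nat" where
  "fresh p = (if p = 0 then K + 1 else 0)"

lemma tok_fresh: "tok fresh 1"
  using K3 by (auto simp: tok_def fresh_def)

lemma dec_fresh [simp]: "dec (fresh p) = 0"
  by (simp add: fresh_def dec_def)

lemma tok_le: "tok g e \<Longrightarrow> g p \<le> 2 * K"
  by (simp add: tok_def)

lemma tok_flag: "tok g e \<Longrightarrow> g p \<le> K \<longleftrightarrow> p \<noteq> 0"
  unfolding tok_def by (metis not_less)

lemma tok_zero: "tok g e \<Longrightarrow> g p = 0 \<longleftrightarrow> e \<le> p"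
  unfolding tok_def by (metis not_less)

lemma tok_less: "tok g e \<Longrightarrow> g p < 2 * K + 2"
  using tok_le[of g e p] by simp

text \<open>A left move on cell 0 has no visible effect; it is the flag that ends the loop.\<close>

definition rew :: "nat \<Rightarrow> cmd" where
  "rew v = Loop (\<lambda>r. r v \<le> K) (Act (\<lambda>r. [v \<mapsto> (r v, -1)]))"

lemma runs_rew:
  assumes "v < k" "tok g e" "\<sigma> v = (g, h)"
  shows "runs (rew v) \<sigma> (2 * h + 1) (\<sigma>(v := (g, 0)))"
proof -
  have "runs (rew v) (\<sigma>(v := (g, h - 0))) (h * (1 + 1) + 1) (\<sigma>(v := (g, h - h)))"
    unfolding rew_def
  proof (rule runs_Loop_count)
    show "runs (Act (\<lambda>r. [v \<mapsto> (r v, - 1)])) (\<sigma>(v := (g, h - i))) 1 (\<sigma>(v := (g, h - Suc i)))" if "i < h" for i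
    proof (rule runs_Act)
      show "okact k (2 * K + 2) [v \<mapsto> (rd k (\<sigma>(v := (g, h - i))) v, - 1)]"
        using assms tok_less[OF assms(2)] by (auto intro!: okact_update)
      show "upd (\<sigma>(v := (g, h - i))) [v \<mapsto> (rd k (\<sigma>(v := (g, h - i))) v, - 1)] = \<sigma>(v := (g, h - Suc i))"
        using assms(1) that pred[OF that] by (simp add: act_pair)
    qed
  qed (use assms in \<open>auto simp: tok_flag\<close>)
  moreover have "\<sigma>(v := (g, h - 0)) = \<sigma>" using assms(3) by auto
  moreover have "h * (1 + 1) + 1 = 2 * h + 1" by simp
  ultimately show ?thesis by (metis diff_self_eq_0)
qed

definition ffwd :: "nat \<Rightarrow> cmd" where
  "ffwd v = Loop (\<lambda>r. r v \<noteq> 0) (Act (\<lambda>r. [v \<mapsto> (r v, 1)]))"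

lemma runs_ffwd:
  assumes "v < k" "tok g e" "\<sigma> v = (g, h)" "h \<le> e"
  shows "runs (ffwd v) \<sigma> (2 * e + 1) (\<sigma>(v := (g, e)))"
proof -
  have "runs (ffwd v) (\<sigma>(v := (g, h + 0))) ((e - h) * (1 + 1) + 1) (\<sigma>(v := (g, h + (e - h))))"
    unfolding ffwd_def
  proof (rule runs_Loop_count)
    show "runs (Act (\<lambda>r. [v \<mapsto> (r v, 1)])) (\<sigma>(v := (g, h + i))) 1 (\<sigma>(v := (g, h + Suc i)))" if "i < e - h" for i
    proof (rule runs_Act)
      show "okact k (2 * K + 2) [v \<mapsto> (rd k (\<sigma>(v := (g, h + i))) v, 1)]"
        using assms tok_less[OF assms(2)] by (auto intro!: okact_update)
      show "upd (\<sigma>(v := (g, h + i))) [v \<mapsto> (rd k (\<sigma>(v := (g, h + i))) v, 1)] = \<sigma>(v := (g, h + Suc i))"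
        using assms(1) by (simp add: act_pair nat_add_distrib)
    qed
  qed (use assms in \<open>auto simp: tok_def\<close>)
  moreover have "\<sigma>(v := (g, h + 0)) = \<sigma>" "h + (e - h) = e" using assms(3,4) by auto
  moreover have "(e - h) * (1 + 1) + 1 \<le> 2 * e + 1" by simp
  ultimately show ?thesis using runs_mono by metis
qed

text \<open>Erasing proceeds from the end of the visited part to the left, so that the flag in cell
  0 is still there to stop it. Cell 0 is then reset to the flagged blank
  \<open>K + 1\<close>.\<close>

definition clr :: "nat \<Rightarrow> cmd" where
  "clr v = ffwd v ;; Loop (\<lambda>r. r v \<le> K) (Act (\<lambda>r. [v \<mapsto> (0, -1)])) ;; Act (\<lambda>r. [v \<mapsto> (K + 1, 0)])"

lemma runs_clr:
  assumes "v < k" "tok g e" "\<sigma> v = (g, h)" "h \<le> e"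
  shows "runs (clr v) \<sigma> (4 * e + 5) (\<sigma>(v := (fresh, 0)))"
proof -
  define G where "G i = (\<lambda>p. if p > e - i then 0 else g p)" for i
  have 1: "runs (Loop (\<lambda>r. r v \<le> K) (Act (\<lambda>r. [v \<mapsto> (0, -1)]))) (\<sigma>(v := (G 0, e - 0))) (e * (1 + 1) + 1) (\<sigma>(v := (G e, e - e)))"
  proof (rule runs_Loop_count)
    show "runs (Act (\<lambda>r. [v \<mapsto> (0, -1)])) (\<sigma>(v := (G i, e - i))) 1 (\<sigma>(v := (G (Suc i), e - Suc i)))" if "i < e" for i
    proof (rule runs_Act)
      have "(G i)(e - i := 0) = G (Suc i)"
      proof
        fix p show "((G i)(e - i := 0)) p = G (Suc i) p"
          using that unfolding G_def fun_upd_def by (cases "p = e - i"; cases "p > e - i") auto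
      qed
      then show "upd (\<sigma>(v := (G i, e - i))) [v \<mapsto> (0, -1)] = \<sigma>(v := (G (Suc i), e - Suc i))"
        using assms(1) that pred[OF that] by (simp add: act_pair)
    qed (use assms in \<open>auto intro!: okact_update\<close>)
  qed (use assms tok_flag[OF assms(2)] in \<open>auto simp: G_def\<close>)
  have 2: "\<sigma>(v := (G 0, e - 0)) = \<sigma>(v := (g, e))"
    using tok_zero[OF assms(2)] by (simp add: G_def if_distrib cong: if_cong) (metis less_imp_le)
  have "(G e)(0 := K + 1) = fresh" by (auto simp: G_def fresh_def)
  then have 3: "runs (Act (\<lambda>r. [v \<mapsto> (K + 1, 0)])) (\<sigma>(v := (G e, e - e))) 1 (\<sigma>(v := (fresh, 0)))"
    using assms(1) by (intro runs_Act) (auto intro!: okact_update simp: act_pair)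
  note runs_Then[OF 1 3, unfolded 2]
  from runs_Then[OF runs_ffwd[of v g e \<sigma> h, OF assms] this]
  have "runs (clr v) \<sigma> ((2 * e + 1) + ((e * (1 + 1) + 1) + 1 + 1) + 1) (\<sigma>(v := (fresh, 0)))"
    unfolding clr_def .
  then show ?thesis by (rule runs_mono) simp
qed

definition skip :: cmd where "skip = Act (\<lambda>_. Map.empty)"

lemma runs_skip: "runs skip \<sigma> 1 \<sigma>"
  unfolding skip_def by (rule runs_Act) auto

primrec clrs :: "nat list \<Rightarrow> cmd" where
  "clrs [] = skip"
| "clrs (v # vs) = clr v ;; clrs vs"

lemma runs_clrs:
  assumes "\<And>v. v \<in> set vs \<Longrightarrow> v < k \<and> (\<exists>g h e. \<sigma> v = (g, h) \<and> tok g e \<and> h \<le> e \<and> e \<le> E)"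
  shows "runs (clrs vs) \<sigma> (length vs * (4 * E + 6) + 1) (\<lambda>t. if t \<in> set vs then (fresh, 0) else \<sigma> t)"
  using assms
proof (induction vs arbitrary: \<sigma>)
  case Nil
  then show ?case using runs_skip by simp
next
  case (Cons v vs)
  from Cons.prems[of v] obtain g h e where v: "v < k" "\<sigma> v = (g, h)" "tok g e" "h \<le> e" "e \<le> E" by auto
  have 1: "runs (clr v) \<sigma> (4 * E + 5) (\<sigma>(v := (fresh, 0)))"
    using runs_clr[of v g e \<sigma> h, OF v(1,3,2,4)] by (rule runs_mono) (use v in simp)
  have "E \<ge> 1" using v by (auto simp: tok_def)
  then have 2: "runs (clrs vs) (\<sigma>(v := (fresh, 0))) (length vs * (4 * E + 6) + 1)
      (\<lambda>t. if t \<in> set vs then (fresh, 0) else (\<sigma>(v := (fresh, 0))) t)"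
    using Cons.prems tok_fresh by (intro Cons.IH) (auto intro!: exI)
  have "(\<lambda>t. if t \<in> set (v # vs) then (fresh, 0) else \<sigma> t) =
     (\<lambda>t. if t \<in> set vs then (fresh, 0) else (\<sigma>(v := (fresh, 0))) t)" by auto
  with runs_mono[OF runs_Then[OF 1 2]] show ?case by auto
qed

text \<open>\<open>tr\<close> also receives the symbol being overwritten, so that copying into a
  flagged tape can preserve the flag there.\<close>

definition copy :: "(nat \<Rightarrow> bool) \<Rightarrow> (nat \<Rightarrow> nat \<Rightarrow> nat) \<Rightarrow> nat \<Rightarrow> nat \<Rightarrow> cmd" where
  "copy F tr u v = Loop (\<lambda>r. F (r u)) (Act (\<lambda>r. [v \<mapsto> (tr (r u) (r v), 1), u \<mapsto> (r u, 1)]))"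

lemma runs_copy:
  assumes uv: "u \<noteq> v" "u < k" "v < k" and \<sigma>: "\<sigma> u = (g, 0)" "\<sigma> v = (g0, 0)"
    and n: "\<And>p. p < n \<Longrightarrow> F (g p) \<and> tr (g p) (g0 p) < 2 * K + 2 \<and> g p < 2 * K + 2" "\<not> F (g n)"
  shows "runs (copy F tr u v) \<sigma> (2 * n + 1) (\<sigma>(u := (g, n), v := (\<lambda>p. if p < n then tr (g p) (g0 p) else g0 p, n)))"
proof -
  define s where "s i = \<sigma>(u := (g, i), v := (\<lambda>p. if p < i then tr (g p) (g0 p) else g0 p, i))" for i
  have "runs (copy F tr u v) (s 0) (n * (1 + 1) + 1) (s n)"
    unfolding copy_def
  proof (rule runs_Loop_count)
    show "runs (Act (\<lambda>r. [v \<mapsto> (tr (r u) (r v), 1), u \<mapsto> (r u, 1)])) (s i) 1 (s (Suc i))" if "i < n" for i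
    proof (rule runs_Act)
      have "(\<lambda>p. if p < i then tr (g p) (g0 p) else g0 p)(i := tr (g i) (g0 i)) = (\<lambda>p. if p < Suc i then tr (g p) (g0 p) else g0 p)"
        by (auto simp: less_Suc_eq)
      then show "upd (s i) [v \<mapsto> (tr (rd k (s i) u) (rd k (s i) v), 1), u \<mapsto> (rd k (s i) u, 1)] = s (Suc i)"
        using uv by (simp add: s_def act_pair nat_add_distrib fun_upd_twist)
      show "okact k (2 * K + 2) [v \<mapsto> (tr (rd k (s i) u) (rd k (s i) v), 1), u \<mapsto> (rd k (s i) u, 1)]"
        using uv n(1)[OF that] by (auto simp: s_def intro!: okact_update)
    qed
  qed (use uv n in \<open>auto simp: s_def\<close>)
  moreover have "s 0 = \<sigma>" using \<sigma> by (auto simp: s_def)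
  moreover have "n * (1 + 1) + 1 = 2 * n + 1" by simp
  ultimately have "runs (copy F tr u v) \<sigma> (2 * n + 1) (s n)" by metis
  then show ?thesis by (simp only: s_def)
qed

end

section \<open>Step-by-step simulation of machines\<close>

definition syms :: "otm \<Rightarrow> conf \<Rightarrow> nat list" where
  "syms M c = map (\<lambda>t. tp c t (conf.hd c t)) [0..<ntapes M]"

definition trans_to :: "otm \<Rightarrow> nat \<times> nat list \<times> int list \<Rightarrow> conf \<Rightarrow> conf" where
  "trans_to M r c = \<lparr> st = fst r,
     tp = (\<lambda>t p. if t < ntapes M \<and> p = conf.hd c t then fst (snd r) ! t else tp c t p),
     hd = (\<lambda>t. if t < ntapes M then nat (int (conf.hd c t) + snd (snd r) ! t) else conf.hd c t) \<rparr>"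

lemma trans_to_sel [simp]: "st (trans_to M r c) = fst r"
  "tp (trans_to M r c) = (\<lambda>t p. if t < ntapes M \<and> p = conf.hd c t then fst (snd r) ! t else tp c t p)"
  "conf.hd (trans_to M r c) = (\<lambda>t. if t < ntapes M then nat (int (conf.hd c t) + snd (snd r) ! t) else conf.hd c t)"
  by (auto simp: trans_to_def)

lemma trans_step_iff:
  "trans_step M c c' \<longleftrightarrow> st c \<notin> {acc M, rej M, qry M} \<and> (\<exists>r \<in> delta M (st c) (syms M c). c' = trans_to M r c)"
  (is "?L \<longleftrightarrow> ?R")
proof
  assume ?L
  then obtain ws mv where 1: "st c \<notin> {acc M, rej M, qry M}" "(st c', ws, mv) \<in> delta M (st c) (syms M c)"
    "tp c' = (\<lambda>t p. if t < ntapes M \<and> p = conf.hd c t then ws ! t else tp c t p)"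
    "conf.hd c' = (\<lambda>t. if t < ntapes M then nat (int (conf.hd c t) + mv ! t) else conf.hd c t)"
    unfolding trans_step_def syms_def by blast
  then have "c' = trans_to M (st c', ws, mv) c" by (intro conf.equality) (simp_all cong: if_cong)
  with 1 show ?R by blast
next
  assume ?R
  then obtain r where "st c \<notin> {acc M, rej M, qry M}" "r \<in> delta M (st c) (syms M c)" "c' = trans_to M r c" by blast
  then show ?L unfolding trans_step_def syms_def
    by (intro conjI exI[of _ "fst (snd r)"] exI[of _ "snd (snd r)"]) (simp_all cong: if_cong)
qed

text \<open>A move of M that is chosen by a digit; a stuck machine is sent to its rejecting state.\<close>

definition ostep :: "otm \<Rightarrow> (nat \<Rightarrow> nat list \<Rightarrow> nat \<Rightarrow> (nat \<times> nat list \<times> int list) option) \<Rightarrow>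
    bool list set \<Rightarrow> nat \<Rightarrow> conf \<Rightarrow> conf" where
  "ostep M pick B d c = (if st c = qry M then answer_step M B c
     else case pick (st c) (syms M c) d of None \<Rightarrow> c\<lparr>st := rej M\<rparr> | Some r \<Rightarrow> trans_to M r c)"

text \<open>\<open>ostep\<close> does not stop in a halting state, so the lemmas that relate this
  sequence to runs carry the assumption that all earlier configurations are
  \<open>live\<close>.\<close>

primrec ctr :: "otm \<Rightarrow> (nat \<Rightarrow> nat list \<Rightarrow> nat \<Rightarrow> (nat \<times> nat list \<times> int list) option) \<Rightarrow>
    bool list set \<Rightarrow> (nat \<Rightarrow> nat) \<Rightarrow> conf \<Rightarrow> nat \<Rightarrow> conf" where
  "ctr M pick B ds c 0 = c"
| "ctr M pick B ds c (Suc i) = ostep M pick B (ds i) (ctr M pick B ds c i)"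

lemma ctr_cong: "(\<And>i. i < n \<Longrightarrow> ds i = ds' i) \<Longrightarrow> ctr M pick B ds c n = ctr M pick B ds' c n"
  by (induction n) auto

abbreviation "itr M pick B ds x \<equiv> ctr M pick B ds (init_conf M x)"

definition live :: "otm \<Rightarrow> conf \<Rightarrow> bool" where
  "live M c \<longleftrightarrow> st c \<noteq> acc M \<and> st c \<noteq> rej M"

definition sound_pick :: "otm \<Rightarrow> (nat \<Rightarrow> nat list \<Rightarrow> nat \<Rightarrow> (nat \<times> nat list \<times> int list) option) \<Rightarrow> bool" where
  "sound_pick M pick \<longleftrightarrow> (\<forall>q s d r. pick q s d = Some r \<longrightarrow> r \<in> delta M q s)"

text \<open>The second alternative is a stuck machine: its artificial rejecting configuration need
  not be reachable, but its predecessor is. This accounts for the extra step in the time bounds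
  below.\<close>

lemma ctr_reach:
  assumes pick: "sound_pick M pick" and live: "\<And>i. i < n \<Longrightarrow> live M (itr M pick B ds x i)"
  shows "(\<exists>q. reach M B x n q (itr M pick B ds x n)) \<or>
     (st (itr M pick B ds x n) = rej M \<and> n \<ge> 1 \<and> (\<exists>q c. reach M B x (n - 1) q c))"
  using live
proof (induction n)
  case 0
  then show ?case using reach_init by auto
next
  case (Suc n)
  let ?c = "itr M pick B ds x n"
  from Suc obtain q where q: "reach M B x n q ?c" unfolding live_def by (metis less_Suc_eq)
  show ?case
  proof (cases "st ?c = qry M")
    case True
    then show ?thesis using reach_query[OF q True] by (auto simp: ostep_def)
  next
    case False
    show ?thesis
    proof (cases "pick (st ?c) (syms M ?c) (ds n)")
      case None
      then show ?thesis using False q by (auto simp: ostep_def)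
    next
      case (Some r)
      then have "trans_step M ?c (trans_to M r ?c)"
        using False pick Suc.prems[of n] unfolding trans_step_iff sound_pick_def live_def by blast
      from reach_trans[OF q this] show ?thesis using False Some by (auto simp: ostep_def)
    qed
  qed
qed

lemma ctr_bound:
  assumes "sound_pick M pick" "\<And>i. i < n \<Longrightarrow> live M (itr M pick B ds x i)" "time_bounded M B T"
  shows "n \<le> T (length x) + 1"
proof -
  have "n \<le> T (length x) \<or> n - 1 \<le> T (length x)"
    using ctr_reach[where ds = ds and n = n, OF assms(1,2)] assms(3) unfolding time_bounded_def by meson
  then show ?thesis by auto
qed

lemma ctr_acc:
  assumes "sound_pick M pick" "\<And>i. i < n \<Longrightarrow> live M (itr M pick B ds x i)"
    "st (itr M pick B ds x n) = acc M" "wf_otm M"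
  shows "accepts M B x"
  using ctr_reach[where ds = ds and n = n, OF assms(1,2)] assms(3,4) unfolding accepts_def wf_otm_def by auto

lemma ctr_halts:
  assumes "sound_pick M pick" "time_bounded M B T"
  obtains n where "\<And>i. i < n \<Longrightarrow> live M (itr M pick B ds x i)"
    "\<not> live M (itr M pick B ds x n)" "n \<le> T (length x) + 1"
proof -
  let ?c = "itr M pick B ds x"
  have "\<exists>n. \<not> live M (?c n)"
    using ctr_bound[where ds = ds and n = "T (length x) + 2" and x = x, OF assms(1) _ assms(2)] by force
  then have 1: "\<not> live M (?c (LEAST n. \<not> live M (?c n)))" by (rule LeastI_ex)
  have 2: "live M (?c i)" if "i < (LEAST n. \<not> live M (?c n))" for i using not_less_Least[OF that] by blast
  show ?thesis using that[OF 2 1] ctr_bound[where ds = ds, OF assms(1) 2 assms(2)] by blast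
qed

text \<open>The digits are found along the run. A later digit has no influence on earlier
  configurations, so the sequence is extended by changing it at position \<open>n\<close>.\<close>

lemma reach_ctr:
  assumes complete: "\<And>q s r. r \<in> delta M q s \<Longrightarrow> \<exists>d \<in> V. pick q s d = Some r" and V: "V \<noteq> {}"
    and wf: "wf_otm M"
  shows "reach M B x n q c \<Longrightarrow> \<exists>ds. (\<forall>i. ds i \<in> V) \<and> itr M pick B ds x n = c \<and>
     (\<forall>i < n. live M (itr M pick B ds x i))"
proof (induction rule: reach.induct)
  case reach_init
  from V obtain v where "v \<in> V" by blast
  then show ?case by (auto intro!: exI[of _ "\<lambda>_. v"])
next
  case (reach_trans n q c c')
  then obtain ds where ds: "\<And>i. ds i \<in> V" "itr M pick B ds x n = c"
     "\<And>i. i < n \<Longrightarrow> live M (itr M pick B ds x i)" by blast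
  from reach_trans(2) obtain r where r: "r \<in> delta M (st c) (syms M c)" "c' = trans_to M r c"
    and s: "st c \<notin> {acc M, rej M, qry M}" unfolding trans_step_iff by blast
  from complete[OF r(1)] obtain d where d: "d \<in> V" "pick (st c) (syms M c) d = Some r" by blast
  define ds' where "ds' = ds(n := d)"
  have "itr M pick B ds' x i = itr M pick B ds x i" if "i \<le> n" for i
    using that by (intro ctr_cong) (auto simp: ds'_def)
  moreover have "ds' n = d" "\<And>i. ds' i \<in> V" using ds(1) d(1) by (auto simp: ds'_def)
  moreover have "live M c" using s by (auto simp: live_def)
  ultimately show ?case using ds(2,3) d r s
    by (intro exI[of _ ds']) (simp add: ostep_def less_Suc_eq)
next
  case (reach_query n q c)
  then obtain ds where ds: "\<And>i. ds i \<in> V" "itr M pick B ds x n = c"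
     "\<And>i. i < n \<Longrightarrow> live M (itr M pick B ds x i)" by blast
  have "live M c" using reach_query wf unfolding live_def wf_otm_def by auto
  then show ?case using ds reach_query
    by (intro exI[of _ "ds"]) (auto simp: ostep_def less_Suc_eq)
qed

definition det_pick :: "otm \<Rightarrow> nat \<Rightarrow> nat list \<Rightarrow> nat \<Rightarrow> (nat \<times> nat list \<times> int list) option" where
  "det_pick M q s d = (if delta M q s = {} then None else Some (SOME r. r \<in> delta M q s))"

lemma sound_det_pick: "sound_pick M (det_pick M)"
  unfolding sound_pick_def det_pick_def by (metis option.distinct(1) option.inject some_in_eq)

lemma det_pick_const: "ctr M (det_pick M) B ds c n = ctr M (det_pick M) B ds' c n"
  by (induction n) (auto simp: ostep_def det_pick_def)

lemma reach_det_ctr: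
  assumes "deterministic M" "wf_otm M" "reach M B x n q c"
  shows "itr M (det_pick M) B ds x n = c \<and> (\<forall>i < n. live M (itr M (det_pick M) B ds x i))"
proof -
  have "det_pick M q s 0 = Some r" if "r \<in> delta M q s" for q s r
  proof -
    have "(SOME r'. r' \<in> delta M q s) = r" using that assms(1) unfolding deterministic_def by (metis someI)
    then show ?thesis using that by (auto simp: det_pick_def)
  qed
  from reach_ctr[where V = "{0}" and pick = "det_pick M", OF _ _ assms(2,3)] this
  obtain ds' where "itr M (det_pick M) B ds' x n = c \<and> (\<forall>i < n. live M (itr M (det_pick M) B ds' x i))"
    by blast
  then show ?thesis using det_pick_const[of M B ds _ _ ds'] by metis
qed

lemma det_ctr_accepts:
  assumes "deterministic M" "wf_otm M" "\<And>i. i < n \<Longrightarrow> live M (itr M (det_pick M) B ds x i)"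
    "\<not> live M (itr M (det_pick M) B ds x n)"
  shows "st (itr M (det_pick M) B ds x n) = acc M \<longleftrightarrow> accepts M B x"
proof
  assume "accepts M B x"
  then obtain m q c where c: "reach M B x m q c" "st c = acc M" unfolding accepts_def by blast
  from reach_det_ctr[OF assms(1,2) c(1), of ds]
  have "itr M (det_pick M) B ds x m = c" "\<And>i. i < m \<Longrightarrow> live M (itr M (det_pick M) B ds x i)" by auto
  then have "m = n" using assms(3,4) c(2) unfolding live_def by (metis linorder_neqE_nat)
  then show "st (itr M (det_pick M) B ds x n) = acc M" using c \<open>itr M (det_pick M) B ds x m = c\<close> by simp
qed (use ctr_acc[OF sound_det_pick] assms in blast)

lemma wf_otmD:
  assumes "wf_otm M" "r \<in> delta M q s"
  shows "fst r < nstates M" "length (fst (snd r)) = ntapes M" "length (snd (snd r)) = ntapes M"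
    "\<And>t. t < ntapes M \<Longrightarrow> fst (snd r) ! t < alph M" "\<And>t. t < ntapes M \<Longrightarrow> snd (snd r) ! t \<in> {-1, 0, 1}"
proof -
  obtain q' ws mv where r: "r = (q', ws, mv)" by (cases r)
  have *: "q' < nstates M \<and> length ws = ntapes M \<and> length mv = ntapes M \<and>
        (\<forall>s \<in> set ws. s < alph M) \<and> (\<forall>m \<in> set mv. m \<in> {-1, 0, 1})"
    using assms unfolding wf_otm_def r by blast
  show "fst r < nstates M" "length (fst (snd r)) = ntapes M" "length (snd (snd r)) = ntapes M"
    using * r by auto
  show "fst (snd r) ! t < alph M" "snd (snd r) ! t \<in> {-1, 0, 1}" if "t < ntapes M" for t
    using * r that by (metis fst_conv snd_conv nth_mem)+
qed

section \<open>Simulation of a machine on flagged tapes\<close>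

context env
begin

text \<open>What has to be known of tapes left over from an earlier simulation: they can be erased,
  at a cost bounded through \<open>E\<close>.\<close>

definition grpok :: "nat \<Rightarrow> nat \<Rightarrow> nat \<Rightarrow> store \<Rightarrow> bool" where
  "grpok b n E \<sigma> \<longleftrightarrow> (\<forall>t<n. \<exists>g h e. \<sigma> (b + t) = (g, h) \<and> tok g e \<and> h \<le> e \<and> e \<le> E)"

definition rep :: "otm \<Rightarrow> nat \<Rightarrow> nat \<Rightarrow> conf \<Rightarrow> nat \<Rightarrow> store \<Rightarrow> bool" where
  "rep M b sv c E \<sigma> \<longleftrightarrow> cur (\<sigma> sv) = st c \<and>
     (\<forall>t<ntapes M. \<exists>g e. \<sigma> (b + t) = (g, conf.hd c t) \<and> tok g e \<and> conf.hd c t \<le> e \<and> e \<le> E \<and>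
        (\<lambda>p. dec (g p)) = tp c t)"

lemma rep_grpok: "rep M b sv c E \<sigma> \<Longrightarrow> grpok b (ntapes M) E \<sigma>"
  unfolding rep_def grpok_def by blast

lemma rep_cong: "rep M b sv c E \<sigma> \<Longrightarrow> \<sigma>' sv = \<sigma> sv \<Longrightarrow> (\<And>t. t < ntapes M \<Longrightarrow> \<sigma>' (b + t) = \<sigma> (b + t)) \<Longrightarrow> rep M b sv c E \<sigma>'"
  unfolding rep_def by simp

lemma rep_mono: "rep M b sv c E \<sigma> \<Longrightarrow> E \<le> E' \<Longrightarrow> rep M b sv c E' \<sigma>"
  unfolding rep_def by (meson order_trans)

lemma grpok_cong: "grpok b n E \<sigma> \<Longrightarrow> (\<And>t. t < n \<Longrightarrow> \<sigma>' (b + t) = \<sigma> (b + t)) \<Longrightarrow> grpok b n E \<sigma>'"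
  unfolding grpok_def by simp

lemma grpok_mono: "grpok b n E \<sigma> \<Longrightarrow> E \<le> E' \<Longrightarrow> grpok b n E' \<sigma>"
  unfolding grpok_def by (meson order_trans)

definition grp :: "otm \<Rightarrow> nat \<Rightarrow> nat \<Rightarrow> nat set" where
  "grp M b sv = insert sv {b..<b + ntapes M}"

text \<open>Room for the simulation of M on the tapes b, b+1, ..., with its state on tape sv.\<close>

definition fits :: "otm \<Rightarrow> nat \<Rightarrow> nat \<Rightarrow> bool" where
  "fits M b sv \<longleftrightarrow> wf_otm M \<and> alph M \<le> K \<and> nstates M \<le> K \<and> 3 \<le> b \<and> b + ntapes M \<le> k \<and> 3 \<le> sv \<and> sv < k \<and>
     sv \<notin> {b..<b + ntapes M}"

text \<open>A single action may depend on all scanned symbols and act on all tapes at once. Hence a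
  whole move of the simulated machine, whose state is a symbol on tape \<open>sv\<close>, costs one
  step.\<close>

definition sim :: "otm \<Rightarrow> (nat \<Rightarrow> nat list \<Rightarrow> nat \<Rightarrow> (nat \<times> nat list \<times> int list) option) \<Rightarrow>
    nat \<Rightarrow> nat \<Rightarrow> nat \<Rightarrow> cmd" where
  "sim M pick b sv x = Act (\<lambda>r. case pick (r sv) (map (\<lambda>t. dec (r (b + t))) [0..<ntapes M]) (r x) of
      None \<Rightarrow> [sv \<mapsto> (rej M, 0)]
    | Some res \<Rightarrow> (\<lambda>t. if t = sv then Some (fst res, 0) else if b \<le> t \<and> t < b + ntapes M
        then Some (enc (r t) (fst (snd res) ! (t - b)), snd (snd res) ! (t - b)) else None))"

lemma runs_sim:
  assumes fits: "fits M b sv" and x: "x < k" and pick: "sound_pick M pick"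
    and rep: "rep M b sv c E \<sigma>" and q: "st c \<noteq> qry M"
  shows "\<exists>\<sigma>'. runs (sim M pick b sv x) \<sigma> 1 \<sigma>' \<and> rep M b sv (ostep M pick B (cur (\<sigma> x)) c) (E + 1) \<sigma>' \<and>
     (\<forall>t. t \<notin> grp M b sv \<longrightarrow> \<sigma>' t = \<sigma> t)"
proof -
  have svk: "sv < k" and bk: "b + ntapes M \<le> k" and sv: "sv \<notin> {b..<b + ntapes M}" and wf: "wf_otm M"
    and al: "alph M \<le> K" "nstates M \<le> K"
    using fits unfolding fits_def by auto
  have tapes: "\<exists>g e. \<sigma> (b + t) = (g, conf.hd c t) \<and> tok g e \<and> conf.hd c t \<le> e \<and> e \<le> E \<and> (\<lambda>p. dec (g p)) = tp c t"
    if "t < ntapes M" for t using rep that unfolding rep_def by blast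
  have r1: "rd k \<sigma> sv = st c" "rd k \<sigma> x = cur (\<sigma> x)" using rep svk x unfolding rep_def by auto
  have r2: "map (\<lambda>t. dec (rd k \<sigma> (b + t))) [0..<ntapes M] = syms M c"
    unfolding syms_def
  proof (rule map_cong[OF refl])
    fix t assume "t \<in> set [0..<ntapes M]"
    then have t: "t < ntapes M" by simp
    from tapes[OF t] obtain g e where "\<sigma> (b + t) = (g, conf.hd c t)" "(\<lambda>p. dec (g p)) = tp c t" by blast
    then show "dec (rd k \<sigma> (b + t)) = tp c t (conf.hd c t)" using t bk by (auto dest: fun_cong)
  qed
  show ?thesis
  proof (cases "pick (st c) (syms M c) (cur (\<sigma> x))")
    case None
    have "rej M < K" using wf al unfolding wf_otm_def by auto
    then have "runs (sim M pick b sv x) \<sigma> 1 (\<sigma>(sv := act (rej M, 0) (\<sigma> sv)))"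
      unfolding sim_def using svk None r1 r2 by (intro runs_Act) (auto intro!: okact_update)
    moreover have "rep M b sv (c\<lparr>st := rej M\<rparr>) (E + 1) (\<sigma>(sv := act (rej M, 0) (\<sigma> sv)))"
      using tapes sv unfolding rep_def by (fastforce simp: act_def cur_def)
    ultimately show ?thesis using None q by (auto simp: ostep_def grp_def)
  next
    case (Some res)
    have d: "res \<in> delta M (st c) (syms M c)" using pick Some unfolding sound_pick_def by blast
    note res = wf_otmD[OF wf d]
    let ?m = "\<lambda>t. if t = sv then Some (fst res, 0) else if b \<le> t \<and> t < b + ntapes M
        then Some (enc (rd k \<sigma> t) (fst (snd res) ! (t - b)), snd (snd res) ! (t - b)) else None"
    have wsK: "fst (snd res) ! t < K" if "t < ntapes M" for t using res(4)[OF that] al by simp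
    have "okact k (2 * K + 2) ?m"
      unfolding okact_def
    proof (intro allI impI)
      fix t w e assume a: "?m t = Some (w, e)"
      show "t < k \<and> w < 2 * K + 2 \<and> e \<in> {-1, 0, 1}"
      proof (cases "t = sv")
        case True then show ?thesis using a svk res(1) al by auto
      next
        case False
        then have b: "b \<le> t" "t < b + ntapes M" using a by (auto split: if_splits)
        then have t: "t - b < ntapes M" by auto
        have "enc (rd k \<sigma> t) (fst (snd res) ! (t - b)) < 2 * K + 2" using enc_less[OF wsK[OF t], of "rd k \<sigma> t"] by simp
        then show ?thesis using a False b bk res(5)[OF t] by auto
      qed
    qed
    then have run: "runs (sim M pick b sv x) \<sigma> 1 (upd \<sigma> ?m)"
      unfolding sim_def using r1 r2 Some by (intro runs_Act) auto
    have "\<exists>g e. upd \<sigma> ?m (b + t) = (g, conf.hd (trans_to M res c) t) \<and> tok g e \<and> conf.hd (trans_to M res c) t \<le> e \<and>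
        e \<le> E + 1 \<and> (\<lambda>p. dec (g p)) = tp (trans_to M res c) t" if t: "t < ntapes M" for t
    proof -
      from tapes[OF t] obtain g e where g: "\<sigma> (b + t) = (g, conf.hd c t)" "tok g e" "conf.hd c t \<le> e" "e \<le> E" "(\<lambda>p. dec (g p)) = tp c t" by blast
      let ?h = "conf.hd c t" and ?w = "fst (snd res) ! t"
      have "b + t \<noteq> sv" using sv t by auto
      then have 1: "upd \<sigma> ?m (b + t) = (g(?h := enc (g ?h) ?w), nat (int ?h + snd (snd res) ! t))"
        using t g(1) bk by (simp add: upd_def act_pair)
      \<comment> \<open>The visited part grows by at most one cell per move, whence
        \<open>E + 1\<close>.\<close>
      have 2: "tok (g(?h := enc (g ?h) ?w)) (max e (?h + 1))" using tok_write[OF g(2,3) wsK[OF t]] .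
      have 3: "nat (int ?h + snd (snd res) ! t) \<le> max e (?h + 1)" using res(5)[OF t] g(3) by auto
      have "(\<lambda>p. dec ((g(?h := enc (g ?h) ?w)) p)) = tp (trans_to M res c) t"
      proof
        fix p show "dec ((g(?h := enc (g ?h) ?w)) p) = tp (trans_to M res c) t p"
          using wsK[OF t] t fun_cong[OF g(5), of p] by auto
      qed
      moreover have "conf.hd (trans_to M res c) t = nat (int ?h + snd (snd res) ! t)" using t by simp
      ultimately show ?thesis using 1 2 3 g(3,4) by (intro exI[of _ "g(?h := enc (g ?h) ?w)"] exI[of _ "max e (?h + 1)"]) auto
    qed
    moreover have "cur (upd \<sigma> ?m sv) = fst res" by (simp add: upd_def act_def cur_def)
    ultimately have "rep M b sv (trans_to M res c) (E + 1) (upd \<sigma> ?m)" unfolding rep_def by simp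
    moreover have "\<forall>t. t \<notin> grp M b sv \<longrightarrow> upd \<sigma> ?m t = \<sigma> t" by (auto simp: upd_def grp_def)
    ultimately show ?thesis using run q Some by (auto simp: ostep_def)
  qed
qed

text \<open>Every simulated move also moves the head of an auxiliary tape x to the right. That tape supplies the
  choice digits, or bounds the number of moves by its content (through F), or collects one symbol per move.\<close>

definition adv :: "(nat \<Rightarrow> nat) \<Rightarrow> tape \<Rightarrow> tape" where
  "adv f s = act (f (cur s), 1) s"

definition run :: "otm \<Rightarrow> (nat \<Rightarrow> nat list \<Rightarrow> nat \<Rightarrow> (nat \<times> nat list \<times> int list) option) \<Rightarrow>
    nat \<Rightarrow> nat \<Rightarrow> (nat \<Rightarrow> bool) \<Rightarrow> (nat \<Rightarrow> nat) \<Rightarrow> nat \<Rightarrow> cmd \<Rightarrow> cmd" where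
  "run M pick b sv F f x Q = Loop (\<lambda>r. F (r x) \<and> r sv \<noteq> acc M \<and> r sv \<noteq> rej M)
     (Cond (\<lambda>r. r sv = qry M) Q (sim M pick b sv x) ;; Act (\<lambda>r. [x \<mapsto> (f (r x), 1)]))"

text \<open>The caller supplies the number \<open>n\<close> of moves and shows that the guard holds
  before and fails at it. \<open>J\<close> carries what the query handler \<open>Q\<close> relies
  on; it may depend only on tapes that the simulated moves leave alone. A round costs at most
  \<open>TQ + 4\<close>: the handler or a move, one action on \<open>x\<close>, and three control
  steps.\<close>

lemma runs_run:
  fixes M pick B f s0 c0
  defines "s \<equiv> \<lambda>i. (adv f ^^ i) s0"
  defines "C \<equiv> ctr M pick B (\<lambda>i. cur (s i)) c0"
  assumes fits: "fits M b sv" and x: "x < k" "x \<notin> grp M b sv" and pick: "sound_pick M pick"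
    and Q: "\<And>i \<sigma>. i < n \<Longrightarrow> st (C i) = qry M \<Longrightarrow> rep M b sv (C i) (E + i) \<sigma> \<Longrightarrow> J \<sigma> \<Longrightarrow>
       \<exists>\<sigma>'. runs Q \<sigma> TQ \<sigma>' \<and> rep M b sv (answer_step M B (C i)) (E + i + 1) \<sigma>' \<and> J \<sigma>' \<and> \<sigma>' x = \<sigma> x"
    and J: "\<And>\<sigma> \<sigma>'. J \<sigma> \<Longrightarrow> (\<And>t. t \<notin> grp M b sv \<Longrightarrow> t \<noteq> x \<Longrightarrow> \<sigma>' t = \<sigma> t) \<Longrightarrow> J \<sigma>'"
    and f: "\<And>i. i < n \<Longrightarrow> f (cur (s i)) < 2 * K + 2"
    and go: "\<And>i. i < n \<Longrightarrow> F (cur (s i)) \<and> live M (C i)"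
    and stop: "\<not> (F (cur (s n)) \<and> live M (C n))"
    and init: "rep M b sv c0 E \<sigma>" "\<sigma> x = s0" "J \<sigma>" and TQ: "TQ \<ge> 1"
  shows "\<exists>\<sigma>'. runs (run M pick b sv F f x Q) \<sigma> (n * (TQ + 4) + 1) \<sigma>' \<and> rep M b sv (C n) (E + n) \<sigma>' \<and> \<sigma>' x = s n \<and> J \<sigma>'"
proof -
  let ?Q = "Cond (\<lambda>r. r sv = qry M) Q (sim M pick b sv x)"
  let ?aux = "Act (\<lambda>r. [x \<mapsto> (f (r x), 1)])"
  define I where "I i \<sigma> \<longleftrightarrow> rep M b sv (C i) (E + i) \<sigma> \<and> \<sigma> x = s i \<and> J \<sigma>" for i \<sigma>
  have svk: "sv < k" using fits unfolding fits_def by auto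
  have xsv: "x \<noteq> sv" "\<And>t. t < ntapes M \<Longrightarrow> b + t \<noteq> x" using x unfolding grp_def by auto
  have "\<exists>\<sigma>'. runs (run M pick b sv F f x Q) \<sigma> (n * ((TQ + 3) + 1) + 1) \<sigma>' \<and> I n \<sigma>'"
    unfolding run_def
  proof (rule runs_Loop_inv)
    show "I 0 \<sigma>" using init by (simp add: I_def C_def s_def)
    show "\<not> (F (rd k \<sigma> x) \<and> rd k \<sigma> sv \<noteq> acc M \<and> rd k \<sigma> sv \<noteq> rej M)" if "I n \<sigma>" for \<sigma>
      using that stop x svk unfolding I_def rep_def live_def by auto
    fix i \<sigma> assume i: "i < n" and "I i \<sigma>"
    then have rep: "rep M b sv (C i) (E + i) \<sigma>" and sx: "\<sigma> x = s i" and j: "J \<sigma>" by (auto simp: I_def)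
    have st: "cur (\<sigma> sv) = st (C i)" using rep by (simp add: rep_def)
    have CS: "C (Suc i) = ostep M pick B (cur (s i)) (C i)" by (simp add: C_def)
    have "\<exists>\<sigma>1. runs ?Q \<sigma> (TQ + 1) \<sigma>1 \<and> rep M b sv (C (Suc i)) (E + Suc i) \<sigma>1 \<and> J \<sigma>1 \<and> \<sigma>1 x = \<sigma> x"
    proof (cases "st (C i) = qry M")
      case True
      from Q[OF i True rep j] obtain \<sigma>1 where "runs Q \<sigma> TQ \<sigma>1" "rep M b sv (answer_step M B (C i)) (E + i + 1) \<sigma>1" "J \<sigma>1" "\<sigma>1 x = \<sigma> x" by blast
      moreover have "runs ?Q \<sigma> (TQ + 1) \<sigma>1"
        using calculation st svk True by (intro runs_Cond) auto
      ultimately show ?thesis using CS True by (auto simp: ostep_def)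
    next
      case False
      from runs_sim[where B = B, OF fits x(1) pick rep False] obtain \<sigma>1 where 1: "runs (sim M pick b sv x) \<sigma> 1 \<sigma>1" "rep M b sv (C (Suc i)) (E + Suc i) \<sigma>1"
        "\<And>t. t \<notin> grp M b sv \<Longrightarrow> \<sigma>1 t = \<sigma> t" using CS sx by auto
      have "runs ?Q \<sigma> (TQ + 1) \<sigma>1"
        using runs_mono[OF 1(1) TQ] st svk False by (intro runs_Cond) auto
      moreover have "J \<sigma>1" using J[OF j] 1(3) by blast
      ultimately show ?thesis using 1 x(2) by blast
    qed
    then obtain \<sigma>1 where 1: "runs ?Q \<sigma> (TQ + 1) \<sigma>1"
      "rep M b sv (C (Suc i)) (E + Suc i) \<sigma>1" "J \<sigma>1" "\<sigma>1 x = \<sigma> x" by blast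
    let ?\<sigma>2 = "\<sigma>1(x := adv f (s i))"
    have 2: "runs ?aux \<sigma>1 1 ?\<sigma>2"
      using x(1) 1(4) sx f[OF i] by (intro runs_Act) (auto intro!: okact_update simp: adv_def)
    have "rep M b sv (C (Suc i)) (E + Suc i) ?\<sigma>2" using 1(2) by (rule rep_cong) (use xsv in auto)
    moreover have "J ?\<sigma>2" using 1(3) by (rule J) auto
    ultimately have "I (Suc i) ?\<sigma>2" by (simp add: I_def s_def)
    moreover have "F (rd k \<sigma> x) \<and> rd k \<sigma> sv \<noteq> acc M \<and> rd k \<sigma> sv \<noteq> rej M"
      using go[OF i] sx x svk st unfolding live_def by auto
    ultimately show "(F (rd k \<sigma> x) \<and> rd k \<sigma> sv \<noteq> acc M \<and> rd k \<sigma> sv \<noteq> rej M) \<and> (\<exists>\<sigma>'.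
      runs (?Q ;; ?aux) \<sigma> (TQ + 3) \<sigma>' \<and> I (Suc i) \<sigma>')"
      using runs_mono[OF runs_Then[OF 1(1) 2], of "TQ + 3"] by auto
  qed
  then show ?thesis by (auto simp: I_def ac_simps)
qed

end

lemma inp_Least:
  fixes f :: "nat \<Rightarrow> nat"
  assumes "\<And>p. p < n \<Longrightarrow> f p \<in> {1, 2}" "f n \<notin> {1, 2}"
  shows "(LEAST p. f p \<notin> {1, 2}) = n"
  by (rule Least_equality) (use assms not_le in blast)+

lemma inp_map: "(\<And>p. p < n \<Longrightarrow> f p \<in> {1, 2}) \<Longrightarrow> inp (map (\<lambda>p. f p = 2) [0..<n]) p = (if p < n then f p else 0)"
  by (force simp: inp_def)

section \<open>Loading inputs and answering queries\<close>

context env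
begin

text \<open>The first unvisited cell decodes to a blank and so ends the query word. This is where
  the length of queries gets bounded by the visited part of the tape.\<close>

lemma rep_query_word:
  assumes rep: "rep M b sv c E \<sigma>" and t: "ntapes M \<ge> 2"
  obtains g e n where "\<sigma> (b + 1) = (g, conf.hd c 1)" "tok g e" "conf.hd c 1 \<le> e" "e \<le> E" "n \<le> e"
    "\<And>p. p < n \<Longrightarrow> dec (g p) \<in> {1, 2}" "dec (g n) \<notin> {1, 2}"
    "query_word c = map (\<lambda>p. dec (g p) = 2) [0..<n]"
proof -
  from rep t obtain g e where g: "\<sigma> (b + 1) = (g, conf.hd c 1)" "tok g e" "conf.hd c 1 \<le> e" "e \<le> E" "(\<lambda>p. dec (g p)) = tp c 1"
    unfolding rep_def by (metis One_nat_def Suc_1 Suc_le_lessD)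
  define n where "n = (LEAST p. dec (g p) \<notin> {1, 2})"
  have e: "dec (g e) \<notin> {1, 2}" using tok_zero[OF g(2), of e] by simp
  have 1: "dec (g n) \<notin> {1, 2}" unfolding n_def by (rule LeastI, rule e)
  have 2: "dec (g p) \<in> {1, 2}" if "p < n" for p using not_less_Least[of p "\<lambda>p. dec (g p) \<notin> {1, 2}"] that unfolding n_def by blast
  have 3: "n \<le> e" unfolding n_def by (rule Least_le, rule e)
  have "query_word c = map (\<lambda>p. dec (g p) = 2) [0..<n]"
    unfolding query_word_def g(5)[symmetric] n_def by (simp add: Let_def)
  then show ?thesis using that g(1-4) 1 2 3 by blast
qed

definition prep :: "(nat \<Rightarrow> bool) \<Rightarrow> otm \<Rightarrow> nat \<Rightarrow> nat \<Rightarrow> nat \<Rightarrow> cmd" where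
  "prep F M b sv X = clrs [b..<b + ntapes M] ;; copy F (\<lambda>s _. s) X b ;; rew X ;; rew b ;; Act (\<lambda>r. [sv \<mapsto> (start M, 0)])"

text \<open>\<open>E\<close> bounds what earlier simulations left on the tapes, \<open>E'\<close>
  the new input. Source and target both carry their flag in cell 0, so copying symbols verbatim
  keeps the format.\<close>

lemma runs_prep:
  assumes fits: "fits M b sv" and X: "X < k" "X \<notin> grp M b sv" and grp: "grpok b (ntapes M) E \<sigma>"
    and g: "\<sigma> X = (g, 0)" "tok g e" "e \<le> E'"
    and n: "\<And>p. p < n \<Longrightarrow> F (g p)" "\<not> F (g n)" "n \<le> e"
    and w: "\<And>p. inp w p = (if p < n then dec (g p) else 0)"
  shows "\<exists>\<sigma>'. runs (prep F M b sv X) \<sigma> (ntapes M * (4 * E + 6) + 6 * E' + 12) \<sigma>' \<and> rep M b sv (init_conf M w) E' \<sigma>' \<and>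
    (\<forall>t. t \<notin> grp M b sv \<longrightarrow> \<sigma>' t = \<sigma> t)"
proof -
  have svk: "sv < k" and bk: "b + ntapes M \<le> k" and sv: "sv \<notin> {b..<b + ntapes M}" and wf: "wf_otm M"
    and al: "alph M \<le> K" "nstates M \<le> K" and nt: "ntapes M > 0"
    using fits unfolding fits_def wf_otm_def by auto
  have bk': "b < k" and st: "start M < 2 * K + 2" using bk nt wf al unfolding wf_otm_def by auto
  have Xb: "X \<noteq> b" "X \<noteq> sv" "sv \<noteq> b" "X \<notin> {b..<b + ntapes M}" using X sv nt unfolding grp_def by auto
  define \<sigma>1 where "\<sigma>1 = (\<lambda>t. if t \<in> set [b..<b + ntapes M] then (fresh, 0) else \<sigma> t)"
  define h where "h = (\<lambda>p. if p < n then g p else fresh p)"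
  have e1: "e \<ge> 1" using g(2) by (simp add: tok_def)
  have r1: "runs (clrs [b..<b + ntapes M]) \<sigma> (ntapes M * (4 * E + 6) + 1) \<sigma>1"
  proof -
    have "runs (clrs [b..<b + ntapes M]) \<sigma> (length [b..<b + ntapes M] * (4 * E + 6) + 1) \<sigma>1"
      unfolding \<sigma>1_def
    proof (rule runs_clrs)
      fix v assume "v \<in> set [b..<b + ntapes M]"
      then have v: "v - b < ntapes M" "v < k" "b + (v - b) = v" using bk by auto
      then show "v < k \<and> (\<exists>g h e. \<sigma> v = (g, h) \<and> tok g e \<and> h \<le> e \<and> e \<le> E)"
        using grp unfolding grpok_def by metis
    qed
    then show ?thesis by simp
  qed
  have s1: "\<sigma>1 X = (g, 0)" "\<sigma>1 b = (fresh, 0)" using Xb nt g(1) by (auto simp: \<sigma>1_def)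
  have r2: "runs (copy F (\<lambda>s _. s) X b) \<sigma>1 (2 * n + 1) (\<sigma>1(X := (g, n), b := (h, n)))"
    unfolding h_def by (rule runs_copy) (use s1 Xb X bk' n tok_less[OF g(2)] in auto)
  have tokh: "tok h (max 1 n)"
  proof -
    have "h p \<le> 2 * K \<and> (h p \<noteq> 0 \<longleftrightarrow> p < max 1 n) \<and> (h p > K \<longleftrightarrow> p = 0)" for p
      using tok_le[OF g(2), of p] tok_zero[OF g(2), of p] tok_flag[OF g(2), of p] n(3) K3 by (auto simp: h_def fresh_def)
    then show ?thesis by (simp add: tok_def)
  qed
  let ?\<sigma>2 = "\<sigma>1(X := (g, n), b := (h, n))"
  have r3: "runs (rew X) ?\<sigma>2 (2 * n + 1) (?\<sigma>2(X := (g, 0)))"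
    by (rule runs_rew) (use X Xb g in auto)
  have e3: "?\<sigma>2(X := (g, 0)) = \<sigma>1(b := (h, n))" using s1 Xb by (auto simp: fun_eq_iff)
  have r4: "runs (rew b) (\<sigma>1(b := (h, n))) (2 * n + 1) (\<sigma>1(b := (h, n), b := (h, 0)))"
    by (rule runs_rew) (use bk' tokh in auto)
  let ?\<sigma>' = "\<sigma>1(b := (h, 0), sv := act (start M, 0) (\<sigma> sv))"
  have "\<sigma>1 sv = \<sigma> sv" using sv by (auto simp: \<sigma>1_def)
  then have r5: "runs (Act (\<lambda>r. [sv \<mapsto> (start M, 0)])) (\<sigma>1(b := (h, n), b := (h, 0))) 1 ?\<sigma>'"
    using svk st Xb by (intro runs_Act) (auto intro!: okact_update)
  have "rep M b sv (init_conf M w) E' ?\<sigma>'"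
    unfolding rep_def
  proof (intro conjI allI impI)
    show "cur (?\<sigma>' sv) = st (init_conf M w)" by (simp add: act_def cur_def init_conf_def)
    fix t assume t: "t < ntapes M"
    then have tsv: "b + t \<noteq> sv" using sv by auto
    show "\<exists>g e. ?\<sigma>' (b + t) = (g, conf.hd (init_conf M w) t) \<and> tok g e \<and> conf.hd (init_conf M w) t \<le> e \<and> e \<le> E' \<and>
           (\<lambda>p. dec (g p)) = tp (init_conf M w) t"
    proof (cases "t = 0")
      case True
      have "dec (h p) = inp w p" for p unfolding w by (simp add: h_def)
      then have "(\<lambda>p. dec (h p)) = tp (init_conf M w) 0" by (auto simp: init_conf_def inp_def)
      then show ?thesis using True Xb tokh g e1 n(3) by (intro exI[of _ h] exI[of _ "max 1 n"]) (auto simp: init_conf_def)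
    next
      case False
      then have "?\<sigma>' (b + t) = (fresh, 0)" using t tsv by (auto simp: \<sigma>1_def)
      then show ?thesis using False tok_fresh g e1 by (intro exI[of _ fresh] exI[of _ "1"]) (auto simp: init_conf_def)
    qed
  qed
  moreover have "\<forall>t. t \<notin> grp M b sv \<longrightarrow> ?\<sigma>' t = \<sigma> t" using nt by (auto simp: grp_def \<sigma>1_def)
  moreover have "runs (prep F M b sv X) \<sigma> (ntapes M * (4 * E + 6) + 6 * E' + 12) ?\<sigma>'"
    unfolding prep_def
    by (rule runs_mono[OF runs_Then[OF r1 runs_Then[OF r2 runs_Then[OF r3[unfolded e3] runs_Then[OF r4 r5]]]]])
       (use n(3) g(3) in simp)
  ultimately show ?thesis by blast
qed

text \<open>The oracle reads a plain word from tape 1, so the query is decoded on the way. Tape 1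
  stays outside the flagged format; \<open>Ask\<close> itself returns it blank, ready for the next
  query.\<close>

definition realq :: "otm \<Rightarrow> nat \<Rightarrow> nat \<Rightarrow> cmd" where
  "realq M b sv = rew (b + 1) ;; copy (\<lambda>s. dec s \<in> {1, 2}) (\<lambda>s _. dec s) (b + 1) 1 ;; Ask ;;
     Act (\<lambda>r. [sv \<mapsto> (if r 2 = 1 then yes M else no M, 0)]) ;; clr (b + 1)"

text \<open>Common end of both query handlers, the one that asks the real oracle and the one that
  simulates a decider.\<close>

lemma rep_answer:
  assumes rep: "rep M b sv c E \<sigma>" and fits: "fits M b sv"
    and \<sigma>': "\<And>t. t < ntapes M \<Longrightarrow> t \<noteq> 1 \<Longrightarrow> \<sigma>' (b + t) = \<sigma> (b + t)" "\<sigma>' (b + 1) = (fresh, 0)"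
      "cur (\<sigma>' sv) = (if query_word c \<in> B then yes M else no M)"
  shows "rep M b sv (answer_step M B c) E \<sigma>'"
  unfolding rep_def
proof (intro conjI allI impI)
  show "cur (\<sigma>' sv) = st (answer_step M B c)" using \<sigma>'(3) by (simp add: answer_step_def)
  fix t assume t: "t < ntapes M"
  from rep t obtain g e where g: "\<sigma> (b + t) = (g, conf.hd c t)" "tok g e" "conf.hd c t \<le> e" "e \<le> E" "(\<lambda>p. dec (g p)) = tp c t"
    unfolding rep_def by blast
  show "\<exists>g e. \<sigma>' (b + t) = (g, conf.hd (answer_step M B c) t) \<and> tok g e \<and> conf.hd (answer_step M B c) t \<le> e \<and> e \<le> E \<and>
     (\<lambda>p. dec (g p)) = tp (answer_step M B c) t"
  proof (cases "t = 1")
    case True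
    have "e \<ge> 1" using g(2) by (simp add: tok_def)
    then show ?thesis using True \<sigma>'(2) tok_fresh g(4)
      by (intro exI[of _ fresh] exI[of _ 1]) (auto simp: answer_step_def)
  next
    case False
    then show ?thesis using g \<sigma>'(1)[OF t] by (intro exI[of _ g] exI[of _ e]) (auto simp: answer_step_def)
  qed
qed

lemma runs_realq:
  assumes fits: "fits M b sv" and rep: "rep M b sv c E \<sigma>" and blank: "\<sigma> 1 = blank"
  shows "\<exists>\<sigma>'. runs (realq M b sv) \<sigma> (8 * E + 15) \<sigma>' \<and> rep M b sv (answer_step M A c) E \<sigma>' \<and> \<sigma>' 1 = blank \<and>
    (\<forall>t. t \<notin> grp M b sv \<union> {1, 2} \<longrightarrow> \<sigma>' t = \<sigma> t)"
proof -
  have svk: "sv < k" "3 \<le> sv" "3 \<le> b" and bk: "b + ntapes M \<le> k" and sv: "sv \<notin> {b..<b + ntapes M}" and wf: "wf_otm M"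
    and al: "alph M \<le> K" "nstates M \<le> K" and nt: "ntapes M \<ge> 2"
    using fits unfolding fits_def wf_otm_def by auto
  have bk': "b + 1 < k" and bsv: "b + 1 \<noteq> sv" and y: "yes M < 2 * K + 2" "no M < 2 * K + 2"
    using bk nt sv wf al unfolding wf_otm_def by auto
  from rep_query_word[OF rep nt] obtain g e n where g: "\<sigma> (b + 1) = (g, conf.hd c 1)" "tok g e" "conf.hd c 1 \<le> e" "e \<le> E" "n \<le> e"
    "\<And>p. p < n \<Longrightarrow> dec (g p) \<in> {1, 2}" "dec (g n) \<notin> {1, 2}"
    "query_word c = map (\<lambda>p. dec (g p) = 2) [0..<n]" by blast
  have r1: "runs (rew (b + 1)) \<sigma> (2 * conf.hd c 1 + 1) (\<sigma>(b + 1 := (g, 0)))"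
    by (rule runs_rew) (use bk' g in auto)
  let ?\<sigma>1 = "\<sigma>(b + 1 := (g, 0))"
  define h where "h = (\<lambda>p. if p < n then dec (g p) else 0)"
  have r2: "runs (copy (\<lambda>s. dec s \<in> {1, 2}) (\<lambda>s _. dec s) (b + 1) 1) ?\<sigma>1 (2 * n + 1) (?\<sigma>1(b + 1 := (g, n), 1 := (h, n)))"
    unfolding h_def
  proof (rule runs_copy)
    show "dec (g p) \<in> {1, 2} \<and> dec (g p) < 2 * K + 2 \<and> g p < 2 * K + 2" if "p < n" for p
      using g(6)[OF that] tok_less[OF g(2), of p] K3 by auto
  qed (use bk' k3 svk blank g in \<open>auto simp: blank_def\<close>)
  let ?\<sigma>2 = "\<sigma>(b + 1 := (g, n), 1 := (h, n))"
  have e2: "?\<sigma>1(b + 1 := (g, n), 1 := (h, n)) = ?\<sigma>2" by simp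
  have "(LEAST p. h p \<notin> {1, 2}) = n"
    by (rule inp_Least) (use g(6) in \<open>auto simp: h_def\<close>)
  then have "word_of (h, n) = query_word c" unfolding word_of_def g(8) by (simp add: h_def)
  then have r3: "runs Ask ?\<sigma>2 3 (?\<sigma>2(1 := blank, 2 := act (if query_word c \<in> A then 1 else 2, 0) (\<sigma> 2)))"
    using runs_Ask[of ?\<sigma>2] svk by (auto simp: fun_upd_def)
  let ?\<sigma>3 = "?\<sigma>2(1 := blank, 2 := act (if query_word c \<in> A then 1 else 2, 0) (\<sigma> 2))"
  let ?\<sigma>4 = "?\<sigma>3(sv := act (if query_word c \<in> A then yes M else no M, 0) (\<sigma> sv))"
  have "cur (?\<sigma>3 2) = (if query_word c \<in> A then 1 else 2)" by (simp add: act_def cur_def)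
  then have r4: "runs (Act (\<lambda>r. [sv \<mapsto> (if r 2 = 1 then yes M else no M, 0)])) ?\<sigma>3 1 ?\<sigma>4"
    using svk bsv y k3 by (intro runs_Act) (auto intro!: okact_update)
  have r5: "runs (clr (b + 1)) ?\<sigma>4 (4 * e + 5) (?\<sigma>4(b + 1 := (fresh, 0)))"
    by (rule runs_clr[where h = n]) (use bk' bsv svk g in auto)
  let ?\<sigma>' = "?\<sigma>4(b + 1 := (fresh, 0))"
  have "rep M b sv (answer_step M A c) E ?\<sigma>'"
  proof (rule rep_answer[OF rep fits])
    show "cur (?\<sigma>' sv) = (if query_word c \<in> A then yes M else no M)" using bsv by (simp add: act_def cur_def)
    show "?\<sigma>' (b + t) = \<sigma> (b + t)" if "t < ntapes M" "t \<noteq> 1" for t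
      using that sv svk by auto
  qed simp
  moreover have "runs (realq M b sv) \<sigma> (8 * E + 15) ?\<sigma>'"
    unfolding realq_def
    by (rule runs_mono[OF runs_Then[OF r1 runs_Then[OF r2[unfolded e2] runs_Then[OF r3 runs_Then[OF r4 r5]]]]])
       (use g in simp)
  moreover have "?\<sigma>' 1 = blank" using svk by auto
  moreover have "\<forall>t. t \<notin> grp M b sv \<union> {1, 2} \<longrightarrow> ?\<sigma>' t = \<sigma> t" using nt by (auto simp: grp_def)
  ultimately show ?thesis by blast
qed

definition decide :: "(nat \<Rightarrow> bool) \<Rightarrow> otm \<Rightarrow> nat \<Rightarrow> nat \<Rightarrow> nat \<Rightarrow> nat \<Rightarrow> cmd" where
  "decide F M b sv X D = prep F M b sv X ;; run M (det_pick M) b sv (\<lambda>_. True) (\<lambda>_. 1) D (realq M b sv)"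

text \<open>For \<open>n\<close> tapes: erasing leftovers of size \<open>E\<close>, loading an input
  of size \<open>E'\<close>, then at most \<open>T + 1\<close> rounds, each charged like a real
  query on tapes of size \<open>E' + T\<close>.\<close>

definition dcost :: "nat \<Rightarrow> nat \<Rightarrow> nat \<Rightarrow> nat \<Rightarrow> nat" where
  "dcost n E E' T = n * (4 * E + 6) + 6 * E' + (T + 1) * (8 * (E' + T) + 19) + 14"

lemma dcost_mono: "E \<le> F \<Longrightarrow> E' \<le> F' \<Longrightarrow> T \<le> T' \<Longrightarrow> dcost n E E' T \<le> dcost n F F' T'"
  unfolding dcost_def by (intro add_mono mult_mono) auto

lemma runs_decide:
  assumes det: "deterministic M" and tb: "time_bounded M A T" and fits: "fits M b sv"
    and X: "X < k" "X \<notin> grp M b sv" and D: "D < k" "D \<notin> grp M b sv" "3 \<le> D" and grp: "grpok b (ntapes M) E \<sigma>"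
    and g: "\<sigma> X = (g, 0)" "tok g e" "e \<le> E'"
    and n: "\<And>p. p < n \<Longrightarrow> F (g p)" "\<not> F (g n)" "n \<le> e"
    and w: "\<And>p. inp w p = (if p < n then dec (g p) else 0)"
    and blank: "\<sigma> 1 = blank"
  shows "\<exists>\<sigma>'. runs (decide F M b sv X D) \<sigma> (dcost (ntapes M) E E' (T (length w))) \<sigma>' \<and>
    (cur (\<sigma>' sv) = acc M \<longleftrightarrow> accepts M A w) \<and> grpok b (ntapes M) (E' + T (length w) + 1) \<sigma>' \<and> \<sigma>' 1 = blank \<and>
    (\<forall>t. t \<notin> grp M b sv \<union> {1, 2, D} \<longrightarrow> \<sigma>' t = \<sigma> t)"
proof -
  let ?run = "run M (det_pick M) b sv (\<lambda>_. True) (\<lambda>_. 1) D (realq M b sv)"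
  let ?T = "T (length w)"
  have sv: "sv < k" "3 \<le> sv" "3 \<le> b" and wf: "wf_otm M" using fits unfolding fits_def by auto
  have out: "1 \<notin> grp M b sv" "2 \<notin> grp M b sv" using sv unfolding grp_def by auto
  from runs_prep[where F = F and g = g and n = n and w = w and \<sigma> = \<sigma>, OF fits X grp g n w] obtain \<sigma>1 where
    1: "runs (prep F M b sv X) \<sigma> (ntapes M * (4 * E + 6) + 6 * E' + 12) \<sigma>1" "rep M b sv (init_conf M w) E' \<sigma>1"
    "\<And>t. t \<notin> grp M b sv \<Longrightarrow> \<sigma>1 t = \<sigma> t" by blast
  let ?ds = "\<lambda>i. cur ((adv (\<lambda>_. 1) ^^ i) (\<sigma> D))"
  let ?C = "itr M (det_pick M) A ?ds w"
  obtain N where N: "\<And>i. i < N \<Longrightarrow> live M (?C i)" "\<not> live M (?C N)" "N \<le> ?T + 1"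
    using ctr_halts[OF sound_det_pick tb, of ?ds w] by blast
  define J where "J \<sigma>' \<longleftrightarrow> \<sigma>' 1 = blank \<and> (\<forall>t. t \<notin> grp M b sv \<union> {1, 2, D} \<longrightarrow> \<sigma>' t = \<sigma> t)" for \<sigma>'
  have "\<exists>\<sigma>'. runs ?run \<sigma>1 (N * ((8 * (E' + ?T) + 15) + 4) + 1) \<sigma>' \<and>
     rep M b sv (?C N) (E' + N) \<sigma>' \<and> \<sigma>' D = (adv (\<lambda>_. 1) ^^ N) (\<sigma> D) \<and> J \<sigma>'"
  proof (rule runs_run[OF fits D(1,2) sound_det_pick])
    fix i \<sigma>2 assume i: "i < N" "rep M b sv (?C i) (E' + i) \<sigma>2" "J \<sigma>2"
    have "\<sigma>2 1 = blank" using i(3) by (simp add: J_def)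
    from runs_realq[OF fits i(2) this] obtain \<sigma>3 where 3: "runs (realq M b sv) \<sigma>2 (8 * (E' + i) + 15) \<sigma>3"
     "rep M b sv (answer_step M A (?C i)) (E' + i) \<sigma>3" "\<sigma>3 1 = blank" "\<And>t. t \<notin> grp M b sv \<union> {1, 2} \<Longrightarrow> \<sigma>3 t = \<sigma>2 t" by blast
    have "runs (realq M b sv) \<sigma>2 (8 * (E' + ?T) + 15) \<sigma>3" using 3(1) by (rule runs_mono) (use i(1) N(3) in simp)
    moreover have "J \<sigma>3" using 3(3,4) i(3) unfolding J_def by auto
    moreover have "rep M b sv (answer_step M A (?C i)) (E' + i + 1) \<sigma>3" using rep_mono[OF 3(2)] by simp
    moreover have "\<sigma>3 D = \<sigma>2 D" using 3(4) D by auto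
    ultimately show "\<exists>\<sigma>'. runs (realq M b sv) \<sigma>2 (8 * (E' + ?T) + 15) \<sigma>' \<and>
        rep M b sv (answer_step M A (?C i)) (E' + i + 1) \<sigma>' \<and> J \<sigma>' \<and> \<sigma>' D = \<sigma>2 D" by blast
  next
    fix \<sigma>2 \<sigma>3 assume J: "J \<sigma>2" and same: "\<And>t. t \<notin> grp M b sv \<Longrightarrow> t \<noteq> D \<Longrightarrow> \<sigma>3 t = \<sigma>2 t"
    then show "J \<sigma>3" using out D unfolding J_def by auto
  next
    show "J \<sigma>1" using 1(3) blank out unfolding J_def by auto
  qed (use N 1 D in auto)
  then obtain \<sigma>' where 2: "runs ?run \<sigma>1 (N * ((8 * (E' + ?T) + 15) + 4) + 1) \<sigma>'"
     "rep M b sv (?C N) (E' + N) \<sigma>'" "J \<sigma>'" by blast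
  have "cur (\<sigma>' sv) = acc M \<longleftrightarrow> accepts M A w"
    using det_ctr_accepts[OF det wf N(1,2)] 2(2) unfolding rep_def by simp
  moreover have "grpok b (ntapes M) (E' + ?T + 1) \<sigma>'"
    using grpok_mono[OF rep_grpok[OF 2(2)]] N(3) by simp
  moreover have "runs (decide F M b sv X D) \<sigma> (dcost (ntapes M) E E' ?T) \<sigma>'"
  proof -
    have 3: "N * ((8 * (E' + ?T) + 15) + 4) \<le> (?T + 1) * (8 * (E' + ?T) + 19)"
    proof -
      have "(8 * (E' + ?T) + 15) + 4 = 8 * (E' + ?T) + 19" by simp
      then show ?thesis using mult_le_mono1[OF N(3)] by (simp only:)
    qed
    show ?thesis
      unfolding decide_def
    proof (rule runs_mono[OF runs_Then[OF 1(1) 2(1)]])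
      show "ntapes M * (4 * E + 6) + 6 * E' + 12 + (N * ((8 * (E' + ?T) + 15) + 4) + 1) + 1
        \<le> dcost (ntapes M) E E' ?T"
        using 3 unfolding dcost_def by linarith
    qed
  qed
  ultimately show ?thesis using 2(3) unfolding J_def by blast
qed

text \<open>Query of a simulated machine N, answered by simulating a decider M of its oracle.\<close>

definition subq :: "otm \<Rightarrow> nat \<Rightarrow> nat \<Rightarrow> otm \<Rightarrow> nat \<Rightarrow> nat \<Rightarrow> nat \<Rightarrow> cmd" where
  "subq N b sv M b' sv' D = rew (b + 1) ;; decide (\<lambda>s. dec s \<in> {1, 2}) M b' sv' (b + 1) D ;;
     Act (\<lambda>r. [sv \<mapsto> (if r sv' = acc M then yes N else no N, 0)]) ;; clr (b + 1)"

text \<open>The bound \<open>EM\<close> is meant to be reused: by \<open>E + TM + 1 \<le> EM\<close>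
  the tapes of the decider are within \<open>EM\<close> again after the query, so the cost of a
  query does not grow with the number of earlier queries.\<close>

lemma runs_subq:
  assumes det: "deterministic M" and tb: "time_bounded M A T" and M: "decides M A B"
    and fits: "fits N b sv" and fits': "fits M b' sv'" and disj: "grp N b sv \<inter> grp M b' sv' = {}"
    and D: "D < k" "D \<notin> grp N b sv" "D \<notin> grp M b' sv'" "3 \<le> D"
    and rep: "rep N b sv c E \<sigma>" and grp: "grpok b' (ntapes M) EM \<sigma>" and blank: "\<sigma> 1 = blank"
    and T: "\<And>n. n \<le> E \<Longrightarrow> T n \<le> TM" and EM: "E + TM + 1 \<le> EM"
  shows "\<exists>\<sigma>'. runs (subq N b sv M b' sv' D) \<sigma> (dcost (ntapes M) EM E TM + 6 * E + 10) \<sigma>' \<and>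
    rep N b sv (answer_step N B c) E \<sigma>' \<and> grpok b' (ntapes M) EM \<sigma>' \<and> \<sigma>' 1 = blank \<and>
    (\<forall>t. t \<notin> grp N b sv \<union> grp M b' sv' \<union> {1, 2, D} \<longrightarrow> \<sigma>' t = \<sigma> t)"
proof -
  let ?dec = "decide (\<lambda>s. dec s \<in> {1, 2}) M b' sv' (b + 1) D"
  let ?w = "query_word c"
  have svk: "sv < k" "3 \<le> sv" "3 \<le> b" and bk: "b + ntapes N \<le> k" and sv: "sv \<notin> {b..<b + ntapes N}" and wf: "wf_otm N"
    and al: "alph N \<le> K" "nstates N \<le> K" and nt: "ntapes N \<ge> 2"
    using fits unfolding fits_def wf_otm_def by auto
  have bk': "b + 1 < k" and bsv: "b + 1 \<noteq> sv" and y: "yes N < 2 * K + 2" "no N < 2 * K + 2"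
    using bk nt sv wf al unfolding wf_otm_def by auto
  have sv': "sv' < k" "3 \<le> sv'" "3 \<le> b'" using fits' unfolding fits_def by auto
  have bN: "b + t \<in> grp N b sv" if "t < ntapes N" for t using that by (auto simp: grp_def)
  have b1: "b + 1 \<in> grp N b sv" using nt by (auto simp: grp_def)
  have b1': "b + 1 \<notin> grp M b' sv'" using b1 disj by blast
  have bt': "b' + t \<notin> grp N b sv" if "t < ntapes M" for t
  proof -
    have "b' + t \<in> grp M b' sv'" using that by (simp add: grp_def)
    then show ?thesis using disj by blast
  qed
  have bt1: "b' + t \<noteq> b + 1" if "t < ntapes M" for t using bt'[OF that] b1 by metis
  have "sv' \<in> grp M b' sv'" "sv \<in> grp N b sv" by (auto simp: grp_def)
  then have svsv: "sv' \<noteq> sv" "sv' \<noteq> b + 1" "sv \<notin> grp M b' sv'" using disj b1 by blast+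
  from rep_query_word[OF rep nt] obtain g e n where g: "\<sigma> (b + 1) = (g, conf.hd c 1)" "tok g e" "conf.hd c 1 \<le> e" "e \<le> E" "n \<le> e"
    "\<And>p. p < n \<Longrightarrow> dec (g p) \<in> {1, 2}" "dec (g n) \<notin> {1, 2}"
    "?w = map (\<lambda>p. dec (g p) = 2) [0..<n]" by blast
  have lw: "length ?w \<le> E" using g by simp
  have r1: "runs (rew (b + 1)) \<sigma> (2 * conf.hd c 1 + 1) (\<sigma>(b + 1 := (g, 0)))"
    by (rule runs_rew) (use bk' g in auto)
  let ?\<sigma>1 = "\<sigma>(b + 1 := (g, 0))"
  have "\<exists>\<sigma>'. runs ?dec ?\<sigma>1 (dcost (ntapes M) EM E (T (length ?w))) \<sigma>' \<and>
    (cur (\<sigma>' sv') = acc M \<longleftrightarrow> accepts M A ?w) \<and> grpok b' (ntapes M) (E + T (length ?w) + 1) \<sigma>' \<and> \<sigma>' 1 = blank \<and>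
    (\<forall>t. t \<notin> grp M b' sv' \<union> {1, 2, D} \<longrightarrow> \<sigma>' t = ?\<sigma>1 t)"
  proof (rule runs_decide[OF det tb fits' bk' b1' D(1,3,4) _ _ g(2,4) _ _ g(5)])
    show "grpok b' (ntapes M) EM ?\<sigma>1" using grp by (rule grpok_cong) (use bt1 in auto)
    show "inp ?w p = (if p < n then dec (g p) else 0)" for p
      unfolding g(8) using g(6) by (rule inp_map)
  qed (use g blank svk in auto)
  then obtain \<sigma>2 where 2: "runs ?dec ?\<sigma>1 (dcost (ntapes M) EM E (T (length ?w))) \<sigma>2"
    "cur (\<sigma>2 sv') = acc M \<longleftrightarrow> accepts M A ?w" "grpok b' (ntapes M) (E + T (length ?w) + 1) \<sigma>2" "\<sigma>2 1 = blank"
    "\<And>t. t \<notin> grp M b' sv' \<union> {1, 2, D} \<Longrightarrow> \<sigma>2 t = ?\<sigma>1 t" by blast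
  have TMl: "T (length ?w) \<le> TM" using T[OF lw] .
  have r2: "runs ?dec ?\<sigma>1 (dcost (ntapes M) EM E TM) \<sigma>2"
    using 2(1) by (rule runs_mono) (intro dcost_mono TMl order_refl)
  have same: "\<sigma>2 t = ?\<sigma>1 t" if "t \<in> grp N b sv" for t
  proof (rule 2(5))
    have "t \<ge> 3" using that svk by (auto simp: grp_def)
    then show "t \<notin> grp M b' sv' \<union> {1, 2, D}" using that disj D(2) by auto
  qed
  let ?\<sigma>3 = "\<sigma>2(sv := act (if ?w \<in> B then yes N else no N, 0) (\<sigma>2 sv))"
  have "cur (\<sigma>2 sv') = acc M \<longleftrightarrow> ?w \<in> B" using 2(2) M unfolding decides_def by simp
  then have r3: "runs (Act (\<lambda>r. [sv \<mapsto> (if r sv' = acc M then yes N else no N, 0)])) \<sigma>2 1 ?\<sigma>3"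
    using svk sv' y by (intro runs_Act) (auto intro!: okact_update)
  have r4: "runs (clr (b + 1)) ?\<sigma>3 (4 * e + 5) (?\<sigma>3(b + 1 := (fresh, 0)))"
    by (rule runs_clr[where h = 0]) (use bk' bsv same[OF b1] g in auto)
  let ?\<sigma>' = "?\<sigma>3(b + 1 := (fresh, 0))"
  have "rep N b sv (answer_step N B c) E ?\<sigma>'"
  proof (rule rep_answer[OF rep fits])
    show "cur (?\<sigma>' sv) = (if ?w \<in> B then yes N else no N)" using bsv by (simp add: act_def cur_def)
    show "?\<sigma>' (b + t) = \<sigma> (b + t)" if "t < ntapes N" "t \<noteq> 1" for t
      using that sv same[OF bN] by auto
  qed simp
  moreover have "runs (subq N b sv M b' sv' D) \<sigma> (dcost (ntapes M) EM E TM + 6 * E + 10) ?\<sigma>'"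
    unfolding subq_def
    by (rule runs_mono[OF runs_Then[OF r1 runs_Then[OF r2 runs_Then[OF r3 r4]]]]) (use g in simp)
  moreover have "?\<sigma>' 1 = blank" using svk 2(4) by auto
  moreover have "grpok b' (ntapes M) EM ?\<sigma>'"
    using grpok_mono[OF 2(3)] EM TMl
    by (rule_tac grpok_cong[of _ _ _ \<sigma>2]) (use bt1 svsv in \<open>auto simp: grp_def\<close>)
  moreover have "\<forall>t. t \<notin> grp N b sv \<union> grp M b' sv' \<union> {1, 2, D} \<longrightarrow> ?\<sigma>' t = \<sigma> t"
    using 2(5) b1 by (auto simp: grp_def)
  ultimately show ?thesis by blast
qed

end

section \<open>Depth-first search through choice sequences\<close>

text \<open>The strict part of the depth-first order on choice sequences: proper prefixes are not included.\<close>

fun slt :: "nat list \<Rightarrow> nat list \<Rightarrow> bool" where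
  "slt (c # cs) (d # ds) \<longleftrightarrow> c < d \<or> (c = d \<and> slt cs ds)"
| "slt _ _ \<longleftrightarrow> False"

text \<open>This is the preorder traversal of the tree of choice sequences, in which a node precedes
  all its extensions.\<close>

definition dle :: "nat list \<Rightarrow> nat list \<Rightarrow> bool" where
  "dle cs ds \<longleftrightarrow> slt cs ds \<or> (\<exists>zs. ds = cs @ zs)"

lemma slt_append: "slt cs ds \<Longrightarrow> slt (cs @ zs) ds"
  by (induction cs ds rule: slt.induct) auto

lemma slt_same_prefix: "slt (cs @ zs) (cs @ zs') = slt zs zs'"
  by (induction cs) auto

text \<open>In preorder the successor of an inner node is its first child, here the one with digit
  1.\<close>

lemma dle_snoc:
  assumes "dle cs ds" "ds \<noteq> cs" "\<And>d. d \<in> set ds \<Longrightarrow> d \<ge> 1"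
  shows "dle (cs @ [1]) ds"
proof (cases "slt cs ds")
  case False
  then obtain d zs where ds: "ds = cs @ d # zs" using assms unfolding dle_def by (metis append_Nil2 neq_Nil_conv)
  then have "d \<ge> 1" using assms(3) by simp
  then show ?thesis unfolding dle_def ds by (cases "d = 1") (auto simp: slt_same_prefix)
qed (simp add: dle_def slt_append)

lemma slt_snoc_max:
  assumes "\<And>d. d \<in> set ds \<Longrightarrow> d \<le> D"
  shows "slt (cs @ [D]) ds \<Longrightarrow> slt cs ds"
  using assms
proof (induction cs ds rule: slt.induct)
  case ("2_1" ds)
  then show ?case by (cases ds) force+
qed auto

lemma slt_replicate_max:
  assumes "\<And>d. d \<in> set ds \<Longrightarrow> d \<le> D"
  shows "slt (cs @ replicate j D) ds \<Longrightarrow> slt cs ds"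
proof (induction j)
  case (Suc j)
  have "cs @ replicate (Suc j) D = (cs @ replicate j D) @ [D]" by (simp add: replicate_append_same)
  then show ?case using Suc slt_snoc_max[OF assms] by metis
qed simp

lemma dle_increment: "slt (cs @ [c]) ds \<Longrightarrow> dle (cs @ [Suc c]) ds"
proof (induction cs ds rule: slt.induct)
  case (1 c' cs d ds)
  then show ?case unfolding dle_def by auto
next
  case ("2_1" ds)
  then show ?case unfolding dle_def by (cases ds) auto
qed auto

lemma dle_next:
  assumes "slt (zs @ c # replicate j D) ds" "\<And>d. d \<in> set ds \<Longrightarrow> d \<le> D"
  shows "dle (zs @ [Suc c]) ds"
  using slt_replicate_max[where cs = "zs @ [c]" and j = j, OF assms(2)] assms(1) dle_increment by simp

lemma not_slt_replicate_max:
  assumes "\<And>d. d \<in> set ds \<Longrightarrow> d \<le> D"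
  shows "\<not> slt (replicate j D) ds"
  using slt_replicate_max[where cs = "[]" and j = j, OF assms] by auto

lemma trailing_max_cases:
  obtains j where "cs = replicate j D" | zs c j where "cs = zs @ c # replicate j D" "c \<noteq> (D :: nat)"
proof (induction cs arbitrary: thesis rule: rev_induct)
  case Nil
  then show ?case by (metis replicate_0)
next
  case (snoc x cs)
  show ?case
  proof (cases "x = D")
    case False
    then show ?thesis using snoc.prems(2)[of cs x 0] by simp
  next
    case True
    show ?thesis
    proof (rule snoc.IH)
      show ?thesis if "cs = replicate j D" for j using snoc.prems(1)[of "Suc j"] that True by (simp add: replicate_append_same)
      show ?thesis if "cs = zs @ c # replicate j D" "c \<noteq> D" for zs c j
        using snoc.prems(2)[of zs c "Suc j"] that True by (simp add: replicate_append_same)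
    qed
  qed
qed

text \<open>A choice sequence with digits at most D, padded with zeros to length h and read in base D + 1.\<close>

primrec mu :: "nat \<Rightarrow> nat \<Rightarrow> nat list \<Rightarrow> nat" where
  "mu D 0 cs = 0"
| "mu D (Suc h) cs = (case cs of [] \<Rightarrow> 0 | c # cs' \<Rightarrow> c * (D + 1) ^ h + mu D h cs')"

lemma mu_less: "(\<And>c. c \<in> set cs \<Longrightarrow> c \<le> D) \<Longrightarrow> mu D h cs < (D + 1) ^ h"
proof (induction h arbitrary: cs)
  case (Suc h)
  show ?case
  proof (cases cs)
    case (Cons c cs')
    then have "mu D h cs' < (D + 1) ^ h" "c \<le> D" using Suc by auto
    then have "c * (D + 1) ^ h + mu D h cs' < D * (D + 1) ^ h + (D + 1) ^ h"
      by (intro add_le_less_mono mult_le_mono1) auto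
    then show ?thesis using Cons by simp
  qed simp
qed simp

lemma mu_snoc: "length cs < h \<Longrightarrow> mu D h cs < mu D h (cs @ [Suc c])"
  by (induction h arbitrary: cs) (auto split: list.split)

text \<open>At the first difference \<open>ds\<close> has the larger digit, and by
  \<open>mu_less\<close> the rest of \<open>cs\<close> is worth less than one unit of that
  place.\<close>

lemma mu_slt:
  "slt cs ds \<Longrightarrow> (\<And>c. c \<in> set cs \<Longrightarrow> c \<le> D) \<Longrightarrow> length cs \<le> h \<Longrightarrow> mu D h cs < mu D h ds"
proof (induction cs ds arbitrary: h rule: slt.induct)
  case (1 c cs d ds)
  then obtain h' where h: "h = Suc h'" by (cases h) auto
  show ?case
  proof (cases "c = d")
    case True
    then show ?thesis using 1 h by auto
  next
    case False
    then have "Suc c \<le> d" using 1 by auto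
    have "mu D h' cs < (D + 1) ^ h'" using 1(3) by (intro mu_less) auto
    then have "c * (D + 1) ^ h' + mu D h' cs < Suc c * (D + 1) ^ h'" by simp
    also have "\<dots> \<le> d * (D + 1) ^ h'" using \<open>Suc c \<le> d\<close> by (rule mult_le_mono1)
    finally show ?thesis using h by simp
  qed
qed auto

lemma slt_next: "slt (zs @ c # us) (zs @ [Suc c])"
  by (simp add: slt_same_prefix)

section \<open>Tape formats and programs of the search\<close>

context env
begin

definition flag_all :: "nat set \<Rightarrow> cmd" where
  "flag_all S = Act (\<lambda>r t. if t \<in> S then Some (K + 1, 0) else None)"

lemma runs_flag_all:
  assumes "S \<subseteq> {..<k}" "\<And>t. t \<in> S \<Longrightarrow> \<sigma> t = blank"
  shows "runs (flag_all S) \<sigma> 1 (\<lambda>t. if t \<in> S then (fresh, 0) else \<sigma> t)"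
  unfolding flag_all_def
proof (rule runs_Act)
  show "okact k (2 * K + 2) (\<lambda>t. if t \<in> S then Some (K + 1, 0) else None)"
    using assms(1) by (auto simp: okact_def split: if_splits)
  have "(\<lambda>_. 0)(0 := K + 1) = fresh" by (auto simp: fresh_def)
  then show "upd \<sigma> (\<lambda>t. if t \<in> S then Some (K + 1, 0) else None) = (\<lambda>t. if t \<in> S then (fresh, 0) else \<sigma> t)"
    using assms(2) by (auto simp: upd_def fun_eq_iff blank_def act_pair)
qed

definition load :: "nat \<Rightarrow> cmd" where
  "load X = copy (\<lambda>s. s \<noteq> 0) (\<lambda>s v. enc v s) 0 X ;; rew X"

definition filled :: "(nat \<Rightarrow> nat) \<Rightarrow> nat \<Rightarrow> nat \<Rightarrow> nat" where
  "filled f n p = (if p < n then enc (fresh p) (f p) else fresh p)"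

lemma tok_filled:
  assumes "\<And>p. f p < K"
  shows "tok (filled f n) (max 1 n)"
proof -
  have "filled f n p \<le> 2 * K \<and> (filled f n p \<noteq> 0 \<longleftrightarrow> p < max 1 n) \<and> (filled f n p > K \<longleftrightarrow> p = 0)" for p
    using assms[of p] enc_less[of "f p" "fresh p"] enc_flag[of "f p" "fresh p"] K3 by (auto simp: filled_def fresh_def)
  then show ?thesis by (simp add: tok_def)
qed

lemma dec_filled: "(\<And>p. f p < K) \<Longrightarrow> dec (filled f n p) = (if p < n then f p else 0)"
  by (simp add: filled_def)

lemma filled_Suc: "(filled f n)(n := enc (filled f n n) (f n)) = filled f (Suc n)"
  by (rule ext) (auto simp: filled_def less_Suc_eq)

lemma filled_0: "filled f 0 = fresh"
  by (rule ext) (simp add: filled_def)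

lemma inp_beyond: "inp x p = (if p < length x then inp x p else 0)"
  by (simp add: inp_def)

lemma inp_less: "inp x p < K"
  using K3 by (auto simp: inp_def)

abbreviation loaded :: "bool list \<Rightarrow> nat \<Rightarrow> nat" where
  "loaded x \<equiv> filled (inp x) (length x)"

lemma tok_loaded: "tok (loaded x) (max 1 (length x))"
  by (rule tok_filled[OF inp_less])

lemma runs_load:
  assumes "\<sigma> 0 = (inp x, 0)" "\<sigma> X = (fresh, 0)" "X < k" "X \<noteq> 0"
  shows "runs (load X) \<sigma> (4 * length x + 3) (\<sigma>(0 := (inp x, length x), X := (loaded x, 0)))"
proof -
  have e: "enc v (inp x p) < 2 * K + 2" for v p using K3 enc_less[of "inp x p" v] by (auto simp: inp_def)
  have i: "inp x p \<noteq> 0 \<longleftrightarrow> p < length x" "inp x p < 2 * K + 2" for p using K3 by (auto simp: inp_def)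
  have 1: "runs (copy (\<lambda>s. s \<noteq> 0) (\<lambda>s v. enc v s) 0 X) \<sigma> (2 * length x + 1) (\<sigma>(0 := (inp x, length x), X := (loaded x, length x)))"
    unfolding filled_def using assms k3 i e by (intro runs_copy) auto
  have 2: "runs (rew X) (\<sigma>(0 := (inp x, length x), X := (loaded x, length x))) (2 * length x + 1)
     (\<sigma>(0 := (inp x, length x), X := (loaded x, length x), X := (loaded x, 0)))"
    by (rule runs_rew) (use assms tok_loaded in auto)
  show ?thesis unfolding load_def using runs_mono[OF runs_Then[OF 1 2]] by simp
qed

text \<open>Even for the empty word the flagged cell 0 is nonzero, so the copying loop covers
  \<open>max 1 n\<close> cells; in that case the copied cell decodes to a blank, and the input is
  still the empty word.\<close>

lemma runs_prep_filled:
  assumes fits: "fits M b sv" and X: "X < k" "X \<notin> grp M b sv" and grp: "grpok b (ntapes M) E \<sigma>"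
    and f: "\<And>p. f p < K" and \<sigma>: "\<sigma> X = (filled f n, 0)" and w: "\<And>p. inp w p = (if p < n then f p else 0)"
  obtains \<sigma>' where "runs (prep (\<lambda>s. s \<noteq> 0) M b sv X) \<sigma> (ntapes M * (4 * E + 6) + 6 * max 1 n + 12) \<sigma>'"
    "rep M b sv (init_conf M w) (max 1 n) \<sigma>'" "\<And>t. t \<notin> grp M b sv \<Longrightarrow> \<sigma>' t = \<sigma> t"
proof -
  note tok = tok_filled[where f = f and n = n, OF f]
  have F: "filled f n p \<noteq> 0 \<longleftrightarrow> p < max 1 n" for p using tok_zero[OF tok, of p] by (metis not_less)
  have "inp w p = (if p < max 1 n then dec (filled f n p) else 0)" for p
    unfolding w dec_filled[where f = f, OF f] by auto
  from runs_prep[where F = "\<lambda>s. s \<noteq> 0" and w = w and \<sigma> = \<sigma>, OF fits X grp \<sigma> tok order_refl _ _ order_refl this]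
  show thesis using that F by (metis (no_types, lifting) order_less_irrefl)
qed

text \<open>Digits are stored without \<open>enc\<close>, from cell 1 on: cell 0 holds only the
  flag, and a digit between 1 and \<open>K\<close> already counts as visited and unflagged.\<close>

definition chs :: "nat list \<Rightarrow> nat \<Rightarrow> nat" where
  "chs cs p = (if p = 0 then K + 1 else if p \<le> length cs then cs ! (p - 1) else 0)"

lemma chs_Nil: "chs [] = fresh"
  by (auto simp: chs_def fresh_def)

lemma chs_snoc: "(chs cs)(Suc (length cs) := d) = chs (cs @ [d])"
  by (rule ext) (auto simp: chs_def nth_append)

lemma chs_clear: "(chs (cs @ [d]))(Suc (length cs) := 0) = chs cs"
  by (rule ext) (auto simp: chs_def nth_append)

lemma chs_last [simp]: "chs (cs @ [d]) (Suc (length cs)) = d"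
  by (simp add: chs_def)

lemma chs_0 [simp]: "chs cs 0 = K + 1"
  by (simp add: chs_def)

lemma chs_nth: "i < length cs \<Longrightarrow> chs cs (Suc i) = cs ! i"
  by (simp add: chs_def)

lemma chs_end [simp]: "chs cs (Suc (length cs)) = 0"
  by (simp add: chs_def)

lemma tok_chs:
  assumes "set cs \<subseteq> {1..K}"
  shows "tok (chs cs) (Suc (length cs))"
proof -
  have c: "1 \<le> cs ! (p - 1) \<and> cs ! (p - 1) \<le> K" if "p \<noteq> 0" "p \<le> length cs" for p
  proof -
    have "cs ! (p - 1) \<in> set cs" using that by simp
    then show ?thesis using assms by auto
  qed
  have "chs cs p \<le> 2 * K \<and> (chs cs p \<noteq> 0 \<longleftrightarrow> p < Suc (length cs)) \<and> (chs cs p > K \<longleftrightarrow> p = 0)" for p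
    using c[of p] K3 by (auto simp: chs_def)
  then show ?thesis by (simp add: tok_def)
qed

text \<open>Trailing digits \<open>D\<close> are erased back to the last digit that can be
  increased. Meeting the flag instead means that the candidates are exhausted, and tape 5 receives
  the rejecting verdict 2.\<close>

definition backtrack :: "nat \<Rightarrow> cmd" where
  "backtrack D = ffwd 4 ;; Act (\<lambda>r. [4 \<mapsto> (r 4, -1)]) ;; Loop (\<lambda>r. r 4 = D) (Act (\<lambda>r. [4 \<mapsto> (0, -1)])) ;;
     Cond (\<lambda>r. r 4 > K) (Act (\<lambda>r. [5 \<mapsto> (2, 0)])) (Act (\<lambda>r. [4 \<mapsto> (Suc (r 4), 0)]))"

lemma runs_backtrack:
  assumes "5 < k" "D < K" "D \<ge> 1" "set cs \<subseteq> {1..D}" "\<sigma> 4 = (chs cs, h)" "h \<le> Suc (length cs)"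
  obtains j where "cs = replicate j D" "runs (backtrack D) \<sigma> (4 * length cs + 11) (\<sigma>(4 := (chs [], 0), 5 := act (2, 0) (\<sigma> 5)))"
  | zs c j where "cs = zs @ c # replicate j D" "c < D"
     "runs (backtrack D) \<sigma> (4 * length cs + 11) (\<sigma>(4 := (chs (zs @ [Suc c]), Suc (length zs))))"
proof -
  let ?pop = "Loop (\<lambda>r. r 4 = D) (Act (\<lambda>r. [4 \<mapsto> (0, -1)]))"
  let ?last = "Cond (\<lambda>r. r 4 > K) (Act (\<lambda>r. [5 \<mapsto> (2, 0)])) (Act (\<lambda>r. [4 \<mapsto> (Suc (r 4), 0)]))"
  have tok: "tok (chs cs) (Suc (length cs))" by (rule tok_chs) (use assms in auto)
  have ff: "runs (ffwd 4) \<sigma> (2 * Suc (length cs) + 1) (\<sigma>(4 := (chs cs, Suc (length cs))))"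
    by (rule runs_ffwd) (use assms tok in auto)
  have chs_idle: "(chs cs)(Suc (length cs) := 0) = chs cs"
    by (rule ext) (simp add: chs_def)
  have lf: "runs (Act (\<lambda>r. [4 \<mapsto> (r 4, -1)])) (\<sigma>(4 := (chs cs, Suc (length cs)))) 1 (\<sigma>(4 := (chs cs, length cs)))"
    using assms chs_idle by (intro runs_Act) (auto intro!: okact_update simp: act_pair)
  have pop: "runs ?pop (\<sigma>(4 := (chs cs, length cs))) (2 * length cs + 1) (\<sigma>(4 := (chs ys, length ys)))"
    if cs: "cs = ys @ replicate j D" and ys: "chs ys (length ys) \<noteq> D" for ys j
  proof -
    define s where "s i = \<sigma>(4 := (chs (ys @ replicate (j - i) D), length ys + (j - i)))" for i
    have l: "runs ?pop (s 0) (j * (1 + 1) + 1) (s j)"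
    proof (rule runs_Loop_count)
      fix i assume "i < j"
      then obtain m where m: "j - i = Suc m" "j - Suc i = m" by (metis Suc_diff_Suc)
      have e: "ys @ replicate (Suc m) D = (ys @ replicate m D) @ [D]" by (simp add: replicate_append_same)
      have s: "s i = \<sigma>(4 := (chs ((ys @ replicate m D) @ [D]), Suc (length (ys @ replicate m D))))"
        unfolding s_def m e by simp
      have s': "s (Suc i) = \<sigma>(4 := (chs (ys @ replicate m D), length (ys @ replicate m D)))"
        unfolding s_def m by simp
      show "rd k (s i) 4 = D" unfolding s using assms(1) chs_last[of "ys @ replicate m D" D] by (simp del: append_assoc chs_last)
      show "runs (Act (\<lambda>r. [4 \<mapsto> (0, -1)])) (s i) 1 (s (Suc i))"
        unfolding s s' using assms(1) chs_clear[of "ys @ replicate m D" D]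
        by (intro runs_Act) (auto intro!: okact_update simp: act_pair nat_add_distrib simp del: append_assoc)
    next
      show "rd k (s j) 4 \<noteq> D" using ys assms(1) by (simp add: s_def)
    qed
    have "s 0 = \<sigma>(4 := (chs cs, length cs))" "s j = \<sigma>(4 := (chs ys, length ys))"
      unfolding s_def cs by simp_all
    then show ?thesis using runs_mono[OF l, of "2 * length cs + 1"] cs by simp
  qed
  show thesis
  proof (cases rule: trailing_max_cases[of cs D])
    case (1 j)
    have p: "runs ?pop (\<sigma>(4 := (chs cs, length cs))) (2 * length cs + 1) (\<sigma>(4 := (chs [], 0)))"
      using pop[of "[]" j] 1 assms(2) by simp
    have "runs (Act (\<lambda>r. [5 \<mapsto> (2, 0)])) (\<sigma>(4 := (chs [], 0))) 1 (\<sigma>(4 := (chs [], 0), 5 := act (2, 0) (\<sigma> 5)))"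
      using assms(1) K3 by (intro runs_Act) (auto intro!: okact_update)
    then have "runs ?last (\<sigma>(4 := (chs [], 0))) (1 + 1)
      (\<sigma>(4 := (chs [], 0), 5 := act (2, 0) (\<sigma> 5)))"
      by (intro runs_Cond) (use assms(1) in simp)
    from runs_Then[OF ff runs_Then[OF lf runs_Then[OF p this]]]
    have "runs (backtrack D) \<sigma> (4 * length cs + 11) (\<sigma>(4 := (chs [], 0), 5 := act (2, 0) (\<sigma> 5)))"
      unfolding backtrack_def by (rule runs_mono) simp
    with that(1) 1 show thesis by blast
  next
    case (2 zs c j)
    have c: "c < D" using 2 assms(4) by auto
    have p: "runs ?pop (\<sigma>(4 := (chs cs, length cs))) (2 * length cs + 1) (\<sigma>(4 := (chs (zs @ [c]), Suc (length zs))))"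
      using pop[of "zs @ [c]" j] 2 c by simp
    have "(chs (zs @ [c]))(Suc (length zs) := Suc c) = chs (zs @ [Suc c])" by (metis chs_clear chs_snoc fun_upd_upd)
    then have "runs (Act (\<lambda>r. [4 \<mapsto> (Suc (r 4), 0)])) (\<sigma>(4 := (chs (zs @ [c]), Suc (length zs)))) 1 (\<sigma>(4 := (chs (zs @ [Suc c]), Suc (length zs))))"
      using assms(1,2) c by (intro runs_Act) (auto intro!: okact_update simp: act_pair nat_add_distrib)
    then have "runs ?last (\<sigma>(4 := (chs (zs @ [c]), Suc (length zs)))) (1 + 1)
      (\<sigma>(4 := (chs (zs @ [Suc c]), Suc (length zs))))"
      by (intro runs_Cond) (use assms(1,2) c in simp)
    from runs_Then[OF ff runs_Then[OF lf runs_Then[OF p this]]]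
    have "runs (backtrack D) \<sigma> (4 * length cs + 11) (\<sigma>(4 := (chs (zs @ [Suc c]), Suc (length zs))))"
      unfolding backtrack_def by (rule runs_mono) simp
    with that(2) 2 c show thesis by blast
  qed
qed

lemma adv_keep [simp]: "adv (\<lambda>s. s) (g, h) = (g, Suc h)"
  by (simp add: adv_def act_pair nat_add_distrib)

lemma adv_keep_iter: "(adv (\<lambda>s. s) ^^ i) (g, h) = (g, h + i)"
  by (induction i) auto

end

text \<open>Tapes of the search: 3 the input, 4 the current choice sequence, 5 the verdict, 6 and 7 the states of
  N and M, 8 a dummy; N is simulated on the tapes from 9 on and M on those from b on.\<close>

locale dfs = env +
  fixes N M :: otm and B :: "bool list set" and T1 T2 :: "nat \<Rightarrow> nat" and U :: "(nat \<times> nat list \<times> int list) list"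
  assumes wfN: "wf_otm N" and tbN: "time_bounded N B T1"
    and wfM: "wf_otm M" and detM: "deterministic M" and tbM: "time_bounded M A T2" and decM: "decides M A B"
    and k: "k = 9 + ntapes N + ntapes M"
    and KN: "alph N \<le> K" "nstates N \<le> K" and KM: "alph M \<le> K" "nstates M \<le> K"
    and U: "\<And>q s. delta N q s \<subseteq> set U" "U \<noteq> []" "length U < K"
    and T2: "mono T2"
begin

abbreviation "D \<equiv> length U"
abbreviation "b \<equiv> 9 + ntapes N"

text \<open>Choices are numbered from 1 on, since 0 is the blank.\<close>

definition pick :: "nat \<Rightarrow> nat list \<Rightarrow> nat \<Rightarrow> (nat \<times> nat list \<times> int list) option" where
  "pick q s v = (if U ! (v - 1) \<in> delta N q s then Some (U ! (v - 1)) else None)"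

lemma sound_pick: "sound_pick N pick"
  by (auto simp: sound_pick_def pick_def split: if_splits)

lemma complete_pick: "r \<in> delta N q s \<Longrightarrow> \<exists>v\<in>{1..D}. pick q s v = Some r"
proof -
  assume r: "r \<in> delta N q s"
  then obtain i where "i < D" "U ! i = r" using U(1) by (metis in_set_conv_nth subsetD)
  then show ?thesis using r by (intro bexI[of _ "Suc i"]) (auto simp: pick_def)
qed

lemma D1: "D \<ge> 1" using U(2) by (cases U) auto

text \<open>Meaningful for \<open>i \<le> length cs\<close>, since \<open>cs ! i\<close> is
  unspecified beyond the end of the list.\<close>

definition path :: "bool list \<Rightarrow> nat list \<Rightarrow> nat \<Rightarrow> conf" where
  "path x cs i = itr N pick B (\<lambda>i. cs ! i) x i"

definition accepting :: "bool list \<Rightarrow> nat list \<Rightarrow> bool" where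
  "accepting x cs \<longleftrightarrow> set cs \<subseteq> {1..D} \<and> (\<forall>i<length cs. live N (path x cs i)) \<and> st (path x cs (length cs)) = acc N"

lemma path_append: "i \<le> length cs \<Longrightarrow> path x (cs @ zs) i = path x cs i"
  unfolding path_def by (intro ctr_cong) (auto simp: nth_append)

lemma accepts_iff: "accepts N B x \<longleftrightarrow> (\<exists>cs. accepting x cs)"
proof
  assume "accepts N B x"
  then obtain n q c where c: "reach N B x n q c" "st c = acc N" unfolding accepts_def by blast
  from reach_ctr[where V = "{1..D}" and pick = pick, OF complete_pick _ wfN c(1)] D1
  obtain ds where ds: "\<And>i. ds i \<in> {1..D}" "itr N pick B ds x n = c"
    "\<And>i. i < n \<Longrightarrow> live N (itr N pick B ds x i)" by force
  let ?cs = "map ds [0..<n]"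
  have "path x ?cs i = itr N pick B ds x i" if "i \<le> n" for i
    unfolding path_def using that by (intro ctr_cong) auto
  then have "accepting x ?cs" using ds c(2) unfolding accepting_def by auto
  then show "\<exists>cs. accepting x cs" by blast
next
  assume "\<exists>cs. accepting x cs"
  then show "accepts N B x" using ctr_acc[OF sound_pick _ _ wfN, of _ B] unfolding accepting_def path_def by blast
qed

lemma fitsN: "fits N 9 6" and fitsM: "fits M b 7"
  using wfN wfM KN KM k unfolding fits_def by auto

lemma grps: "grp N 9 6 = insert 6 {9..<b}" "grp M b 7 = insert 7 {b..<k}"
  unfolding grp_def k by auto

lemma ntN: "ntapes N \<ge> 2" using wfN unfolding wf_otm_def by simp

text \<open>\<open>N\<close> is replayed from its initial configuration for every choice sequence,
  so that no earlier configuration has to be stored or undone. The price is up to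
  \<open>T1 (length x) + 1\<close> simulated moves per candidate.\<close>

definition follow :: cmd where
  "follow = prep (\<lambda>s. s \<noteq> 0) N 9 6 3 ;; rew 4 ;; Act (\<lambda>r. [4 \<mapsto> (r 4, 1)]) ;;
     run N pick 9 6 (\<lambda>s. s \<noteq> 0) (\<lambda>s. s) 4 (subq N 9 6 M b 7 8)"

text \<open>Cells visited on the tapes of \<open>N\<close>: at most \<open>length x + 1\<close>
  after loading, and one more for each of at most \<open>T1 (length x) + 1\<close> moves. Queries
  fit into this size as well, which keeps a simulation of the decider within
  \<open>eM x\<close>.\<close>

definition eN :: "bool list \<Rightarrow> nat" where "eN x = length x + T1 (length x) + 2"
definition eM :: "bool list \<Rightarrow> nat" where "eM x = eN x + T2 (eN x) + 1"

definition qcost :: "bool list \<Rightarrow> nat" where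
  "qcost x = dcost (ntapes M) (eM x) (eN x) (T2 (eN x)) + 6 * eN x + 10"

definition fcost :: "bool list \<Rightarrow> nat" where
  "fcost x = ntapes N * (4 * eN x + 6) + 6 * eN x + 2 * T1 (length x) + (T1 (length x) + 1) * (qcost x + 4) + 22"

definition ready :: "bool list \<Rightarrow> store \<Rightarrow> bool" where
  "ready x \<sigma> \<longleftrightarrow> \<sigma> 1 = blank \<and> \<sigma> 3 = (loaded x, 0) \<and> grpok 9 (ntapes N) (eN x) \<sigma> \<and> grpok b (ntapes M) (eM x) \<sigma>"

lemma ready_cong: "ready x \<sigma> \<Longrightarrow> (\<And>t. t \<notin> {2, 4, 5, 6, 7, 8} \<Longrightarrow> \<sigma>' t = \<sigma> t) \<Longrightarrow> ready x \<sigma>'"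
  unfolding ready_def grpok_def by auto

text \<open>The replay ends after the last digit, where tape 4 reads as blank, or earlier in a
  halting configuration. \<open>n\<close> is the number of digits consumed, and the head position on
  tape 4 records it.\<close>

lemma runs_follow:
  assumes ready: "ready x \<sigma>" and cs: "set cs \<subseteq> {1..D}" "length cs \<le> T1 (length x) + 1"
    and \<sigma>4: "\<sigma> 4 = (chs cs, h)" "h \<le> Suc (length cs)"
  shows "\<exists>\<sigma>' n. runs follow \<sigma> (fcost x) \<sigma>' \<and> n \<le> length cs \<and> (\<forall>i<n. live N (path x cs i)) \<and>
    (n < length cs \<longrightarrow> \<not> live N (path x cs n)) \<and> cur (\<sigma>' 6) = st (path x cs n) \<and> \<sigma>' 4 = (chs cs, Suc n) \<and>
    ready x \<sigma>' \<and> \<sigma>' 5 = \<sigma> 5"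
proof -
  let ?run = "run N pick 9 6 (\<lambda>s. s \<noteq> 0) (\<lambda>s. s) 4 (subq N 9 6 M b 7 8)"
  let ?q = "subq N 9 6 M b 7 8"
  let ?prep = "prep (\<lambda>s. s \<noteq> 0) N 9 6 3"
  let ?T = "T1 (length x)"
  have k9: "9 < k" "8 < k" "6 < k" "4 < k" "3 < k" using k ntN by auto
  let ?E = "max 1 (length x)"
  have 3: "\<sigma> 3 = (loaded x, 0)" "\<sigma> 1 = blank" "grpok 9 (ntapes N) (eN x) \<sigma>" "grpok b (ntapes M) (eM x) \<sigma>"
    using ready by (auto simp: ready_def)
  have gr: "3 \<notin> grp N 9 6" by (simp add: grp_def)
  obtain \<sigma>1 where 1: "runs ?prep \<sigma> (ntapes N * (4 * eN x + 6) + 6 * ?E + 12) \<sigma>1"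
    "rep N 9 6 (init_conf N x) ?E \<sigma>1" "\<And>t. t \<notin> grp N 9 6 \<Longrightarrow> \<sigma>1 t = \<sigma> t"
    using runs_prep_filled[where w = x and f = "inp x", OF fitsN k9(5) gr 3(3) inp_less 3(1) inp_beyond] by metis
  have tok: "tok (chs cs) (Suc (length cs))" by (rule tok_chs) (use cs(1) U(3) in auto)
  have \<sigma>14: "\<sigma>1 4 = (chs cs, h)" using 1(3)[of 4] \<sigma>4 unfolding grps by simp
  have 2: "runs (rew 4) \<sigma>1 (2 * h + 1) (\<sigma>1(4 := (chs cs, 0)))" by (rule runs_rew) (use k9 tok \<sigma>14 in auto)
  have "(chs cs)(0 := Suc K) = chs cs" by (auto simp: chs_def)
  then have 3: "runs (Act (\<lambda>r. [4 \<mapsto> (r 4, 1)])) (\<sigma>1(4 := (chs cs, 0))) 1 (\<sigma>1(4 := (chs cs, 1)))"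
    using k9 by (intro runs_Act) (auto intro!: okact_update simp: act_pair)
  let ?\<sigma>2 = "\<sigma>1(4 := (chs cs, 1))"
  define J where "J \<sigma>' \<longleftrightarrow> \<sigma>' 1 = blank \<and> grpok b (ntapes M) (eM x) \<sigma>' \<and> \<sigma>' 3 = \<sigma> 3 \<and> \<sigma>' 5 = \<sigma> 5" for \<sigma>'
  have J2: "J ?\<sigma>2"
    using ready 1(3) unfolding J_def ready_def grps by (auto intro!: grpok_cong[of b _ _ \<sigma>])
  let ?s = "\<lambda>i. (adv (\<lambda>s. s) ^^ i) (chs cs, 1)"
  have s: "?s i = (chs cs, Suc i)" for i unfolding adv_keep_iter by simp
  have C: "ctr N pick B (\<lambda>i. cur (?s i)) (init_conf N x) i = path x cs i" if "i \<le> length cs" for i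
    unfolding path_def using that by (intro ctr_cong) (simp add: adv_keep_iter chs_nth)
  define n where "n = (LEAST i. i = length cs \<or> \<not> live N (path x cs i))"
  have n1: "n = length cs \<or> \<not> live N (path x cs n)" unfolding n_def by (rule LeastI[of _ "length cs"]) simp
  have n2: "i \<noteq> length cs \<and> live N (path x cs i)" if "i < n" for i
    using not_less_Least[of i "\<lambda>i. i = length cs \<or> \<not> live N (path x cs i)"] that unfolding n_def by blast
  have n3: "n \<le> length cs" unfolding n_def by (rule Least_le) simp
  have nT: "n \<le> ?T + 1" using n3 cs(2) by simp
  have rep2: "rep N 9 6 (init_conf N x) ?E ?\<sigma>2" using 1(2) by (rule rep_cong) auto
  have "\<exists>\<sigma>'. runs ?run ?\<sigma>2 (n * (qcost x + 4) + 1) \<sigma>' \<and>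
     rep N 9 6 (ctr N pick B (\<lambda>i. cur (?s i)) (init_conf N x) n) (?E + n) \<sigma>' \<and> \<sigma>' 4 = ?s n \<and> J \<sigma>'"
  proof (rule runs_run[where n = n and J = J and E = "max 1 (length x)" and \<sigma> = ?\<sigma>2 and ?c0.0 = "init_conf N x", OF fitsN k9(4) _ sound_pick _ _ _ _ _ rep2 _ J2])
    fix i \<sigma>3 assume i: "i < n" and "rep N 9 6 (ctr N pick B (\<lambda>i. cur (?s i)) (init_conf N x) i) (?E + i) \<sigma>3" and J3: "J \<sigma>3"
    then have r: "rep N 9 6 (path x cs i) (?E + i) \<sigma>3" using C[of i] n3 by simp
    have E: "?E + i \<le> eN x" using i nT unfolding eN_def by auto
    have "\<exists>\<sigma>'. runs ?q \<sigma>3 (dcost (ntapes M) (eM x) (?E + i) (T2 (eN x)) + 6 * (?E + i) + 10) \<sigma>' \<and>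
      rep N 9 6 (answer_step N B (path x cs i)) (?E + i) \<sigma>' \<and> grpok b (ntapes M) (eM x) \<sigma>' \<and> \<sigma>' 1 = blank \<and>
      (\<forall>t. t \<notin> grp N 9 6 \<union> grp M b 7 \<union> {1, 2, 8} \<longrightarrow> \<sigma>' t = \<sigma>3 t)"
    proof (rule runs_subq[OF detM tbM decM fitsN fitsM _ k9(2) _ _ _ r])
      show "T2 n \<le> T2 (eN x)" if "n \<le> ?E + i" for n using monoD[OF T2] that E by (meson order_trans)
      show "?E + i + T2 (eN x) + 1 \<le> eM x" using E unfolding eM_def by simp
    qed (use J3 in \<open>auto simp: J_def grps\<close>)
    then obtain \<sigma>4 where 4: "runs ?q \<sigma>3 (dcost (ntapes M) (eM x) (?E + i) (T2 (eN x)) + 6 * (?E + i) + 10) \<sigma>4"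
      "rep N 9 6 (answer_step N B (path x cs i)) (?E + i) \<sigma>4" "grpok b (ntapes M) (eM x) \<sigma>4" "\<sigma>4 1 = blank"
      "\<And>t. t \<notin> grp N 9 6 \<union> grp M b 7 \<union> {1, 2, 8} \<Longrightarrow> \<sigma>4 t = \<sigma>3 t" by blast
    have "runs ?q \<sigma>3 (qcost x) \<sigma>4"
      using 4(1) unfolding qcost_def by (rule runs_mono) (intro add_mono dcost_mono mult_le_mono2 order_refl E)
    moreover have "\<sigma>4 3 = \<sigma>3 3" "\<sigma>4 4 = \<sigma>3 4" "\<sigma>4 5 = \<sigma>3 5" using 4(5) unfolding grps by auto
    ultimately show "\<exists>\<sigma>'. runs ?q \<sigma>3 (qcost x) \<sigma>' \<and>
      rep N 9 6 (answer_step N B (ctr N pick B (\<lambda>i. cur (?s i)) (init_conf N x) i)) (?E + i + 1) \<sigma>' \<and> J \<sigma>' \<and> \<sigma>' 4 = \<sigma>3 4"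
      using rep_mono[OF 4(2)] 4(3,4) J3 C[of i] n3 i unfolding J_def by (intro exI[of _ \<sigma>4]) auto
  next
    fix \<sigma>3 \<sigma>4 assume "J \<sigma>3" "\<And>t. t \<notin> grp N 9 6 \<Longrightarrow> t \<noteq> 4 \<Longrightarrow> \<sigma>4 t = \<sigma>3 t"
    then show "J \<sigma>4" unfolding J_def grps by (auto intro!: grpok_cong[of b _ _ \<sigma>3])
  next
    fix i assume i: "i < n"
    have "cs ! i \<in> {1..D}" using cs(1) i n3 by (meson le_less_trans less_le_trans nth_mem subsetD)
    then show "cur (?s i) \<noteq> 0 \<and> live N (ctr N pick B (\<lambda>i. cur (?s i)) (init_conf N x) i)"
      "cur (?s i) < 2 * K + 2" using n2[OF i] C[of i] n3 i U(3) by (auto simp: adv_keep_iter chs_nth)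
  next
    show "\<not> (cur (?s n) \<noteq> 0 \<and> live N (ctr N pick B (\<lambda>i. cur (?s i)) (init_conf N x) n))"
      using n1 C[OF n3] by (auto simp: adv_keep_iter)
  qed (auto simp: grps qcost_def)
  then obtain \<sigma>5 where 5: "runs ?run ?\<sigma>2 (n * (qcost x + 4) + 1) \<sigma>5"
     "rep N 9 6 (path x cs n) (?E + n) \<sigma>5" "\<sigma>5 4 = (chs cs, Suc n)" "J \<sigma>5" using C[OF n3] s by auto
  have e1: "\<sigma>1(4 := (chs cs, 0), 4 := (chs cs, 1)) = ?\<sigma>2" by simp
  have "runs follow \<sigma> (fcost x) \<sigma>5"
    unfolding follow_def
  proof (rule runs_mono[OF runs_Then[OF 1(1) runs_Then[OF 2 runs_Then[OF 3 5(1)]]]])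
    have "n * (qcost x + 4) \<le> (?T + 1) * (qcost x + 4)" using nT by (rule mult_le_mono1)
    moreover have "?E \<le> eN x" "h \<le> ?T + 2" using \<sigma>4(2) cs(2) unfolding eN_def by auto
    ultimately show "ntapes N * (4 * eN x + 6) + 6 * ?E + 12 + (2 * h + 1 + (1 + (n * (qcost x + 4) + 1) + 1) + 1) + 1 \<le> fcost x"
      unfolding fcost_def by linarith
  qed
  moreover have "cur (\<sigma>5 6) = st (path x cs n)" using 5(2) unfolding rep_def by simp
  moreover have "ready x \<sigma>5"
  proof -
    have "?E + n \<le> eN x" using nT unfolding eN_def by auto
    then show ?thesis using grpok_mono[OF rep_grpok[OF 5(2)]] 5(4) ready unfolding ready_def J_def by auto
  qed
  ultimately show ?thesis using n1 n2 n3 5(3,4) unfolding J_def by (intro exI[of _ \<sigma>5] exI[of _ n]) auto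
qed

text \<open>A blank under the head of tape 4 signals that all digits were consumed. If
  \<open>N\<close> has not halted by then, the search descends to the first child; in all other
  nonaccepting cases the subtree below the sequence is dead and is skipped.\<close>

definition body :: cmd where
  "body = follow ;; Cond (\<lambda>r. r 6 = acc N) (Act (\<lambda>r. [5 \<mapsto> (1, 0)]))
     (Cond (\<lambda>r. r 4 = 0 \<and> r 6 \<noteq> rej N) (Act (\<lambda>r. [4 \<mapsto> (1, 0)])) (backtrack D))"

text \<open>The second disjunct of the invariant: the search is over and tape 5 holds the verdict.\<close>

definition inv :: "bool list \<Rightarrow> nat \<Rightarrow> store \<Rightarrow> bool" where
  "inv x m \<sigma> \<longleftrightarrow> ready x \<sigma> \<and> (\<exists>cs h. \<sigma> 4 = (chs cs, h) \<and> h \<le> Suc (length cs) \<and> set cs \<subseteq> {1..D} \<and>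
     length cs \<le> T1 (length x) + 1 \<and>
     (cur (\<sigma> 5) = 0 \<and> m = (D + 1) ^ (T1 (length x) + 1) - mu D (T1 (length x) + 1) cs \<and>
        (\<forall>ds. accepting x ds \<longrightarrow> dle cs ds) \<or>
      m = 0 \<and> cur (\<sigma> 5) = (if accepts N B x then 1 else 2)))"

lemma inv_step:
  assumes inv: "inv x m \<sigma>" and 0: "cur (\<sigma> 5) = 0"
  shows "\<exists>\<sigma>'. runs body \<sigma> (fcost x + 4 * T1 (length x) + 18) \<sigma>' \<and> (\<exists>m' < m. inv x m' \<sigma>')"
proof -
  let ?T = "T1 (length x)"
  let ?H = "?T + 1"
  have k9: "9 < k" "8 < k" "6 < k" "4 < k" "3 < k" "5 < k" using k ntN by auto
  from inv obtain cs h where cs: "\<sigma> 4 = (chs cs, h)" "h \<le> Suc (length cs)" "set cs \<subseteq> {1..D}" "length cs \<le> ?H"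
     and or: "cur (\<sigma> 5) = 0 \<and> m = (D + 1) ^ ?H - mu D ?H cs \<and> (\<forall>ds. accepting x ds \<longrightarrow> dle cs ds) \<or>
       m = 0 \<and> cur (\<sigma> 5) = (if accepts N B x then 1 else 2)" and ready: "ready x \<sigma>"
    unfolding inv_def by blast
  have "cur (\<sigma> 5) \<noteq> (if accepts N B x then 1 else 2)" unfolding 0 by simp
  with or have m: "m = (D + 1) ^ ?H - mu D ?H cs" and before: "\<And>ds. accepting x ds \<Longrightarrow> dle cs ds" by blast+
  have D: "d \<le> D" if "accepting x ds" "d \<in> set ds" for ds d using that unfolding accepting_def by auto
  have mpos: "mu D ?H cs < (D + 1) ^ ?H" by (rule mu_less) (use cs(3) in auto)
  have m0: "0 < m" using m mpos by simp
  from runs_follow[OF ready cs(3,4,1,2)] obtain \<sigma>1 n where f: "runs follow \<sigma> (fcost x) \<sigma>1" "n \<le> length cs" "\<And>i. i < n \<Longrightarrow> live N (path x cs i)"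
    "n < length cs \<Longrightarrow> \<not> live N (path x cs n)" "cur (\<sigma>1 6) = st (path x cs n)" "\<sigma>1 4 = (chs cs, Suc n)"
    "ready x \<sigma>1" "\<sigma>1 5 = \<sigma> 5" by blast
  have \<sigma>14: "cur (\<sigma>1 4) = 0 \<longleftrightarrow> n = length cs"
  proof (cases "n = length cs")
    case False
    then have "cs ! n \<in> {1..D}" using cs(3) f(2) by (meson le_neq_implies_less nth_mem subsetD)
    then show ?thesis using False f(2,6) by (simp add: chs_nth)
  qed (use f(6) in simp)
  let ?dec = "Cond (\<lambda>r. r 6 = acc N) (Act (\<lambda>r. [5 \<mapsto> (1, 0)]))
     (Cond (\<lambda>r. r 4 = 0 \<and> r 6 \<noteq> rej N) (Act (\<lambda>r. [4 \<mapsto> (1, 0)])) (backtrack D))"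
  have "\<exists>\<sigma>'. runs ?dec \<sigma>1 (4 * ?T + 17) \<sigma>' \<and> (\<exists>m' < m. inv x m' \<sigma>')"
  proof (cases "st (path x cs n) = acc N")
    case True
    \<comment> \<open>Acceptance may come before the digits are used up; the witness is the consumed
      prefix.\<close>
    have "accepting x (take n cs)"
    proof -
      have "path x (take n cs) i = path x cs i" if "i \<le> n" for i
        using path_append[of i "take n cs" x "drop n cs"] that f(2) by simp
      moreover have "length (take n cs) = n" using f(2) by simp
      ultimately show ?thesis using True f(3) cs(3) set_take_subset[of n cs] unfolding accepting_def by auto
    qed
    then have "accepts N B x" using accepts_iff by blast
    then have "inv x 0 (\<sigma>1(5 := act (1, 0) (\<sigma>1 5)))"
      using ready_cong[OF f(7), of "\<sigma>1(5 := act (1, 0) (\<sigma>1 5))"] f(2,6) cs(3,4) unfolding inv_def by auto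
    moreover have "runs (Act (\<lambda>r. [5 \<mapsto> (1, 0)])) \<sigma>1 1 (\<sigma>1(5 := act (1, 0) (\<sigma>1 5)))"
      using k9 by (intro runs_Act) (auto intro!: okact_update)
    then have "runs ?dec \<sigma>1 (1 + 1) (\<sigma>1(5 := act (1, 0) (\<sigma>1 5)))"
      by (intro runs_Cond) (use k9 True f(5) in simp)
    then have "runs ?dec \<sigma>1 (4 * ?T + 17) (\<sigma>1(5 := act (1, 0) (\<sigma>1 5)))" by (rule runs_mono) simp
    ultimately show ?thesis using m0 by blast
  next
    case not_acc: False
    show ?thesis
    proof (cases "n = length cs \<and> st (path x cs n) \<noteq> rej N")
      case True
      let ?\<sigma>' = "\<sigma>1(4 := (chs (cs @ [1]), Suc (length cs)))"
      \<comment> \<open>All configurations on this path are live, including the last, so the time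
        bound of \<open>N\<close> leaves room for one more digit. This keeps the depth of the search
        bounded.\<close>
      have "length cs + 1 \<le> ?H"
      proof (rule ctr_bound[OF sound_pick _ tbN])
        show "live N (itr N pick B (\<lambda>i. cs ! i) x i)" if "i < length cs + 1" for i
          using that True not_acc f(3)[of i] unfolding path_def live_def by (cases "i = n") auto
      qed
      then have len: "length cs < ?H" by simp
      have "dle (cs @ [1]) ds" if "accepting x ds" for ds
      proof (rule dle_snoc[OF before[OF that]])
        show "ds \<noteq> cs" using that True not_acc unfolding accepting_def by auto
        show "d \<ge> 1" if "d \<in> set ds" for d using \<open>accepting x ds\<close> that unfolding accepting_def by auto
      qed
      then have "inv x ((D + 1) ^ ?H - mu D ?H (cs @ [1])) ?\<sigma>'"
        using ready_cong[OF f(7), of ?\<sigma>'] cs(3) len D1 0 f(8) unfolding inv_def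
        by (intro conjI exI[of _ "cs @ [1]"] exI[of _ "Suc (length cs)"]) auto
      moreover have "mu D ?H cs < mu D ?H (cs @ [1])" using mu_snoc[OF len, of D 0] by simp
      then have "(D + 1) ^ ?H - mu D ?H (cs @ [1]) < m" using mpos m by auto
      moreover have "runs (Act (\<lambda>r. [4 \<mapsto> (1, 0)])) \<sigma>1 1 ?\<sigma>'"
        using k9 f(6) True by (intro runs_Act) (auto intro!: okact_update simp: act_pair chs_snoc nat_add_distrib)
      then have "runs (Cond (\<lambda>r. r 4 = 0 \<and> r 6 \<noteq> rej N) (Act (\<lambda>r. [4 \<mapsto> (1, 0)])) (backtrack D)) \<sigma>1 (1 + 1) ?\<sigma>'"
        by (intro runs_Cond) (use True f(5) \<sigma>14 k9 in auto)
      then have "runs ?dec \<sigma>1 (1 + 1 + 1) ?\<sigma>'"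
        by (intro runs_Cond) (use not_acc f(5) k9 in simp)
      then have "runs ?dec \<sigma>1 (4 * ?T + 17) ?\<sigma>'" by (rule runs_mono) simp
      ultimately show ?thesis by blast
    next
      case dead: False
      have nl: "\<not> live N (path x cs n)" using f(2,4) dead unfolding live_def by (cases "n = length cs") auto
      \<comment> \<open>Every extension of \<open>cs\<close> runs through the same halted,
        nonaccepting configuration after \<open>n\<close> moves.\<close>
      have no: "ds \<noteq> cs @ zs" if "accepting x ds" for ds zs
      proof
        assume ds: "ds = cs @ zs"
        then have p: "path x ds n = path x cs n" using path_append f(2) by simp
        show False
        proof (cases "n < length ds")
          case True
          then show False using that nl p unfolding accepting_def by auto
        next
          case False
          then have "n = length ds" using f(2) ds by simp
          then show False using that not_acc p unfolding accepting_def by auto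
        qed
      qed
      have slt: "slt cs ds" if "accepting x ds" for ds
        using before[OF that] no[OF that] unfolding dle_def by blast
      have n1: "Suc n \<le> Suc (length cs)" using f(2) by simp
      have dec: "runs ?dec \<sigma>1 (4 * ?T + 17) \<sigma>'" if "runs (backtrack D) \<sigma>1 (4 * length cs + 11) \<sigma>'" for \<sigma>'
      proof -
        have "runs ?dec \<sigma>1 (4 * length cs + 11 + 1 + 1) \<sigma>'"
        proof (rule runs_Cond)
          have "runs (Cond (\<lambda>r. r 4 = 0 \<and> r 6 \<noteq> rej N) (Act (\<lambda>r. [4 \<mapsto> (1, 0)])) (backtrack D)) \<sigma>1 (4 * length cs + 11 + 1) \<sigma>'"
            by (rule runs_Cond) (use that dead \<sigma>14 f(5) k9 in auto)
          then show "runs (if rd k \<sigma>1 6 = acc N then Act (\<lambda>r. [5 \<mapsto> (1, 0)]) else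
             Cond (\<lambda>r. r 4 = 0 \<and> r 6 \<noteq> rej N) (Act (\<lambda>r. [4 \<mapsto> (1, 0)])) (backtrack D)) \<sigma>1 (4 * length cs + 11 + 1) \<sigma>'"
            using not_acc f(5) k9 by simp
        qed
        then show ?thesis by (rule runs_mono) (use cs(4) in simp)
      qed
      show ?thesis
      proof (cases rule: runs_backtrack[where \<sigma> = \<sigma>1 and cs = cs and h = "Suc n", OF k9(6) U(3) D1 cs(3) f(6) n1])
        case (1 j)
        have "\<not> accepts N B x" unfolding accepts_iff
        proof
          assume "\<exists>ds. accepting x ds"
          then obtain ds where "accepting x ds" by blast
          from slt[OF this] D[OF this] show False using not_slt_replicate_max[of ds D j] 1(1) by blast
        qed
        then have "inv x 0 (\<sigma>1(4 := (chs [], 0), 5 := act (2, 0) (\<sigma>1 5)))"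
          using ready_cong[OF f(7), of "\<sigma>1(4 := (chs [], 0), 5 := act (2, 0) (\<sigma>1 5))"] unfolding inv_def
          by (intro conjI exI[of _ "[]"] exI[of _ 0]) auto
        then show ?thesis using dec[OF 1(2)] m0 by blast
      next
        case (2 zs c j)
        let ?\<sigma>' = "\<sigma>1(4 := (chs (zs @ [Suc c]), Suc (length zs)))"
        have "dle (zs @ [Suc c]) ds" if "accepting x ds" for ds
          using dle_next[of zs c j D ds] slt[OF that] D[OF that] 2(1) by blast
        then have "inv x ((D + 1) ^ ?H - mu D ?H (zs @ [Suc c])) ?\<sigma>'"
          using ready_cong[OF f(7), of ?\<sigma>'] cs(3,4) 0 f(8) 2(1,2) unfolding inv_def
          by (intro conjI exI[of _ "zs @ [Suc c]"] exI[of _ "Suc (length zs)"]) auto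
        moreover have "mu D ?H cs < mu D ?H (zs @ [Suc c])"
          by (rule mu_slt) (use slt_next 2(1) cs(3,4) in auto)
        then have "(D + 1) ^ ?H - mu D ?H (zs @ [Suc c]) < m" using mpos m by auto
        ultimately show ?thesis using dec[OF 2(3)] by blast
      qed
    qed
  qed
  then obtain \<sigma>' m' where "runs ?dec \<sigma>1 (4 * ?T + 17) \<sigma>'" "m' < m" "inv x m' \<sigma>'" by blast
  moreover have "runs body \<sigma> (fcost x + 4 * ?T + 18) \<sigma>'"
    unfolding body_def using runs_mono[OF runs_Then[OF f(1) calculation(1)]] by simp
  ultimately show ?thesis by blast
qed

definition prog :: cmd where
  "prog = flag_all ({3, 4} \<union> {9..<k}) ;; load 3 ;; Loop (\<lambda>r. r 5 = 0) body ;; Act (\<lambda>r. [2 \<mapsto> (if r 5 = 1 then 1 else 2, 0)])"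

text \<open>The measure starts at \<open>(D + 1) ^ (t + 1)\<close>, which bounds the number of
  rounds; a round costs one replay \<open>f\<close> plus the change to the next sequence.\<close>

definition pcost :: "nat \<Rightarrow> nat \<Rightarrow> nat \<Rightarrow> nat" where
  "pcost n t f = 4 * n + (D + 1) ^ (t + 1) * (f + 4 * t + 19) + 9"

lemma runs_prog:
  "\<exists>\<sigma>'. runs prog (init_store x) (pcost (length x) (T1 (length x)) (fcost x)) \<sigma>' \<and> cur (\<sigma>' 2) = (if accepts N B x then 1 else 2)"
proof -
  have k9: "9 < k" "8 < k" "6 < k" "4 < k" "3 < k" "5 < k" "2 < k" using k ntN by auto
  let ?S = "{3, 4} \<union> {9..<k}"
  define \<sigma>1 where "\<sigma>1 = (\<lambda>t. if t \<in> ?S then (fresh, 0) else init_store x t)"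
  have 1: "runs (flag_all ?S) (init_store x) 1 \<sigma>1"
    unfolding \<sigma>1_def by (rule runs_flag_all) (use k9 in \<open>auto simp: init_store_def\<close>)
  let ?\<sigma>2 = "\<sigma>1(0 := (inp x, length x), 3 := (loaded x, 0))"
  have 2: "runs (load 3) \<sigma>1 (4 * length x + 3) ?\<sigma>2"
    by (rule runs_load) (use k9 in \<open>auto simp: \<sigma>1_def init_store_def\<close>)
  have fr: "\<exists>g h e. (fresh, 0) = (g, h) \<and> tok g e \<and> h \<le> e \<and> e \<le> E" if "E \<ge> 1" for E
    using tok_fresh that by auto
  have "ready x ?\<sigma>2"
    unfolding ready_def grpok_def
  proof (intro conjI allI impI)
    fix t assume "t < ntapes N"
    then have "?\<sigma>2 (9 + t) = (fresh, 0)" using k by (auto simp: \<sigma>1_def)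
    then show "\<exists>g h e. ?\<sigma>2 (9 + t) = (g, h) \<and> tok g e \<and> h \<le> e \<and> e \<le> eN x" using fr[of "eN x"] unfolding eN_def by auto
  next
    fix t assume "t < ntapes M"
    then have "?\<sigma>2 (b + t) = (fresh, 0)" using k by (auto simp: \<sigma>1_def)
    then show "\<exists>g h e. ?\<sigma>2 (b + t) = (g, h) \<and> tok g e \<and> h \<le> e \<and> e \<le> eM x" using fr[of "eM x"] unfolding eM_def by auto
  qed (auto simp: \<sigma>1_def init_store_def blank_def)
  \<comment> \<open>The search starts at the root, where \<open>mu\<close> is 0 and every sequence
    is still to come.\<close>
  then have "inv x ((D + 1) ^ (T1 (length x) + 1)) ?\<sigma>2"
    unfolding inv_def
    by (intro conjI exI[of _ "[]"] exI[of _ 0]) (auto simp: \<sigma>1_def chs_Nil init_store_def blank_def dle_def)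
  from runs_Loop_measure[where I = "inv x" and P = "\<lambda>r. r 5 = 0" and c = body and T = "fcost x + 4 * T1 (length x) + 18", OF _ this] inv_step k9
  obtain \<sigma>3 m where 3: "runs (Loop (\<lambda>r. r 5 = 0) body) ?\<sigma>2 ((D + 1) ^ (T1 (length x) + 1) * ((fcost x + 4 * T1 (length x) + 18) + 1) + 1) \<sigma>3"
    "inv x m \<sigma>3" "cur (\<sigma>3 5) \<noteq> 0" by auto
  then have v: "cur (\<sigma>3 5) = (if accepts N B x then 1 else 2)" unfolding inv_def by auto
  let ?\<sigma>4 = "\<sigma>3(2 := act (if accepts N B x then 1 else 2, 0) (\<sigma>3 2))"
  have 4: "runs (Act (\<lambda>r. [2 \<mapsto> (if r 5 = 1 then 1 else 2, 0)])) \<sigma>3 1 ?\<sigma>4"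
    using k9 v K3 by (intro runs_Act) (auto intro!: okact_update)
  have "runs prog (init_store x) (pcost (length x) (T1 (length x)) (fcost x)) ?\<sigma>4"
    unfolding prog_def by (rule runs_mono[OF runs_Then[OF 1 runs_Then[OF 2 runs_Then[OF 3(1) 4]]]]) (simp add: pcost_def)
  then show ?thesis by (intro exI[of _ ?\<sigma>4]) auto
qed

end

section \<open>Iterated exponentials\<close>

lemma expi_mono: "x \<le> y \<Longrightarrow> expi i x \<le> expi i y"
  by (induction i) auto

lemma expi_ge: "x \<le> expi i x"
  by (induction i) (auto intro: order_trans[OF _ less_imp_le[OF less_exp]])

lemma expi_add: "expi i (expi j x) = expi (i + j) x"
  by (induction i) auto

lemma expi_le_level: "i \<le> j \<Longrightarrow> expi i x \<le> expi j x"
  using expi_ge[of "expi i x" "j - i"] by (simp add: expi_add)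

text \<open>Above level 0 doubling adds 1 to the exponent, and the induction hypothesis makes room
  for twice the exponent, which is at least 1.\<close>

lemma expi_double: "1 \<le> y \<Longrightarrow> 2 * expi i y \<le> expi i (2 * y)"
proof (induction i)
  case (Suc i)
  have "1 \<le> expi i y" using Suc.prems expi_ge order_trans by blast
  then have "Suc (expi i y) \<le> expi i (2 * y)" using Suc by simp
  then show ?case by (simp flip: power_Suc)
qed simp

text \<open>At positive level squaring doubles the exponent, so \<open>expi_double\<close> one level
  below applies.\<close>

lemma expi_square: "2 \<le> y \<Longrightarrow> expi i y * expi i y \<le> expi i (y * y)"
proof (cases i)
  case (Suc j)
  assume y: "2 \<le> y"
  have "2 * expi j y \<le> expi j (2 * y)" using y by (intro expi_double) simp
  also have "\<dots> \<le> expi j (y * y)" using y by (intro expi_mono) simp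
  finally show ?thesis using Suc by (simp add: mult_2 flip: power_add)
qed simp

text \<open>Bounds are only compared from n = 2 on, where n ^ K absorbs constants.\<close>

definition expclass :: "nat \<Rightarrow> (nat \<Rightarrow> nat) set" where
  "expclass i = {f. \<exists>K. \<forall>n\<ge>2. f n \<le> expi i (n ^ K)}"

lemma expclassI: "(\<And>n. 2 \<le> n \<Longrightarrow> f n \<le> expi i (n ^ K)) \<Longrightarrow> f \<in> expclass i"
  unfolding expclass_def by blast

lemma expclassE:
  assumes "f \<in> expclass i"
  obtains K where "\<And>n. 2 \<le> n \<Longrightarrow> f n \<le> expi i (n ^ K)"
  using assms unfolding expclass_def by blast

lemma expclass_le:
  assumes "f \<in> expclass i" "\<And>n. g n \<le> f n"
  shows "g \<in> expclass i"
proof -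
  obtain K where "\<And>n. 2 \<le> n \<Longrightarrow> f n \<le> expi i (n ^ K)" using expclassE[OF assms(1)] by metis
  then show ?thesis using order_trans[OF assms(2)] by (intro expclassI[where K = K]) metis
qed

lemma expclass_level:
  assumes "f \<in> expclass i" "i \<le> j"
  shows "f \<in> expclass j"
proof -
  obtain K where "\<And>n. 2 \<le> n \<Longrightarrow> f n \<le> expi i (n ^ K)" using expclassE[OF assms(1)] by metis
  then show ?thesis using order_trans[OF _ expi_le_level[OF assms(2)]] by (intro expclassI[where K = K]) metis
qed

lemma expclass_power_id: "(\<lambda>n. n ^ m) \<in> expclass i"
  unfolding expclass_def using expi_ge by blast

lemma expclass_id [intro, simp]: "(\<lambda>n. n) \<in> expclass i"
  using expclass_power_id[of 1 i] by simp

lemma expclass_const [intro, simp]: "(\<lambda>_. c) \<in> expclass i"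
proof -
  have "c \<le> expi i (n ^ c)" if "2 \<le> n" for n
  proof -
    have "c \<le> 2 ^ c" using less_exp[of c] by simp
    also have "\<dots> \<le> n ^ c" using that by (intro power_mono) auto
    finally show ?thesis using expi_ge order_trans by blast
  qed
  then show ?thesis unfolding expclass_def by blast
qed

lemma expclass_common:
  assumes "f \<in> expclass i" "g \<in> expclass i"
  obtains c where "\<And>n. 2 \<le> n \<Longrightarrow> f n \<le> expi i (n ^ c)" "\<And>n. 2 \<le> n \<Longrightarrow> g n \<le> expi i (n ^ c)" "c \<ge> 1"
proof -
  obtain a b where a: "\<And>n. 2 \<le> n \<Longrightarrow> f n \<le> expi i (n ^ a)" and b: "\<And>n. 2 \<le> n \<Longrightarrow> g n \<le> expi i (n ^ b)"
    using assms unfolding expclass_def by blast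
  have "expi i (n ^ a) \<le> expi i (n ^ (a + b + 1))" "expi i (n ^ b) \<le> expi i (n ^ (a + b + 1))" if "2 \<le> n" for n
    using that by (intro expi_mono power_increasing; simp)+
  with a b show ?thesis by (intro that[of "a + b + 1"]) (metis order_trans, metis order_trans, simp)
qed

lemma expclass_mult [intro, simp]:
  assumes "f \<in> expclass i" "g \<in> expclass i"
  shows "(\<lambda>n. f n * g n) \<in> expclass i"
proof -
  from expclass_common[OF assms] obtain c where c: "\<And>n. 2 \<le> n \<Longrightarrow> f n \<le> expi i (n ^ c)" "\<And>n. 2 \<le> n \<Longrightarrow> g n \<le> expi i (n ^ c)" "c \<ge> 1" by metis
  have "f n * g n \<le> expi i (n ^ (c + c))" if n: "2 \<le> n" for n
  proof -
    have "n ^ 1 \<le> n ^ c" using n c(3) by (intro power_increasing) auto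
    then have "2 \<le> n ^ c" using n by simp
    then have "expi i (n ^ c) * expi i (n ^ c) \<le> expi i (n ^ (c + c))" unfolding power_add by (rule expi_square)
    then show ?thesis using mult_le_mono[OF c(1,2)[OF n]] by (rule order_trans[rotated])
  qed
  then show ?thesis unfolding expclass_def by blast
qed

text \<open>Reduced to products, since f + g is at most (f + 1) * (g + 1); only adding 1 has to be
  treated separately.\<close>

lemma expclass_add [intro, simp]:
  assumes "f \<in> expclass i" "g \<in> expclass i"
  shows "(\<lambda>n. f n + g n) \<in> expclass i"
proof -
  have suc: "(\<lambda>n. h n + 1) \<in> expclass i" if "h \<in> expclass i" for h
  proof -
    have "(\<lambda>n. h n * 1 + 1) \<in> expclass i" if h: "h \<in> expclass i"
    proof -
      from expclass_common[OF h h] obtain c where c: "\<And>n. 2 \<le> n \<Longrightarrow> h n \<le> expi i (n ^ c)" "c \<ge> 1" by metis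
      have "h n * 1 + 1 \<le> expi i (n ^ (c + c))" if n: "2 \<le> n" for n
      proof -
        have "n ^ 1 \<le> n ^ c" using n c(2) by (intro power_increasing) auto
        then have 2: "2 \<le> n ^ c" using n by simp
        then have 3: "2 \<le> expi i (n ^ c)" using expi_ge order_trans by blast
        have "h n * 1 + 1 \<le> expi i (n ^ c) + expi i (n ^ c)" using c(1)[OF n] 3 by simp
        also have "\<dots> = 2 * expi i (n ^ c)" by simp
        also have "\<dots> \<le> expi i (n ^ c) * expi i (n ^ c)" using 3 by (rule mult_le_mono1)
        also have "\<dots> \<le> expi i (n ^ (c + c))" unfolding power_add using 2 by (rule expi_square)
        finally show ?thesis .
      qed
      then show ?thesis unfolding expclass_def by blast
    qed
    then show ?thesis using that by simp
  qed
  show ?thesis by (rule expclass_le[OF expclass_mult[OF suc[OF assms(1)] suc[OF assms(2)]]]) simp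
qed

lemma expclass_Suc [intro, simp]: "f \<in> expclass i \<Longrightarrow> (\<lambda>n. Suc (f n)) \<in> expclass i"
  using expclass_add[OF expclass_const[of 1 i]] by simp

lemma expclass_expi:
  assumes "f \<in> expclass i"
  shows "(\<lambda>n. expi j (f n)) \<in> expclass (i + j)"
proof -
  obtain c where "\<And>n. 2 \<le> n \<Longrightarrow> f n \<le> expi i (n ^ c)" using assms unfolding expclass_def by blast
  then have "expi j (f n) \<le> expi (i + j) (n ^ c)" if "2 \<le> n" for n
    using expi_mono[of "f n" _ j] that by (metis add.commute expi_add)
  then show ?thesis unfolding expclass_def by blast
qed

lemma expclass_power:
  assumes "f \<in> expclass i"
  shows "(\<lambda>n. f n ^ c) \<in> expclass i"
  using assms by (induction c) auto

text \<open>Because \<open>c \<le> 2 ^ c\<close>, a fixed base costs only a constant factor in the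
  exponent.\<close>

lemma expclass_base:
  assumes "f \<in> expclass i"
  shows "(\<lambda>n. c ^ f n) \<in> expclass (Suc i)"
proof -
  have "(\<lambda>n. expi 1 (c * f n)) \<in> expclass (i + 1)" using assms by (intro expclass_expi) auto
  moreover have "c ^ f n \<le> expi 1 (c * f n)" for n
    using power_mono[of c "2 ^ c" "f n"] less_exp[of c] by (simp add: power_mult)
  ultimately show ?thesis using expclass_le by (metis (no_types, lifting) Suc_eq_plus1)
qed

text \<open>The power in \<open>expbound\<close> is absorbed at level \<open>i\<close>, before the
  \<open>j\<close> exponentials are applied. With \<open>f\<close> bounding the length of queries,
  this is why the levels of base machine and oracle add up.\<close>

lemma expclass_expbound: "f \<in> expclass i \<Longrightarrow> (\<lambda>n. expbound j k (f n)) \<in> expclass (i + j)"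
  unfolding expbound_def by (intro expclass_add expclass_mult expclass_const expclass_expi expclass_power)

lemma expbound_of_expclass:
  assumes "f \<in> expclass i"
  obtains k where "\<And>n. f n \<le> expbound i k n"
proof -
  obtain c where c: "\<And>n. 2 \<le> n \<Longrightarrow> f n \<le> expi i (n ^ c)" using assms unfolding expclass_def by blast
  \<comment> \<open>For lengths 0 and 1, about which the class says nothing, the summands
    \<open>f 0\<close> and \<open>f 1\<close> enter through the additive slack of
    \<open>expbound\<close>.\<close>
  let ?k = "c + f 0 + f 1 + 1"
  have "f n \<le> expbound i ?k n" for n
  proof (cases "2 \<le> n")
    case True
    have "expi i (n ^ c) \<le> expi i (n ^ ?k)" using True by (intro expi_mono power_increasing) auto
    with c[OF True] have "f n \<le> expi i (n ^ ?k)" by simp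
    also have "\<dots> \<le> ?k * expi i (n ^ ?k)" by simp
    finally show ?thesis unfolding expbound_def by simp
  next
    case False
    then have "n = 0 \<or> n = 1" by auto
    then show ?thesis unfolding expbound_def by auto
  qed
  then show ?thesis by (rule that)
qed

lemma mono_expbound: "mono (expbound i k)"
  unfolding expbound_def by (intro monoI add_mono mult_le_mono2 expi_mono power_mono) auto

section \<open>The clock\<close>

text \<open>The one-query restriction concerns every run and is read off from the program text,
  provided that no \<open>Ask\<close> lies inside a loop.\<close>

primrec nasks :: "cmd \<Rightarrow> nat" where
  "nasks (Act f) = 0"
| "nasks Ask = 1"
| "nasks (c ;; c') = nasks c + nasks c'"
| "nasks (Cond P c c') = max (nasks c) (nasks c')"
| "nasks (Loop P c) = nasks c"

primrec no_loop_asks :: "cmd \<Rightarrow> bool" where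
  "no_loop_asks (Act f) = True"
| "no_loop_asks Ask = True"
| "no_loop_asks (c ;; c') = (no_loop_asks c \<and> no_loop_asks c')"
| "no_loop_asks (Cond P c c') = (no_loop_asks c \<and> no_loop_asks c')"
| "no_loop_asks (Loop P c) = (no_loop_asks c \<and> nasks c = 0)"

lemma big_asks: "big k a A c \<sigma> t q \<sigma>' \<Longrightarrow> no_loop_asks c \<Longrightarrow> q \<le> nasks c"
  by (induction rule: big.induct) (auto split: if_splits)

text \<open>A head advances at most one cell per step. This is the source of lower bounds on running
  times, while \<open>runs\<close> yields upper bounds.\<close>

lemma big_head: "big k a A c \<sigma> t q \<sigma>' \<Longrightarrow> snd (\<sigma>' v) \<le> snd (\<sigma> v) + t"
proof (induction rule: big.induct)
  case (big_Act f \<sigma>)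
  then show ?case unfolding upd_def act_def okact_def by (force split: option.split)
qed (auto simp: blank_def act_def)

section \<open>Unary arithmetic for the clock\<close>

context env
begin

text \<open>Unary registers; the head rests on the first free cell.\<close>

definition reg :: "nat \<Rightarrow> tape" where
  "reg r = (chs (replicate r 1), Suc r)"

lemma tok_reg: "tok (chs (replicate r 1)) (Suc r)"
proof -
  have "set (replicate r 1) \<subseteq> {1..K}" using K3 by (auto simp: set_replicate_conv_if)
  from tok_chs[OF this] show ?thesis by simp
qed

lemma reg_Suc: "act (1, 1) (reg r) = reg (Suc r)"
  using chs_snoc[of "replicate r 1" 1] by (simp add: reg_def act_pair nat_add_distrib replicate_append_same)

lemma reg_0: "reg 0 = (fresh, 1)"
  by (simp add: reg_def chs_Nil)

definition inc :: "nat \<Rightarrow> cmd" where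
  "inc v = Act (\<lambda>r. [v \<mapsto> (1, 1)])"

lemma runs_inc: "v < k \<Longrightarrow> \<sigma> v = reg r \<Longrightarrow> runs (inc v) \<sigma> 1 (\<sigma>(v := reg (Suc r)))"
  unfolding inc_def using K3 by (intro runs_Act) (auto intro!: okact_update simp: reg_Suc[simplified])

definition zero :: "nat \<Rightarrow> cmd" where
  "zero v = clr v ;; Act (\<lambda>r. [v \<mapsto> (K + 1, 1)])"

lemma runs_zero:
  assumes "v < k" "\<sigma> v = reg r"
  shows "runs (zero v) \<sigma> (4 * r + 11) (\<sigma>(v := reg 0))"
proof -
  have 1: "runs (clr v) \<sigma> (4 * Suc r + 5) (\<sigma>(v := (fresh, 0)))"
    by (rule runs_clr) (use assms tok_reg in \<open>auto simp: reg_def\<close>)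
  have "fresh(0 := K + 1) = fresh" by (auto simp: fresh_def)
  then have 2: "runs (Act (\<lambda>r. [v \<mapsto> (K + 1, 1)])) (\<sigma>(v := (fresh, 0))) 1 (\<sigma>(v := reg 0))"
    using assms(1) by (intro runs_Act) (auto intro!: okact_update simp: act_pair reg_0)
  show ?thesis unfolding zero_def using runs_mono[OF runs_Then[OF 1 2]] by simp
qed

definition foreach :: "nat \<Rightarrow> cmd \<Rightarrow> cmd" where
  "foreach v c = rew v ;; Act (\<lambda>r. [v \<mapsto> (r v, 1)]) ;; Loop (\<lambda>r. r v \<noteq> 0) (c ;; Act (\<lambda>r. [v \<mapsto> (r v, 1)]))"

text \<open>The head of \<open>v\<close> is the loop counter and its content stays fixed, so the
  body has to work for every head position \<open>h\<close> on \<open>v\<close>.\<close>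

lemma runs_foreach:
  assumes v: "v < k" "\<sigma> v = reg n" and s: "s 0 = \<sigma>"
    and body: "\<And>i h. i < n \<Longrightarrow> runs c ((s i)(v := (chs (replicate n 1), h))) T ((s (Suc i))(v := (chs (replicate n 1), h)))"
  shows "runs (foreach v c) \<sigma> (n * (T + 5) + 8) ((s n)(v := reg n))"
proof -
  let ?right = "Act (\<lambda>r. [v \<mapsto> (r v, 1)])"
  let ?g = "chs (replicate n 1)"
  have 1: "runs (rew v) \<sigma> (2 * Suc n + 1) (\<sigma>(v := (?g, 0)))"
    by (rule runs_rew) (use v tok_reg in \<open>auto simp: reg_def\<close>)
  have "?g(0 := Suc K) = ?g" by (auto simp: chs_def)
  then have 2: "runs ?right (\<sigma>(v := (?g, 0))) 1 (\<sigma>(v := (?g, 1)))"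
    using v by (intro runs_Act) (auto intro!: okact_update simp: act_pair)
  have nth: "?g (Suc i) = 1" if "i < n" for i using that by (simp add: chs_nth)
  have 3: "runs (Loop (\<lambda>r. r v \<noteq> 0) (c ;; ?right)) ((s 0)(v := (?g, Suc 0))) (n * ((T + 1 + 1) + 1) + 1) ((s n)(v := (?g, Suc n)))"
  proof (rule runs_Loop_count)
    fix i assume i: "i < n"
    show "rd k ((s i)(v := (?g, Suc i))) v \<noteq> 0" using v nth[OF i] by simp
    have g: "?g(Suc i := Suc 0) = ?g" using nth[OF i] by auto
    have "runs ?right ((s (Suc i))(v := (?g, Suc i))) 1 ((s (Suc i))(v := (?g, Suc (Suc i))))"
      using v nth[OF i] g K3 by (intro runs_Act) (auto intro!: okact_update simp: act_pair nat_add_distrib)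
    from runs_Then[OF body[OF i] this]
    show "runs (c ;; ?right) ((s i)(v := (?g, Suc i))) (T + 1 + 1) ((s (Suc i))(v := (?g, Suc (Suc i))))" .
  next
    show "\<not> rd k ((s n)(v := (?g, Suc n))) v \<noteq> 0" using v chs_end[of "replicate n 1"] by simp
  qed
  have e: "\<sigma>(v := (?g, 1)) = (s 0)(v := (?g, Suc 0))" using s by simp
  show ?thesis
    unfolding foreach_def reg_def
    by (rule runs_mono[OF runs_Then[OF 1 runs_Then[OF 2[unfolded e] 3]]]) (simp add: algebra_simps)
qed

lemma runs_foreach_inc:
  assumes "u < k" "v < k" "u \<noteq> v" "\<sigma> u = reg n" "\<sigma> v = reg m"
  shows "runs (foreach u (inc v)) \<sigma> (n * 6 + 8) (\<sigma>(v := reg (m + n)))"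
proof -
  let ?g = "chs (replicate n 1)"
  have "runs (foreach u (inc v)) \<sigma> (n * (1 + 5) + 8) ((\<sigma>(v := reg (m + n)))(u := reg n))"
  proof (rule runs_foreach[where s = "\<lambda>i. \<sigma>(v := reg (m + i))"])
    fix i h assume "i < n"
    have "runs (inc v) (\<sigma>(v := reg (m + i), u := (?g, h))) 1
      ((\<sigma>(v := reg (m + i), u := (?g, h)))(v := reg (Suc (m + i))))"
      by (rule runs_inc) (use assms in auto)
    then show "runs (inc v) (\<sigma>(v := reg (m + i), u := (?g, h))) 1
      (\<sigma>(v := reg (m + Suc i), u := (?g, h)))"
      using assms(3) by (simp add: fun_upd_twist)
  qed (use assms in auto)
  then show ?thesis using assms by (simp add: fun_upd_idem fun_upd_twist)
qed

lemma runs_mult: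
  assumes "u < k" "v < k" "x < k" "u \<noteq> v" "u \<noteq> x" "x \<noteq> v" "\<sigma> u = reg n" "\<sigma> v = reg 0" "\<sigma> x = reg m"
  shows "runs (foreach u (foreach x (inc v))) \<sigma> (n * (m * 6 + 13) + 8) (\<sigma>(v := reg (n * m)))"
proof -
  let ?g = "chs (replicate n 1)"
  have "runs (foreach u (foreach x (inc v))) \<sigma> (n * ((m * 6 + 8) + 5) + 8) ((\<sigma>(v := reg (n * m)))(u := reg n))"
  proof (rule runs_foreach[where s = "\<lambda>i. \<sigma>(v := reg (i * m))"])
    fix i h assume "i < n"
    have "runs (foreach x (inc v)) (\<sigma>(v := reg (i * m), u := (?g, h))) (m * 6 + 8)
      ((\<sigma>(v := reg (i * m), u := (?g, h)))(v := reg (i * m + m)))"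
      by (rule runs_foreach_inc) (use assms in auto)
    then show "runs (foreach x (inc v)) (\<sigma>(v := reg (i * m), u := (?g, h))) (m * 6 + 8)
      (\<sigma>(v := reg (Suc i * m), u := (?g, h)))"
      using assms(4) by (simp add: fun_upd_twist add.commute)
  qed (use assms in auto)
  moreover have "(\<sigma>(v := reg (n * m)))(u := reg n) = \<sigma>(v := reg (n * m))" using assms by (auto simp: fun_eq_iff)
  ultimately show ?thesis by (auto elim!: runs_mono simp: algebra_simps)
qed

definition double :: "nat \<Rightarrow> nat \<Rightarrow> cmd" where
  "double v w = foreach v (inc w) ;; foreach w (inc v) ;; zero w"

lemma runs_double:
  assumes "w < k" "v < k" "w \<noteq> v" "\<sigma> v = reg n" "\<sigma> w = reg 0"
  shows "runs (double v w) \<sigma> (16 * n + 29) (\<sigma>(v := reg (2 * n)))"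
proof -
  have 1: "runs (foreach v (inc w)) \<sigma> (n * 6 + 8) (\<sigma>(w := reg (0 + n)))"
    by (rule runs_foreach_inc) (use assms in auto)
  have 2: "runs (foreach w (inc v)) (\<sigma>(w := reg (0 + n))) (n * 6 + 8) (\<sigma>(w := reg (0 + n), v := reg (n + n)))"
    by (rule runs_foreach_inc) (use assms in auto)
  have 3: "runs (zero w) (\<sigma>(w := reg (0 + n), v := reg (n + n))) (4 * n + 11) (\<sigma>(w := reg (0 + n), v := reg (n + n), w := reg 0))"
    by (rule runs_zero) (use assms in auto)
  have "\<sigma>(w := reg (0 + n), v := reg (n + n), w := reg 0) = \<sigma>(v := reg (2 * n))"
    using assms by (auto simp: fun_eq_iff mult_2)
  with runs_Then[OF 1 runs_Then[OF 2 3]] have "runs (double v w) \<sigma> (n * 6 + 8 + (n * 6 + 8 + (4 * n + 11) + 1) + 1) (\<sigma>(v := reg (2 * n)))"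
    unfolding double_def by simp
  then show ?thesis by (rule runs_mono) simp
qed

lemma runs_exp:
  assumes "u < k" "w < k" "v < k" "u \<noteq> v" "u \<noteq> w" "w \<noteq> v" "\<sigma> u = reg n" "\<sigma> v = reg 0" "\<sigma> w = reg 0"
  shows "runs (inc v ;; foreach u (double v w)) \<sigma> (n * (16 * 2 ^ n + 34) + 10) (\<sigma>(v := reg (2 ^ n)))"
proof -
  let ?g = "chs (replicate n 1)"
  have 1: "runs (inc v) \<sigma> 1 (\<sigma>(v := reg (Suc 0)))" by (rule runs_inc) (use assms in auto)
  have 2: "runs (foreach u (double v w)) (\<sigma>(v := reg (Suc 0))) (n * ((16 * 2 ^ n + 29) + 5) + 8) ((\<sigma>(v := reg (2 ^ n)))(u := reg n))"
  proof (rule runs_foreach[where s = "\<lambda>i. \<sigma>(v := reg (2 ^ i))"])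
    fix i h assume i: "i < n"
    have "runs (double v w) (\<sigma>(v := reg (2 ^ i), u := (?g, h))) (16 * 2 ^ i + 29)
      ((\<sigma>(v := reg (2 ^ i), u := (?g, h)))(v := reg (2 * 2 ^ i)))"
      by (rule runs_double) (use assms in auto)
    \<comment> \<open>Each doubling is charged at the price of the final value, so that all rounds
      share one bound.\<close>
    moreover have "(2::nat) ^ i \<le> 2 ^ n" using i by simp
    then have "16 * 2 ^ i + 29 \<le> 16 * (2::nat) ^ n + 29" by simp
    ultimately show "runs (double v w) (\<sigma>(v := reg (2 ^ i), u := (?g, h))) (16 * 2 ^ n + 29)
      (\<sigma>(v := reg (2 ^ Suc i), u := (?g, h)))"
      using assms(4) runs_mono by (simp add: fun_upd_twist)
  qed (use assms in auto)
  have "(\<sigma>(v := reg (2 ^ n)))(u := reg n) = \<sigma>(v := reg (2 ^ n))" using assms by (auto simp: fun_eq_iff)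
  from runs_Then[OF 1 2[unfolded this]] show ?thesis by (rule runs_mono) (simp add: algebra_simps)
qed

end

definition val :: "nat \<Rightarrow> nat \<Rightarrow> nat \<Rightarrow> nat" where
  "val m n i = (if i \<le> m then n ^ i else expi (i - m) (n ^ m))"

lemma val_Suc: "val m n (Suc i) = (if i < m then val m n i * n else 2 ^ val m n i)"
  by (auto simp: val_def Suc_diff_le not_less mult.commute)

primrec ccost :: "nat \<Rightarrow> nat \<Rightarrow> nat \<Rightarrow> nat" where
  "ccost m n 0 = 1"
| "ccost m n (Suc i) = ccost m n i + (if i < m then val m n i * (n * 6 + 13) + 8
     else val m n i * (16 * val m n (Suc i) + 34) + 10) + 1"

lemma expclass_val: "i \<le> m + j \<Longrightarrow> (\<lambda>n. val m n i) \<in> expclass j"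
proof (cases "i \<le> m")
  case True
  then show ?thesis by (simp add: val_def expclass_power_id)
next
  case False
  assume "i \<le> m + j"
  then have "(\<lambda>n. expi (i - m) (n ^ m)) \<in> expclass j"
    using expclass_expi[OF expclass_power_id[of m 0], of "i - m"] expclass_level[of _ "i - m" j] by simp
  then show ?thesis using False by (simp add: val_def)
qed

text \<open>Each stage costs a polynomial in the register values, and the class is closed under such
  polynomials; so the time of the clock stays at the level of the value it produces.\<close>

lemma expclass_ccost: "i \<le> m + j \<Longrightarrow> (\<lambda>n. ccost m n i) \<in> expclass j"
proof (induction i)
  case (Suc i)
  then show ?case
    using expclass_val[of i m j] expclass_val[of "Suc i" m j]
    by (cases "i < m") (auto intro!: expclass_add expclass_mult)
qed simp

context env
begin

text \<open>The tapes 5, 6, ... receive the values n^0, ..., n^m, exp_1(n^m), exp_2(n^m), ..., where n is in register 3.\<close>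

primrec chain :: "nat \<Rightarrow> nat \<Rightarrow> cmd" where
  "chain m 0 = skip"
| "chain m (Suc i) = chain m i ;; (if i < m then foreach (5 + i) (foreach 3 (inc (6 + i)))
     else inc (6 + i) ;; foreach (5 + i) (double (6 + i) 4))"

lemma runs_chain:
  assumes "\<sigma> 3 = reg n" "\<sigma> 4 = reg 0" "\<sigma> 5 = reg 1" "\<And>t. 5 < t \<Longrightarrow> t < k \<Longrightarrow> \<sigma> t = reg 0"
  shows "5 + i < k \<Longrightarrow> runs (chain m i) \<sigma> (ccost m n i) (\<lambda>t. if 5 \<le> t \<and> t \<le> 5 + i then reg (val m n (t - 5)) else \<sigma> t)"
proof (induction i)
  case 0
  have "(\<lambda>t. if 5 \<le> t \<and> t \<le> 5 + 0 then reg (val m n (t - 5)) else \<sigma> t) = \<sigma>"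
    using assms(3) by (auto simp: fun_eq_iff val_def)
  then show ?case using runs_skip by simp
next
  case (Suc i)
  let ?s = "\<lambda>i t. if 5 \<le> t \<and> t \<le> 5 + i then reg (val m n (t - 5)) else \<sigma> t"
  let ?c = "if i < m then foreach (5 + i) (foreach 3 (inc (6 + i))) else inc (6 + i) ;; foreach (5 + i) (double (6 + i) 4)"
  have 1: "runs (chain m i) \<sigma> (ccost m n i) (?s i)" using Suc by simp
  have s: "?s i (5 + i) = reg (val m n i)" "?s i (6 + i) = reg 0" "?s i 3 = reg n" "?s i 4 = reg 0"
    using assms Suc.prems by auto
  have "runs ?c (?s i) (if i < m then val m n i * (n * 6 + 13) + 8 else val m n i * (16 * val m n (Suc i) + 34) + 10)
    ((?s i)(6 + i := reg (val m n (Suc i))))"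
  proof (cases "i < m")
    case True
    have "runs (foreach (5 + i) (foreach 3 (inc (6 + i)))) (?s i) (val m n i * (n * 6 + 13) + 8) ((?s i)(6 + i := reg (val m n i * n)))"
      by (rule runs_mult) (use s Suc.prems in auto)
    then show ?thesis using True by (simp add: val_Suc)
  next
    case False
    have "runs (inc (6 + i) ;; foreach (5 + i) (double (6 + i) 4)) (?s i) (val m n i * (16 * 2 ^ val m n i + 34) + 10)
      ((?s i)(6 + i := reg (2 ^ val m n i)))"
      by (rule runs_exp) (use s Suc.prems in auto)
    then show ?thesis using False by (simp add: val_Suc)
  qed
  moreover have "(?s i)(6 + i := reg (val m n (Suc i))) = ?s (Suc i)" by (auto simp: fun_eq_iff le_Suc_eq)
  ultimately show ?case using runs_Then[OF 1] by simp
qed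

definition clock :: "nat \<Rightarrow> nat \<Rightarrow> cmd" where
  "clock m j = Act (\<lambda>r t. if 3 \<le> t \<and> t < k then Some (K + 1, 1) else None) ;; inc 5 ;;
     Loop (\<lambda>r. r 0 \<noteq> 0) (Act (\<lambda>r. [3 \<mapsto> (1, 1), 0 \<mapsto> (r 0, 1)])) ;; chain m (m + j)"

lemma runs_clock:
  assumes k: "k = 6 + m + j"
  shows "\<exists>\<sigma>'. runs (clock m j) (init_store x) (ccost m (length x) (m + j) + 2 * length x + 6) \<sigma>' \<and>
    \<sigma>' (5 + m + j) = reg (expi j (length x ^ m))"
proof -
  let ?read = "Loop (\<lambda>r. r 0 \<noteq> 0) (Act (\<lambda>r. [3 \<mapsto> (1, 1), 0 \<mapsto> (r 0, 1)]))"
  let ?n = "length x"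
  have k': "0 < k" "3 < k" "5 < k" using k by auto
  let ?\<sigma>1 = "\<lambda>t. if 3 \<le> t \<and> t < k then reg 0 else init_store x t"
  have 1: "runs (Act (\<lambda>r t. if 3 \<le> t \<and> t < k then Some (K + 1, 1) else None)) (init_store x) 1 ?\<sigma>1"
  proof (rule runs_Act)
    have "(\<lambda>_. 0)(0 := K + 1) = fresh" by (auto simp: fresh_def)
    then show "upd (init_store x) (\<lambda>t. if 3 \<le> t \<and> t < k then Some (K + 1, 1) else None) = ?\<sigma>1"
      by (auto simp: upd_def fun_eq_iff blank_def act_pair init_store_def reg_0)
  qed (auto simp: okact_def split: if_splits)
  let ?\<sigma>2 = "?\<sigma>1(5 := reg 1)"
  have 2: "runs (inc 5) ?\<sigma>1 1 ?\<sigma>2"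
    using runs_inc[of 5 ?\<sigma>1 0] k' by simp
  let ?s = "\<lambda>i. ?\<sigma>2(3 := reg i, 0 := (inp x, i))"
  have "runs ?read (?s 0) (?n * (1 + 1) + 1) (?s ?n)"
  proof (rule runs_Loop_count)
    fix i assume i: "i < ?n"
    have ik: "inp x i < Suc (Suc (2 * K))" using inp_less[of x i] by simp
    show "rd k (?s i) 0 \<noteq> 0" using i k' by (auto simp: inp_def)
    show "runs (Act (\<lambda>r. [3 \<mapsto> (1, 1), 0 \<mapsto> (r 0, 1)])) (?s i) 1 (?s (Suc i))"
    proof (rule runs_Act)
      show "upd (?s i) [3 \<mapsto> (1, 1), 0 \<mapsto> (rd k (?s i) 0, 1)] = ?s (Suc i)"
        using k' reg_Suc[of i] by (auto simp: fun_eq_iff act_pair nat_add_distrib)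
    qed (use ik k' K3 in \<open>auto intro!: okact_update\<close>)
  next
    show "\<not> rd k (?s ?n) 0 \<noteq> 0" using k' by (simp add: inp_def)
  qed
  moreover have "?s 0 = ?\<sigma>2" using k' by (auto simp: fun_eq_iff init_store_def)
  ultimately have 3: "runs ?read ?\<sigma>2 (?n * (1 + 1) + 1) (?s ?n)" by simp
  have 4: "runs (chain m (m + j)) (?s ?n) (ccost m ?n (m + j))
    (\<lambda>t. if 5 \<le> t \<and> t \<le> 5 + (m + j) then reg (val m ?n (t - 5)) else ?s ?n t)"
    by (rule runs_chain) (use k in auto)
  have "val m ?n (m + j) = expi j (?n ^ m)" by (simp add: val_def)
  then show ?thesis unfolding clock_def
    using runs_mono[OF runs_Then[OF 1 runs_Then[OF 2 runs_Then[OF 3 4]]], of "ccost m ?n (m + j) + 2 * ?n + 6"]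
    by (intro exI[of _ "\<lambda>t. if 5 \<le> t \<and> t \<le> 5 + (m + j) then reg (val m ?n (t - 5)) else ?s ?n t"] conjI) (simp_all add: add.assoc)
qed

lemma nasks_chain: "nasks (chain m i) = 0 \<and> no_loop_asks (chain m i)"
  by (induction i) (auto simp: skip_def foreach_def inc_def double_def zero_def rew_def clr_def ffwd_def)

lemma nasks_clock: "nasks (clock m j) = 0" "no_loop_asks (clock m j)"
  using nasks_chain by (auto simp: clock_def inc_def)

end

text \<open>\<open>tP\<close> is the exact running time, not a bound: the machine that writes the
  padding and the one that checks it must count the same steps. The query count 0 allows simulating
  \<open>P\<close> without a query handler.\<close>

definition clocks :: "otm \<Rightarrow> (bool list \<Rightarrow> nat) \<Rightarrow> bool" where
  "clocks P tP \<longleftrightarrow> wf_otm P \<and> deterministic P \<and> (\<forall>x. \<exists>c. reach P {} x (tP x) 0 c \<and> \<not> live P c)"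

text \<open>The lower bound on the time comes from the result: the head of the last register ends
  beyond \<open>expi j (length x ^ m)\<close> cells and needs a step for each of them.\<close>

lemma clock_exists:
  obtains P tP f where "clocks P tP" "f \<in> expclass j" "\<And>x. expi j (length x ^ m) \<le> tP x" "\<And>x. tP x \<le> f (length x)"
proof -
  interpret env "6 + m + j" 3 "{}" by unfold_locales auto
  obtain P where P: "wf_otm P" "deterministic P"
    "\<And>A x t q \<sigma>'. big (6 + m + j) (2 * 3 + 2) A (clock m j) (init_store x) t q \<sigma>' \<Longrightarrow>
        \<exists>cc. reach P A x (Suc t) q cc \<and> st cc = (if cur (\<sigma>' 2) = 1 then acc P else rej P)"
    using compile_correct[of "6 + m + j" "2 * 3 + 2" "clock m j"] by auto
  let ?f = "\<lambda>n. ccost m n (m + j) + 2 * n + 7"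
  have "\<exists>t c. reach P {} x t 0 c \<and> \<not> live P c \<and> expi j (length x ^ m) \<le> t \<and> t \<le> ?f (length x)" for x
  proof -
    from runs_clock[of m j x] obtain \<sigma>' where 1: "runs (clock m j) (init_store x) (ccost m (length x) (m + j) + 2 * length x + 6) \<sigma>'"
      "\<sigma>' (5 + m + j) = reg (expi j (length x ^ m))" by auto
    then obtain t q where t: "t \<le> ccost m (length x) (m + j) + 2 * length x + 6" "big (6 + m + j) (2 * 3 + 2) {} (clock m j) (init_store x) t q \<sigma>'"
      unfolding runs_def by blast
    have q: "q = 0" using big_asks[OF t(2)] nasks_clock by simp
    have "expi j (length x ^ m) \<le> t" using big_head[OF t(2), of "5 + m + j"] 1(2) by (simp add: init_store_def blank_def reg_def)
    moreover obtain cc where "reach P {} x (Suc t) 0 cc" "\<not> live P cc" using P(3)[OF t(2)] q unfolding live_def by auto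
    ultimately show ?thesis using t(1) by (intro exI[of _ "Suc t"] exI[of _ cc]) simp
  qed
  then obtain tP where tP: "\<And>x. \<exists>c. reach P {} x (tP x) 0 c \<and> \<not> live P c \<and> expi j (length x ^ m) \<le> tP x \<and> tP x \<le> ?f (length x)" by metis
  show ?thesis
  proof (rule that[of P tP ?f])
    show "clocks P tP" using P tP unfolding clocks_def by metis
    show "?f \<in> expclass j" using expclass_ccost[of "m + j" m j] by (intro expclass_add expclass_mult expclass_const expclass_id) auto
  qed (use tP in blast)+
qed

lemma clocks_ctr:
  assumes P: "clocks P tP"
  shows "i < tP x \<Longrightarrow> live P (itr P (det_pick P) {} ds x i) \<and> st (itr P (det_pick P) {} ds x i) \<noteq> qry P"
    and "\<not> live P (itr P (det_pick P) {} ds x (tP x))"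
proof -
  let ?C = "itr P (det_pick P) {} ds x"
  obtain c where c: "reach P {} x (tP x) 0 c" "\<not> live P c" and d: "deterministic P" "wf_otm P"
    using P unfolding clocks_def by blast
  have 1: "?C (tP x) = c" "\<And>i. i < tP x \<Longrightarrow> live P (?C i)" using reach_det_ctr[OF d c(1)] by auto
  then show "\<not> live P (?C (tP x))" using c by simp
  assume i: "i < tP x"
  \<comment> \<open>A query before the end would push the query count above that of the halting
    configuration, which is 0.\<close>
  have "st (?C i) \<noteq> qry P"
  proof
    assume q: "st (?C i) = qry P"
    have "\<exists>q. reach P {} x i q (?C i)"
      using ctr_reach[where M = P and n = i and B = "{}" and ds = ds and x = x, OF sound_det_pick] 1(2) i unfolding live_def by fastforce
    then obtain q' where "reach P {} x i q' (?C i)" by blast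
    from reach_query[OF this q] have "reach P {} x (Suc i) (Suc q') (answer_step P {} (?C i))" .
    from reach_halted_last[OF d c(1) _ this] c(2) show False unfolding live_def by auto
  qed
  with 1 i show "live P (?C i) \<and> st (?C i) \<noteq> qry P" by blast
qed

context env
begin

text \<open>A clock never queries, so \<open>skip\<close> can stand in for the handler. The guard
  \<open>F\<close> may end the run before \<open>P\<close> halts, and the state on tape
  \<open>sv\<close> tells which of the two happened.\<close>

lemma runs_run_clock:
  fixes f s0
  defines "s \<equiv> \<lambda>i. (adv f ^^ i) s0"
  assumes P: "clocks P tP" and fits: "fits P b sv" and v: "v < k" "v \<notin> grp P b sv"
    and f: "\<And>i. i < n \<Longrightarrow> f (cur (s i)) < 2 * K + 2" and go: "\<And>i. i < n \<Longrightarrow> F (cur (s i))"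
    and n: "n \<le> tP x" "n = tP x \<or> \<not> F (cur (s n))"
    and init: "rep P b sv (init_conf P x) E \<sigma>" "\<sigma> v = s0"
  shows "\<exists>\<sigma>'. runs (run P (det_pick P) b sv F f v skip) \<sigma> (n * 5 + 1) \<sigma>' \<and>
    (cur (\<sigma>' sv) = acc P \<or> cur (\<sigma>' sv) = rej P \<longleftrightarrow> n = tP x) \<and> \<sigma>' v = s n \<and> (\<forall>t. t \<notin> grp P b sv \<longrightarrow> t \<noteq> v \<longrightarrow> \<sigma>' t = \<sigma> t)"
proof -
  let ?run = "run P (det_pick P) b sv F f v skip"
  let ?ds = "\<lambda>i. cur (s i)"
  let ?C = "itr P (det_pick P) {} ?ds x"
  note C = clocks_ctr[where ds = ?ds, OF P]
  have "\<exists>\<sigma>'. runs ?run \<sigma> (n * (1 + 4) + 1) \<sigma>' \<and> rep P b sv (?C n) (E + n) \<sigma>' \<and> \<sigma>' v = s n \<and>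
     (\<forall>t. t \<notin> grp P b sv \<longrightarrow> t \<noteq> v \<longrightarrow> \<sigma>' t = \<sigma> t)"
    unfolding s_def
  proof (rule runs_run[where J = "\<lambda>\<sigma>'. \<forall>t. t \<notin> grp P b sv \<longrightarrow> t \<noteq> v \<longrightarrow> \<sigma>' t = \<sigma> t" and n = n and F = F, OF fits v sound_det_pick])
    show "\<not> (F (cur ((adv f ^^ n) s0)) \<and> live P (ctr P (det_pick P) {} (\<lambda>i. cur ((adv f ^^ i) s0)) (init_conf P x) n))"
      using n(2) C(2)[of x] unfolding s_def by auto
  qed (use C(1)[of _ x] f go n(1) init in \<open>auto simp: s_def\<close>)
  then obtain \<sigma>' where 1: "runs ?run \<sigma> (n * (1 + 4) + 1) \<sigma>'" "rep P b sv (?C n) (E + n) \<sigma>'" "\<sigma>' v = s n"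
     "\<forall>t. t \<notin> grp P b sv \<longrightarrow> t \<noteq> v \<longrightarrow> \<sigma>' t = \<sigma> t" by blast
  have "cur (\<sigma>' sv) = st (?C n)" using 1(2) unfolding rep_def by simp
  moreover have "\<not> live P (?C n) \<longleftrightarrow> n = tP x"
  proof
    assume "\<not> live P (?C n)"
    then have "\<not> n < tP x" using C(1)[of n x] by blast
    then show "n = tP x" using n(1) by simp
  qed (use C(2)[of x] in auto)
  ultimately show ?thesis using 1 unfolding live_def by (intro exI[of _ \<sigma>']) (auto simp: mult.commute)
qed

end

section \<open>Padding\<close>

lemma inp_snoc: "(inp w)(length w := (if b then 2 else 1)) = inp (w @ [b])"
  by (rule ext) (auto simp: inp_def nth_append)

lemma word_of_inp: "word_of (inp w, h) = w"
proof -
  have "(LEAST p. inp w p \<notin> {1, 2}) = length w" by (rule inp_Least) (auto simp: inp_def)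
  then show ?thesis unfolding word_of_def by (intro nth_equalityI) (auto simp: inp_def Let_def)
qed

text \<open>Every bit is preceded by the marker True, so the False that \<open>pad\<close> puts in
  the next marker position ends the encoding unambiguously, whatever follows.\<close>

definition encw :: "bool list \<Rightarrow> bool list" where
  "encw x = concat (map (\<lambda>b. [True, b]) x)"

lemma encw_simps [simp]: "encw [] = []" "encw (b # x) = True # b # encw x"
  "encw (x @ y) = encw x @ encw y" "length (encw x) = 2 * length x"
  by (auto simp: encw_def sum_list_triv o_def length_concat)

definition pad :: "bool list \<Rightarrow> nat \<Rightarrow> bool list" where
  "pad x t = encw x @ [False] @ replicate t False"

text \<open>The inverse of pad is total: on words that are not of the form pad x t it still yields some word,
  on which the clock then has to halt within the rest of the input.\<close>

definition plen :: "bool list \<Rightarrow> nat" where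
  "plen y = (LEAST i. inp y (2 * i) \<noteq> 2)"

definition unpad :: "bool list \<Rightarrow> bool list" where
  "unpad y = map (\<lambda>p. inp y (2 * p + 1) = 2) [0..<min (plen y) (length y div 2)]"

lemma inp_Cons_Suc [simp]: "inp (b # x) (Suc p) = inp x p"
  by (simp add: inp_def)

lemma inp_encw: "p < length x \<Longrightarrow> inp (encw x @ zs) (2 * p) = 2 \<and> inp (encw x @ zs) (2 * p + 1) = (if x ! p then 2 else 1)"
proof (induction x arbitrary: p)
  case (Cons b x)
  then show ?case by (cases p) (auto simp: inp_def[of "True # _" 0] inp_def[of "_ # _" 0])
qed simp

lemma plen: "inp y (2 * plen y) \<noteq> 2" "i < plen y \<Longrightarrow> inp y (2 * i) = 2" "plen y \<le> length y"
proof -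
  have l: "inp y (2 * length y) \<noteq> 2" by (simp add: inp_def)
  show "inp y (2 * plen y) \<noteq> 2" unfolding plen_def by (rule LeastI, rule l)
  show "inp y (2 * i) = 2" if "i < plen y" using not_less_Least[of i "\<lambda>i. inp y (2 * i) \<noteq> 2"] that unfolding plen_def by blast
  show "plen y \<le> length y" unfolding plen_def by (rule Least_le, rule l)
qed

text \<open>\<open>plen y\<close> exceeds \<open>length y div 2\<close> only if \<open>y\<close>
  ends in a marker without its bit. In that position \<open>inp y\<close> is blank, so the formula
  holds with \<open>plen y\<close> alone.\<close>

lemma inp_unpad: "inp (unpad y) p = (if p < plen y then inp y (2 * p + 1) else 0)"
proof -
  have "inp (unpad y) p = (if p < min (plen y) (length y div 2) then inp y (2 * p + 1) else 0)"
    unfolding unpad_def by (rule inp_map) (auto simp: inp_def)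
  then show ?thesis by (auto simp: inp_def)
qed

lemma plen_pad: "plen (pad x t) = length x"
  unfolding plen_def
proof (rule Least_equality)
  show "inp (pad x t) (2 * length x) \<noteq> 2" by (simp add: pad_def inp_def nth_append)
  show "length x \<le> i" if "inp (pad x t) (2 * i) \<noteq> 2" for i
    using that inp_encw[of i x] unfolding pad_def by (meson not_less)
qed

lemma unpad_pad: "unpad (pad x t) = x"
proof (rule nth_equalityI)
  show l: "length (unpad (pad x t)) = length x" by (simp add: unpad_def plen_pad) (simp add: pad_def)
  show "unpad (pad x t) ! i = x ! i" if "i < length (unpad (pad x t))" for i
  proof -
    have i: "i < length x" using that l by simp
    have "unpad (pad x t) ! i = (inp (pad x t) (2 * i + 1) = 2)" using that unfolding unpad_def by simp
    then show ?thesis using inp_encw[OF i] unfolding pad_def by simp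
  qed
qed

section \<open>The querying machine and the decider of its oracle\<close>

context env
begin

lemma filled_act: "f n < K \<Longrightarrow> act (enc (filled f n n) (f n), 1) (filled f n, n) = (filled f (Suc n), Suc n)"
  by (simp add: act_pair filled_Suc nat_add_distrib)

lemma grpok_fresh:
  assumes "\<And>t. t < n \<Longrightarrow> \<sigma> (b + t) = (fresh, 0)"
  shows "grpok b n 1 \<sigma>"
  unfolding grpok_def using assms tok_fresh by (intro allI impI exI[of _ fresh] exI[of _ 0] exI[of _ 1]) auto

text \<open>The query tape itself is the auxiliary tape of \<open>run\<close>: each simulated step
  of the clock appends the symbol 1, the bit False, to the encoded input. \<open>Ask\<close> leaves
  its answer on tape 2, where it is already the verdict.\<close>

definition ask_prog :: "otm \<Rightarrow> cmd" where
  "ask_prog P = flag_all ({3} \<union> {5..<k}) ;;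
     Loop (\<lambda>r. r 0 \<noteq> 0) (Act (\<lambda>r. [1 \<mapsto> (2, 1)]) ;; Act (\<lambda>r. [3 \<mapsto> (enc (r 3) (r 0), 1), 1 \<mapsto> (r 0, 1), 0 \<mapsto> (r 0, 1)])) ;;
     Act (\<lambda>r. [1 \<mapsto> (1, 1)]) ;; rew 3 ;; prep (\<lambda>s. s \<noteq> 0) P 5 4 3 ;;
     run P (det_pick P) 5 4 (\<lambda>_. True) (\<lambda>_. 1) 1 skip ;; Ask"

lemma nasks_clrs: "nasks (clrs vs) = 0 \<and> no_loop_asks (clrs vs)"
  by (induction vs) (auto simp: skip_def clr_def ffwd_def)

lemma nasks_ask_prog: "nasks (ask_prog P) = 1" "no_loop_asks (ask_prog P)"
  using nasks_clrs by (auto simp: ask_prog_def flag_all_def rew_def prep_def copy_def run_def sim_def skip_def)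

lemma adv_one_iter: "(adv (\<lambda>_. 1) ^^ i) (inp w, length w) = (inp (w @ replicate i False), length w + i)"
proof (induction i)
  case (Suc i)
  have "adv (\<lambda>_. 1) (inp (w @ replicate i False), length (w @ replicate i False)) = (inp ((w @ replicate i False) @ [False]), Suc (length (w @ replicate i False)))"
    using inp_snoc[of "w @ replicate i False" False] by (simp add: adv_def act_pair nat_add_distrib)
  then show ?case using Suc by (simp add: replicate_append_same)
qed simp

lemma runs_ask_prog:
  assumes P: "clocks P tP" and k: "k = 5 + ntapes P" and K: "alph P \<le> K" "nstates P \<le> K"
  shows "\<exists>\<sigma>'. runs (ask_prog P) (init_store x) (12 * length x + 10 * ntapes P + 5 * tP x + 40) \<sigma>' \<and>
    cur (\<sigma>' 2) = (if pad x (tP x) \<in> A then 1 else 2)"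
proof -
  let ?put = "Act (\<lambda>r. [3 \<mapsto> (enc (r 3) (r 0), 1), 1 \<mapsto> (r 0, 1), 0 \<mapsto> (r 0, 1)])"
  let ?true = "Act (\<lambda>r. [1 \<mapsto> (2, 1)])"
  let ?run = "run P (det_pick P) 5 4 (\<lambda>_. True) (\<lambda>_. 1) 1 skip"
  let ?nz = "\<lambda>s. s \<noteq> 0"
  let ?n = "length x"
  have wf: "wf_otm P" using P unfolding clocks_def by blast
  have nt: "ntapes P \<ge> 2" using wf unfolding wf_otm_def by simp
  have k': "0 < k" "1 < k" "2 < k" "3 < k" "4 < k" using k nt by auto
  have fits: "fits P 5 4" using wf K k unfolding fits_def by auto
  let ?S = "{3} \<union> {5..<k}"
  define \<sigma>1 where "\<sigma>1 = (\<lambda>t. if t \<in> ?S then (fresh, 0) else init_store x t)"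
  have 1: "runs (flag_all ?S) (init_store x) 1 \<sigma>1"
    unfolding \<sigma>1_def by (rule runs_flag_all) (use k' in \<open>auto simp: init_store_def\<close>)
  let ?s = "\<lambda>i. \<sigma>1(0 := (inp x, i), 1 := (inp (encw (take i x)), 2 * i), 3 := (filled (inp x) i, i))"
  have "runs (Loop (\<lambda>r. r 0 \<noteq> 0) (?true ;; ?put))
     (?s 0) (?n * ((1 + 1 + 1) + 1) + 1) (?s ?n)"
  proof (rule runs_Loop_count)
    fix i assume i: "i < ?n"
    show "rd k (?s i) 0 \<noteq> 0" using i k' by (auto simp: inp_def)
    let ?w = "encw (take i x)"
    have lw: "length ?w = 2 * i" using i by simp
    let ?m = "(?s i)(1 := (inp (?w @ [True]), Suc (2 * i)))"
    have "(inp ?w)(2 * i := 2) = inp (?w @ [True])" using inp_snoc[of ?w True] lw by simp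
    then have a: "runs ?true (?s i) 1 ?m"
      using k' K3 by (intro runs_Act) (auto intro!: okact_update simp: act_pair nat_add_distrib fun_eq_iff)
    have e: "inp x i = (if x ! i then 2 else 1)" using i by (simp add: inp_def)
    have "(inp (?w @ [True]))(Suc (2 * i) := inp x i) = inp (encw (take (Suc i) x))"
      using inp_snoc[of "?w @ [True]" "x ! i"] lw i e by (simp add: take_Suc_conv_app_nth)
    then have b: "act (inp x i, 1) (inp (?w @ [True]), Suc (2 * i)) = (inp (encw (take (Suc i) x)), 2 * Suc i)"
      by (simp add: act_pair nat_add_distrib)
    have c: "act (inp x i, 1) (inp x, i) = (inp x, Suc i)" by (simp add: act_pair nat_add_distrib)
    have r: "rd k ?m 3 = filled (inp x) i i" "rd k ?m 0 = inp x i" using k' by auto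
    have "runs ?put ?m 1 (?s (Suc i))"
    proof (rule runs_Act, unfold r)
      show "okact k (2 * K + 2) [3 \<mapsto> (enc (filled (inp x) i i) (inp x i), 1), 1 \<mapsto> (inp x i, 1), 0 \<mapsto> (inp x i, 1)]"
        using k' inp_less[of x i] enc_less[OF inp_less[of x i], of "filled (inp x) i i"] by (auto intro!: okact_update)
      show "upd ?m [3 \<mapsto> (enc (filled (inp x) i i) (inp x i), 1), 1 \<mapsto> (inp x i, 1), 0 \<mapsto> (inp x i, 1)] = ?s (Suc i)"
        unfolding upd_update upd_empty using b c filled_act[of "inp x" i, OF inp_less] by (auto simp: fun_eq_iff)
    qed
    from runs_Then[OF a this] show "runs (?true ;; ?put) (?s i) (1 + 1 + 1) (?s (Suc i))" .
  next
    show "\<not> rd k (?s ?n) 0 \<noteq> 0" using k' by (simp add: inp_def)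
  qed
  moreover have "?s 0 = \<sigma>1" by (auto simp: fun_eq_iff \<sigma>1_def init_store_def blank_def filled_0 inp_def)
  ultimately have 2: "runs (Loop (\<lambda>r. r 0 \<noteq> 0) (?true ;; ?put))
     \<sigma>1 (?n * ((1 + 1 + 1) + 1) + 1) (?s ?n)" by simp
  let ?w = "encw x @ [False]"
  let ?\<sigma>3 = "(?s ?n)(1 := (inp ?w, length ?w))"
  have "(inp (encw x))(2 * ?n := 1) = inp ?w" using inp_snoc[of "encw x" False] by simp
  then have 3: "runs (Act (\<lambda>r. [1 \<mapsto> (1, 1)])) (?s ?n) 1 ?\<sigma>3"
    using k' K3 by (intro runs_Act) (auto intro!: okact_update simp: act_pair nat_add_distrib fun_eq_iff)
  let ?\<sigma>4 = "?\<sigma>3(3 := (loaded x, 0))"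
  have 4: "runs (rew 3) ?\<sigma>3 (2 * ?n + 1) ?\<sigma>4" by (rule runs_rew) (use k' tok_loaded in auto)
  have gr: "3 \<notin> grp P 5 4" by (simp add: grp_def)
  have grf: "grpok 5 (ntapes P) 1 ?\<sigma>4" by (rule grpok_fresh) (use k in \<open>auto simp: \<sigma>1_def\<close>)
  obtain \<sigma>5 where 5: "runs (prep ?nz P 5 4 3) ?\<sigma>4 (ntapes P * (4 * 1 + 6) + 6 * max 1 ?n + 12) \<sigma>5"
    "rep P 5 4 (init_conf P x) (max 1 ?n) \<sigma>5" "\<And>t. t \<notin> grp P 5 4 \<Longrightarrow> \<sigma>5 t = ?\<sigma>4 t"
    using runs_prep_filled[where w = x and \<sigma> = ?\<sigma>4, OF fits k'(4) gr grf inp_less _ inp_beyond] by auto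
  have g1: "1 \<notin> grp P 5 4" by (auto simp: grp_def)
  have \<sigma>51: "\<sigma>5 1 = (inp ?w, length ?w)" using 5(3)[OF g1] by simp
  have "\<exists>\<sigma>'. runs ?run \<sigma>5 (tP x * 5 + 1) \<sigma>' \<and>
    (cur (\<sigma>' 4) = acc P \<or> cur (\<sigma>' 4) = rej P \<longleftrightarrow> tP x = tP x) \<and> \<sigma>' 1 = (adv (\<lambda>_. 1) ^^ tP x) (inp ?w, length ?w) \<and>
    (\<forall>t. t \<notin> grp P 5 4 \<longrightarrow> t \<noteq> 1 \<longrightarrow> \<sigma>' t = \<sigma>5 t)"
    by (rule runs_run_clock[OF P fits k'(2) g1 _ _ _ _ 5(2) \<sigma>51]) auto
  then obtain \<sigma>6 where 6: "runs ?run \<sigma>5 (tP x * 5 + 1) \<sigma>6"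
    "\<sigma>6 1 = (adv (\<lambda>_. 1) ^^ tP x) (inp ?w, length ?w)" by blast
  have "word_of (\<sigma>6 1) = pad x (tP x)" unfolding 6(2) adv_one_iter word_of_inp pad_def by simp
  then have 7: "runs Ask \<sigma>6 3 (\<sigma>6(1 := blank, 2 := act (if pad x (tP x) \<in> A then 1 else 2, 0) (\<sigma>6 2)))"
    using runs_Ask[of \<sigma>6] by simp
  have "runs (ask_prog P) (init_store x) (12 * length x + 10 * ntapes P + 5 * tP x + 40) (\<sigma>6(1 := blank, 2 := act (if pad x (tP x) \<in> A then 1 else 2, 0) (\<sigma>6 2)))"
    unfolding ask_prog_def
    by (rule runs_mono[OF runs_Then[OF 1 runs_Then[OF 2 runs_Then[OF 3 runs_Then[OF 4 runs_Then[OF 5(1) runs_Then[OF 6(1) 7]]]]]]])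
      (simp add: max_def)
  then show ?thesis by (intro exI conjI) (assumption, simp)
qed

text \<open>The input tape is the auxiliary tape of \<open>run\<close>: each simulated step of the
  clock uses up one symbol of the remaining input, whose end stops the run. If the clock has not
  halted by then, tape 2 stays blank, which counts as rejection.\<close>

definition dec_prog :: "otm \<Rightarrow> otm \<Rightarrow> cmd" where
  "dec_prog P M = flag_all ({3} \<union> {7..<k}) ;;
     Loop (\<lambda>r. r 0 = 2) (Act (\<lambda>r. [0 \<mapsto> (r 0, 1)]) ;; Act (\<lambda>r. [3 \<mapsto> (enc (r 3) (r 0), 1), 0 \<mapsto> (r 0, 1)])) ;;
     Act (\<lambda>r. [0 \<mapsto> (r 0, 1)]) ;; rew 3 ;; prep (\<lambda>s. s \<noteq> 0) P 7 4 3 ;;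
     run P (det_pick P) 7 4 (\<lambda>s. s \<noteq> 0) (\<lambda>s. s) 0 skip ;;
     Cond (\<lambda>r. r 4 = acc P \<or> r 4 = rej P)
       (decide (\<lambda>s. s \<noteq> 0) M (7 + ntapes P) 5 3 6 ;; Act (\<lambda>r. [2 \<mapsto> (if r 5 = acc M then 1 else 2, 0)])) skip"

text \<open>\<open>TB\<close> turns the time bound of \<open>M\<close>, a function of the unpadded
  length, into one of the padded length. It is invoked only when the clock has halted, where
  \<open>tP (unpad y) \<le> length y\<close> holds.\<close>

lemma runs_dec_prog:
  assumes P: "clocks P tP" and M: "wf_otm M" "deterministic M" "time_bounded M A T"
    and k: "k = 7 + ntapes P + ntapes M" and K: "alph P \<le> K" "nstates P \<le> K" "alph M \<le> K" "nstates M \<le> K"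
    and TB: "\<And>x n. tP x \<le> n \<Longrightarrow> T (length x) \<le> TB n"
  shows "\<exists>\<sigma>'. runs (dec_prog P M) (init_store y)
      (20 * length y + 10 * ntapes P + dcost (ntapes M) 1 (length y + 1) (TB (length y)) + 40) \<sigma>' \<and>
    (cur (\<sigma>' 2) = 1 \<longleftrightarrow> tP (unpad y) \<le> length y - (2 * plen y + 1) \<and> accepts M A (unpad y))"
proof -
  let ?put = "Act (\<lambda>r. [3 \<mapsto> (enc (r 3) (r 0), 1), 0 \<mapsto> (r 0, 1)])"
  let ?move = "Act (\<lambda>r. [0 \<mapsto> (r 0, 1)])"
  let ?run = "run P (det_pick P) 7 4 (\<lambda>s. s \<noteq> 0) (\<lambda>s. s) 0 skip"
  let ?dec = "decide (\<lambda>s. s \<noteq> 0) M (7 + ntapes P) 5 3 6"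
  let ?b = "7 + ntapes P"
  let ?x = "unpad y" and ?n = "length y" and ?m = "plen y"
  have wf: "wf_otm P" using P unfolding clocks_def by blast
  have nt: "ntapes P \<ge> 2" "ntapes M \<ge> 2" using wf M unfolding wf_otm_def by auto
  have k': "0 < k" "1 < k" "2 < k" "3 < k" "4 < k" "5 < k" "6 < k" using k nt by auto
  have fits: "fits P 7 4" "fits M ?b 5" using wf M K k unfolding fits_def by auto
  let ?S = "{3} \<union> {7..<k}"
  define \<sigma>1 where "\<sigma>1 = (\<lambda>t. if t \<in> ?S then (fresh, 0) else init_store y t)"
  have 1: "runs (flag_all ?S) (init_store y) 1 \<sigma>1"
    unfolding \<sigma>1_def by (rule runs_flag_all) (use k' in \<open>auto simp: init_store_def\<close>)
  define f where "f p = inp y (2 * p + 1)" for p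
  have fK: "f p < K" for p unfolding f_def by (rule inp_less)
  have iy: "inp y p < Suc (Suc (2 * K))" for p using inp_less[of y p] by simp
  let ?s = "\<lambda>i. \<sigma>1(0 := (inp y, 2 * i), 3 := (filled f i, i))"
  have "runs (Loop (\<lambda>r. r 0 = 2) (?move ;; ?put))
     (?s 0) (?m * ((1 + 1 + 1) + 1) + 1) (?s ?m)"
  proof (rule runs_Loop_count)
    fix i assume i: "i < ?m"
    show "rd k (?s i) 0 = 2" using plen(2)[OF i] k' by simp
    let ?t = "(?s i)(0 := (inp y, Suc (2 * i)))"
    have a: "runs ?move (?s i) 1 ?t"
      using k' iy by (intro runs_Act) (auto intro!: okact_update simp: act_pair nat_add_distrib fun_eq_iff)
    have r: "rd k ?t 3 = filled f i i" "rd k ?t 0 = f i" using k' by (auto simp: f_def)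
    have c: "act (f i, 1) (inp y, Suc (2 * i)) = (inp y, 2 * Suc i)" by (auto simp: act_pair nat_add_distrib f_def)
    have "runs ?put ?t 1 (?s (Suc i))"
    proof (rule runs_Act, unfold r)
      show "okact k (2 * K + 2) [3 \<mapsto> (enc (filled f i i) (f i), 1), 0 \<mapsto> (f i, 1)]"
        using k' fK[of i] enc_less[OF fK[of i], of "filled f i i"] by (auto intro!: okact_update)
      show "upd ?t [3 \<mapsto> (enc (filled f i i) (f i), 1), 0 \<mapsto> (f i, 1)] = ?s (Suc i)"
        unfolding upd_update upd_empty using c filled_act[of f i, OF fK] by (auto simp: fun_eq_iff)
    qed
    from runs_Then[OF a this] show "runs (?move ;; ?put) (?s i) (1 + 1 + 1) (?s (Suc i))" .
  next
    show "rd k (?s ?m) 0 \<noteq> 2" using k' plen(1)[of y] by simp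
  qed
  moreover have "?s 0 = \<sigma>1" by (auto simp: fun_eq_iff \<sigma>1_def init_store_def filled_0)
  ultimately have 2: "runs (Loop (\<lambda>r. r 0 = 2) (?move ;; ?put))
     \<sigma>1 (?m * ((1 + 1 + 1) + 1) + 1) (?s ?m)" by simp
  let ?\<sigma>3 = "(?s ?m)(0 := (inp y, 2 * ?m + 1))"
  have 3: "runs ?move (?s ?m) 1 ?\<sigma>3"
    using k' iy by (intro runs_Act) (auto intro!: okact_update simp: act_pair nat_add_distrib fun_eq_iff)
  have tokf: "tok (filled f ?m) (max 1 ?m)" by (rule tok_filled[OF fK])
  let ?\<sigma>4 = "?\<sigma>3(3 := (filled f ?m, 0))"
  have 4: "runs (rew 3) ?\<sigma>3 (2 * ?m + 1) ?\<sigma>4" by (rule runs_rew) (use k' tokf in auto)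
  have w: "inp ?x p = (if p < max 1 ?m then dec (filled f ?m p) else 0)" for p
    unfolding inp_unpad dec_filled[OF fK] f_def by auto
  have F: "filled f ?m p \<noteq> 0" if "p < max 1 ?m" for p using that tok_zero[OF tokf, of p] by (metis not_less)
  have nF: "\<not> filled f ?m (max 1 ?m) \<noteq> 0" using tok_zero[OF tokf, of "max 1 ?m"] by simp
  have gr: "3 \<notin> grp P 7 4" by (simp add: grp_def)
  have wx: "inp ?x p = (if p < ?m then f p else 0)" for p by (simp add: inp_unpad f_def)
  have grf: "grpok 7 (ntapes P) 1 ?\<sigma>4" by (rule grpok_fresh) (use k in \<open>auto simp: \<sigma>1_def\<close>)
  obtain \<sigma>5 where 5: "runs (prep (\<lambda>s. s \<noteq> 0) P 7 4 3) ?\<sigma>4 (ntapes P * (4 * 1 + 6) + 6 * max 1 ?m + 12) \<sigma>5"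
    "rep P 7 4 (init_conf P ?x) (max 1 ?m) \<sigma>5" "\<And>t. t \<notin> grp P 7 4 \<Longrightarrow> \<sigma>5 t = ?\<sigma>4 t"
    using runs_prep_filled[where w = ?x and \<sigma> = ?\<sigma>4, OF fits(1) k'(4) gr grf fK _ wx] by auto
  have g0: "0 \<notin> grp P 7 4" by (auto simp: grp_def)
  have \<sigma>50: "\<sigma>5 0 = (inp y, 2 * ?m + 1)" using 5(3)[OF g0] by simp
  \<comment> \<open>The run ends when the clock halts or the input is used up, whichever comes
    first; a tie counts as halting.\<close>
  define n where "n = min (tP ?x) (?n - (2 * ?m + 1))"
  have "\<exists>\<sigma>'. runs ?run \<sigma>5 (n * 5 + 1) \<sigma>' \<and>
    (cur (\<sigma>' 4) = acc P \<or> cur (\<sigma>' 4) = rej P \<longleftrightarrow> n = tP ?x) \<and> \<sigma>' 0 = (adv (\<lambda>s. s) ^^ n) (inp y, 2 * ?m + 1) \<and>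
    (\<forall>t. t \<notin> grp P 7 4 \<longrightarrow> t \<noteq> 0 \<longrightarrow> \<sigma>' t = \<sigma>5 t)"
  proof (rule runs_run_clock[OF P fits(1) k'(1) g0 _ _ _ _ 5(2) \<sigma>50])
    show "cur ((adv (\<lambda>s. s) ^^ i) (inp y, 2 * ?m + 1)) < 2 * K + 2" for i
      using iy by (simp add: adv_keep_iter)
    show "cur ((adv (\<lambda>s. s) ^^ i) (inp y, 2 * ?m + 1)) \<noteq> 0" if "i < n" for i
      using that by (simp add: adv_keep_iter n_def inp_def) arith
    show "n = tP ?x \<or> \<not> cur ((adv (\<lambda>s. s) ^^ n) (inp y, 2 * ?m + 1)) \<noteq> 0"
      by (auto simp: adv_keep_iter n_def inp_def min_def)
  qed (simp add: n_def)
  then obtain \<sigma>6 where 6: "runs ?run \<sigma>5 (n * 5 + 1) \<sigma>6"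
    "cur (\<sigma>6 4) = acc P \<or> cur (\<sigma>6 4) = rej P \<longleftrightarrow> n = tP ?x" "\<And>t. t \<notin> grp P 7 4 \<Longrightarrow> t \<noteq> 0 \<Longrightarrow> \<sigma>6 t = \<sigma>5 t" by blast
  have old: "\<sigma>6 t = ?\<sigma>4 t" if "t \<notin> grp P 7 4" "t \<noteq> 0" for t using 6(3)[OF that] 5(3)[OF that(1)] by simp
  have neq: "n = tP ?x \<longleftrightarrow> tP ?x \<le> ?n - (2 * ?m + 1)" by (auto simp: n_def)
  let ?C = "Cond (\<lambda>r. r 4 = acc P \<or> r 4 = rej P)
       (?dec ;; Act (\<lambda>r. [2 \<mapsto> (if r 5 = acc M then 1 else 2, 0)])) skip"
  have "\<exists>\<sigma>'. runs ?C \<sigma>6 (dcost (ntapes M) 1 (?n + 1) (TB ?n) + 4) \<sigma>' \<and>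
     (cur (\<sigma>' 2) = 1 \<longleftrightarrow> tP ?x \<le> ?n - (2 * ?m + 1) \<and> accepts M A ?x)"
  proof (cases "n = tP ?x")
    case False
    have "runs ?C \<sigma>6 (1 + 1) \<sigma>6" by (rule runs_Cond) (use False 6(2) k' runs_skip in auto)
    then have "runs ?C \<sigma>6 (dcost (ntapes M) 1 (?n + 1) (TB ?n) + 4) \<sigma>6" by (rule runs_mono) simp
    moreover have "cur (\<sigma>6 2) = 0" using old[of 2] by (auto simp: grp_def \<sigma>1_def init_store_def blank_def)
    ultimately show ?thesis using False neq by (intro exI[of _ \<sigma>6]) auto
  next
    case True
    then have tn: "tP ?x \<le> ?n" using neq by simp
    have g3: "3 \<notin> grp M ?b 5" "6 \<notin> grp M ?b 5" by (auto simp: grp_def)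
    have \<sigma>63: "\<sigma>6 3 = (filled f ?m, 0)" using old[of 3] by (auto simp: grp_def)
    have gM: "grpok ?b (ntapes M) 1 \<sigma>6"
    proof (rule grpok_fresh)
      fix t assume t: "t < ntapes M"
      have "\<sigma>6 (?b + t) = ?\<sigma>4 (?b + t)" by (rule old) (auto simp: grp_def)
      then show "\<sigma>6 (?b + t) = (fresh, 0)" using t k by (auto simp: \<sigma>1_def)
    qed
    have "\<exists>\<sigma>'. runs ?dec \<sigma>6 (dcost (ntapes M) 1 (max 1 ?m) (T (length ?x))) \<sigma>' \<and>
      (cur (\<sigma>' 5) = acc M \<longleftrightarrow> accepts M A ?x) \<and> grpok ?b (ntapes M) (max 1 ?m + T (length ?x) + 1) \<sigma>' \<and> \<sigma>' 1 = blank \<and>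
      (\<forall>t. t \<notin> grp M ?b 5 \<union> {1, 2, 6} \<longrightarrow> \<sigma>' t = \<sigma>6 t)"
    proof (rule runs_decide[where F = "\<lambda>s. s \<noteq> 0" and w = ?x and \<sigma> = \<sigma>6 and g = "filled f ?m" and n = "max 1 ?m" and e = "max 1 ?m", OF M(2,3) fits(2) k'(4) g3(1) k'(7) g3(2) _ gM \<sigma>63 tokf _ _ nF _ w])
      show "\<sigma>6 1 = blank" using old[of 1] by (auto simp: grp_def \<sigma>1_def init_store_def)
    qed (use F in auto)
    then obtain \<sigma>7 where 7: "runs ?dec \<sigma>6 (dcost (ntapes M) 1 (max 1 ?m) (T (length ?x))) \<sigma>7"
      "cur (\<sigma>7 5) = acc M \<longleftrightarrow> accepts M A ?x" by blast
    let ?\<sigma>8 = "\<sigma>7(2 := act (if accepts M A ?x then 1 else 2, 0) (\<sigma>7 2))"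
    have 8: "runs (Act (\<lambda>r. [2 \<mapsto> (if r 5 = acc M then 1 else 2, 0)])) \<sigma>7 1 ?\<sigma>8"
      using k' 7(2) K3 by (intro runs_Act) (auto intro!: okact_update)
    have c: "dcost (ntapes M) 1 (max 1 ?m) (T (length ?x)) \<le> dcost (ntapes M) 1 (?n + 1) (TB ?n)"
      by (intro dcost_mono TB[OF tn]) (use plen(3)[of y] in auto)
    have "runs ?C \<sigma>6 ((dcost (ntapes M) 1 (max 1 ?m) (T (length ?x)) + 1 + 1) + 1) ?\<sigma>8"
      by (rule runs_Cond) (use True 6(2) k' runs_Then[OF 7(1) 8] in simp)
    then have "runs ?C \<sigma>6 (dcost (ntapes M) 1 (?n + 1) (TB ?n) + 4) ?\<sigma>8" by (rule runs_mono) (use c in simp)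
    then show ?thesis using True neq by (intro exI[of _ ?\<sigma>8]) auto
  qed
  then obtain \<sigma>' where 7: "runs ?C \<sigma>6 (dcost (ntapes M) 1 (?n + 1) (TB ?n) + 4) \<sigma>'"
     "cur (\<sigma>' 2) = 1 \<longleftrightarrow> tP ?x \<le> ?n - (2 * ?m + 1) \<and> accepts M A ?x" by blast
  have "n \<le> ?n" by (simp add: n_def)
  then have "runs (dec_prog P M) (init_store y) (20 * length y + 10 * ntapes P + dcost (ntapes M) 1 (length y + 1) (TB (length y)) + 40) \<sigma>'"
    unfolding dec_prog_def
    by (intro runs_mono[OF runs_Then[OF 1 runs_Then[OF 2 runs_Then[OF 3 runs_Then[OF 4 runs_Then[OF 5(1) runs_Then[OF 6(1) 7(1)]]]]]]])
      (use plen(3)[of y] in \<open>simp add: max_def\<close>)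
  then show ?thesis using 7(2) by blast
qed

text \<open>The program yields one halting run per input. As the machine is deterministic, this run
  determines all reachable configurations, and with them the time, the language and the number of
  queries.\<close>

lemma program_machine:
  assumes prog: "\<And>x. \<exists>\<sigma>'. runs c (init_store x) (f (length x)) \<sigma>' \<and> (cur (\<sigma>' 2) = 1 \<longleftrightarrow> x \<in> L)" and f: "f \<in> expclass i"
  obtains M m where "wf_otm M" "deterministic M" "time_bounded M A (expbound i m)" "decides M A L"
    "nasks c \<le> 1 \<Longrightarrow> no_loop_asks c \<Longrightarrow> at_most_one_query M A"
proof -
  obtain M where M: "wf_otm M" "deterministic M"
    "\<And>A x t q \<sigma>'. big k (2 * K + 2) A c (init_store x) t q \<sigma>' \<Longrightarrow>
        \<exists>cc. reach M A x (Suc t) q cc \<and> st cc = (if cur (\<sigma>' 2) = 1 then acc M else rej M)"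
    using compile_correct[of k "2 * K + 2" c] k3 K3 by auto
  obtain m where m: "\<And>n. Suc (f n) \<le> expbound i m n" using expbound_of_expclass[OF expclass_Suc[OF f]] by blast
  have halt: "\<exists>n q cc. reach M A x n q cc \<and> n \<le> expbound i m (length x) \<and> st cc = (if x \<in> L then acc M else rej M) \<and>
    (no_loop_asks c \<longrightarrow> q \<le> nasks c)" for x
  proof -
    from prog[of x] obtain \<sigma>' t q where t: "t \<le> f (length x)" "big k (2 * K + 2) A c (init_store x) t q \<sigma>'" "cur (\<sigma>' 2) = 1 \<longleftrightarrow> x \<in> L"
      unfolding runs_def by blast
    from M(3)[OF t(2)] obtain cc where cc: "reach M A x (Suc t) q cc" "st cc = (if x \<in> L then acc M else rej M)" using t(3) by auto
    have "Suc t \<le> expbound i m (length x)" using t(1) m[of "length x"] by simp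
    then show ?thesis using cc big_asks[OF t(2)] by blast
  qed
  have ne: "acc M \<noteq> rej M" using M(1) unfolding wf_otm_def by simp
  have last: "n' \<le> n \<and> q' \<le> q" if "reach M A x n q cc" "st cc = (if x \<in> L then acc M else rej M)" "reach M A x n' q' c'" for x n q cc n' q' c'
    using reach_halted_last[OF M(2,1) that(1) _ that(3)] that(2) by (auto split: if_splits)
  show ?thesis
  proof (rule that[OF M(1,2)])
    show "time_bounded M A (expbound i m)" unfolding time_bounded_def
      using halt last by (meson order_trans)
    show "at_most_one_query M A" if "nasks c \<le> 1" "no_loop_asks c"
      unfolding at_most_one_query_def using halt last that by (meson order_trans)
    show "decides M A L" unfolding decides_def
    proof
      fix x
      from halt[of x] obtain n q cc where h: "reach M A x n q cc" "st cc = (if x \<in> L then acc M else rej M)" by blast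
      show "x \<in> L \<longleftrightarrow> accepts M A x"
      proof
        assume "accepts M A x"
        then obtain n' q' c' where a: "reach M A x n' q' c'" "st c' = acc M" unfolding accepts_def by blast
        \<comment> \<open>Both configurations halt, so each of them is the last of the same
          run.\<close>
        have "n \<le> n'" using reach_halted_last[OF M(2,1) a(1) _ h(1)] a(2) by simp
        then have "n = n'" using last[OF h a(1)] by simp
        then have "cc = c'" using reach_unique[OF M(2) h(1)] a(1) by blast
        then show "x \<in> L" using a(2) h(2) ne by (auto split: if_splits)
      qed (use h in \<open>auto simp: accepts_def\<close>)
    qed
  qed
qed

end

section \<open>The inclusions\<close>

lemma finite_wf_results: "finite {r. wfres n k a r}"
proof -
  let ?W = "{ws. set ws \<subseteq> {..<a} \<and> length ws = k}" and ?V = "{mv :: int list. set mv \<subseteq> {-1, 0, 1} \<and> length mv = k}"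
  have "{r. wfres n k a r} \<subseteq> {..<n} \<times> ?W \<times> ?V" unfolding wfres_def by auto
  moreover have "finite ({..<n} \<times> ?W \<times> ?V)" by (intro finite_cartesian_product finite_lists_length_eq) auto
  ultimately show ?thesis by (rule finite_subset)
qed

text \<open>\<open>delta N\<close> has infinitely many possible arguments, but well-formedness
  confines its results to a finite set. A single list therefore numbers the choices for all states
  and symbols.\<close>

lemma finite_choices:
  assumes "wf_otm N"
  obtains U where "\<And>q s. delta N q s \<subseteq> set U" "U \<noteq> []"
proof -
  obtain U where U: "set U = {r. wfres (nstates N) (ntapes N) (alph N) r}" using finite_list[OF finite_wf_results] by blast
  \<comment> \<open>The dummy entry makes the list nonempty; its empty lists do not match
    \<open>ntapes N \<ge> 2\<close>, so it is never a possible move.\<close>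
  have "delta N q s \<subseteq> set ((0, [], []) # U)" for q s
  proof
    fix r assume r: "r \<in> delta N q s"
    obtain q' ws mv where "r = (q', ws, mv)" by (cases r)
    with r have "wfres (nstates N) (ntapes N) (alph N) r" using assms unfolding wf_otm_def wfres_def by fast
    then show "r \<in> set ((0, [], []) # U)" using U by simp
  qed
  then show ?thesis by (intro that[of "(0, [], []) # U"]) auto
qed

text \<open>Bookkeeping of levels: time and tape use of \<open>N\<close> have level
  \<open>i\<close>, the number of choice sequences level \<open>i + 1\<close>, a simulated query
  level \<open>i + j\<close>.\<close>

lemma NEXPO_EXPO_subset:
  assumes L: "L \<in> NEXPO i B" and B: "B \<in> EXPO j A" and j: "j \<ge> 1"
  shows "L \<in> EXPO (i + j) A"
proof -
  let ?P = "expclass (i + j)"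
  obtain kN N where N: "wf_otm N" "time_bounded N B (expbound i kN)" "decides N B L"
    using L unfolding NEXPO_def NTIME_O_def by blast
  obtain kM M where M: "wf_otm M" "deterministic M" "time_bounded M A (expbound j kM)" "decides M A B"
    using B unfolding EXPO_def DTIME_O_def by blast
  obtain U where U: "\<And>q s. delta N q s \<subseteq> set U" "U \<noteq> []" using finite_choices[OF N(1)] by blast
  define K where "K = alph N + nstates N + alph M + nstates M + length U + 3"
  interpret dfs "9 + ntapes N + ntapes M" K A N M B "expbound i kN" "expbound j kM" U
    by unfold_locales (use N M U mono_expbound in \<open>auto simp: K_def\<close>)
  let ?T1 = "expbound i kN" and ?T2 = "expbound j kM"
  let ?e = "\<lambda>n. n + ?T1 n + 2"
  let ?m = "\<lambda>n. ?e n + ?T2 (?e n) + 1"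
  let ?q = "\<lambda>n. dcost (ntapes M) (?m n) (?e n) (?T2 (?e n)) + 6 * ?e n + 10"
  let ?f = "\<lambda>n. ntapes N * (4 * ?e n + 6) + 6 * ?e n + 2 * ?T1 n + (?T1 n + 1) * (?q n + 4) + 22"
  let ?p = "\<lambda>n. pcost n (?T1 n) (?f n)"
  have f: "fcost x = ?f (length x)" for x
    unfolding fcost_def qcost_def eM_def eN_def by simp
  have T1: "?T1 \<in> expclass i" using expclass_expbound[of "\<lambda>n. n" 0 i kN] by simp
  have T1': "?T1 \<in> ?P" by (rule expclass_level[OF T1]) simp
  have e: "?e \<in> expclass i" using T1 by (intro expclass_add expclass_const expclass_id)
  have e': "?e \<in> ?P" by (rule expclass_level[OF e]) simp
  have T2: "(\<lambda>n. ?T2 (?e n)) \<in> ?P" by (rule expclass_expbound[OF e])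
  have m: "?m \<in> ?P" by (intro expclass_add expclass_const e' T2)
  have q: "?q \<in> ?P" unfolding dcost_def
    by (intro expclass_add expclass_mult expclass_const expclass_id e' T2 m T1')
  have f': "?f \<in> ?P"
    by (intro expclass_add expclass_mult expclass_const expclass_id e' T1' q)
  have "(\<lambda>n. (length U + 1) ^ (?T1 n + 1)) \<in> expclass (Suc i)"
    by (intro expclass_base expclass_add expclass_const T1)
  \<comment> \<open>Here \<open>j \<ge> 1\<close> enters: the search tree is exponential in the time
    of \<open>N\<close>, hence one level above \<open>i\<close>.\<close>
  then have pw: "(\<lambda>n. (length U + 1) ^ (?T1 n + 1)) \<in> ?P" by (rule expclass_level) (use j in simp)
  have "(\<lambda>n. pcost n (?T1 n) (f n)) \<in> ?P" if "f \<in> ?P" for f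
    unfolding pcost_def by (intro expclass_add expclass_mult expclass_const expclass_id T1' pw that)
  from this[OF f'] have p: "?p \<in> ?P" .
  have "\<exists>\<sigma>'. runs prog (init_store x) (?p (length x)) \<sigma>' \<and> (cur (\<sigma>' 2) = 1 \<longleftrightarrow> x \<in> L)" for x
    using runs_prog[of x] N(3) unfolding f decides_def by (auto split: if_splits)
  from program_machine[OF this p] show ?thesis unfolding EXPO_def DTIME_O_def by blast
qed

lemma EXPO_padding:
  assumes L: "L \<in> EXPO l A" and k: "k \<le> l"
  obtains B where "B \<in> EXPO (l - k) A" "L \<in> NEXPO1 k B"
proof -
  obtain m M where M: "wf_otm M" "deterministic M" "time_bounded M A (expbound l m)" "decides M A L"
    using L unfolding EXPO_def DTIME_O_def by blast
  \<comment> \<open>The clock takes its exponent \<open>m\<close> from the time bound of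
    \<open>M\<close>. Then \<open>expi l (length x ^ m)\<close> is at most
    \<open>expi (l - k)\<close> of the padding length.\<close>
  obtain P tP f where P: "clocks P tP" "f \<in> expclass k" "\<And>x. expi k (length x ^ m) \<le> tP x" "\<And>x. tP x \<le> f (length x)"
    using clock_exists[of k m] by metis
  define K where "K = alph P + nstates P + alph M + nstates M + 3"
  \<comment> \<open>Membership asks for a long enough tail instead of an exact padding; the queried
    word \<open>pad x (tP x)\<close> has a tail of just the required length.\<close>
  define B where "B = {y. tP (unpad y) \<le> length y - (2 * plen y + 1) \<and> accepts M A (unpad y)}"
  let ?TB = "\<lambda>n. m * expi (l - k) n + m"
  have TB: "expbound l m (length x) \<le> ?TB n" if "tP x \<le> n" for x n
  proof -
    have "expi l (length x ^ m) = expi (l - k) (expi k (length x ^ m))" using k by (simp add: expi_add)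
    also have "\<dots> \<le> expi (l - k) n" by (rule expi_mono[OF order_trans[OF P(3) that]])
    finally show ?thesis unfolding expbound_def by simp
  qed
  have "B \<in> EXPO (l - k) A"
  proof -
    interpret env "7 + ntapes P + ntapes M" K A by unfold_locales (auto simp: K_def)
    let ?c = "\<lambda>n. 20 * n + 10 * ntapes P + dcost (ntapes M) 1 (n + 1) (?TB n) + 40"
    have "(\<lambda>n. expi (l - k) n) \<in> expclass (l - k)" using expclass_expi[of "\<lambda>n. n" 0 "l - k"] by simp
    then have c: "?c \<in> expclass (l - k)" unfolding dcost_def
      by (intro expclass_add expclass_mult expclass_const expclass_id)
    have "\<exists>\<sigma>'. runs (dec_prog P M) (init_store y) (?c (length y)) \<sigma>' \<and> (cur (\<sigma>' 2) = 1 \<longleftrightarrow> y \<in> B)" for y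
      using runs_dec_prog[where y = y, OF P(1) M(1-3) refl _ _ _ _ TB] unfolding B_def by (simp add: K_def)
    from program_machine[OF this c] show ?thesis unfolding EXPO_def DTIME_O_def by blast
  qed
  moreover have "L \<in> NEXPO1 k B"
  proof -
    interpret env "5 + ntapes P" K B by unfold_locales (use P(1) in \<open>auto simp: K_def clocks_def wf_otm_def\<close>)
    let ?c = "\<lambda>n. 12 * n + 10 * ntapes P + 5 * f n + 40"
    have c: "?c \<in> expclass k" by (intro expclass_add expclass_mult expclass_const expclass_id P(2))
    have mem: "pad x (tP x) \<in> B \<longleftrightarrow> x \<in> L" for x
      using M(4) unfolding B_def decides_def by (simp add: unpad_pad plen_pad) (simp add: pad_def)
    have "\<exists>\<sigma>'. runs (ask_prog P) (init_store x) (?c (length x)) \<sigma>' \<and> (cur (\<sigma>' 2) = 1 \<longleftrightarrow> x \<in> L)" for x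
    proof -
      from runs_ask_prog[where x = x, OF P(1) refl] obtain \<sigma>' where
        1: "runs (ask_prog P) (init_store x) (12 * length x + 10 * ntapes P + 5 * tP x + 40) \<sigma>'" "cur (\<sigma>' 2) = (if pad x (tP x) \<in> B then 1 else 2)"
        by (auto simp: K_def)
      have "runs (ask_prog P) (init_store x) (?c (length x)) \<sigma>'" using 1(1) by (rule runs_mono) (use P(4)[of x] in simp)
      moreover have "cur (\<sigma>' 2) = 1 \<longleftrightarrow> x \<in> L" using 1(2) mem[of x] by simp
      ultimately show ?thesis by blast
    qed
    from program_machine[OF this c] nasks_ask_prog show ?thesis unfolding NEXPO1_def NTIME_O1_def by (metis (mono_tags, lifting) UN_iff UNIV_I mem_Collect_eq order_refl)
  qed
  ultimately show ?thesis by (rule that)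
qed

lemma NEXPO1_subset: "NEXPO1 i A \<subseteq> NEXPO i A"
  unfolding NEXPO1_def NEXPO_def NTIME_O1_def NTIME_O_def by blast

lemma rel_NEXPO_subset:
  assumes "j \<ge> 1"
  shows "rel (NEXPO i) (rel (EXPO j) D) \<subseteq> rel (EXPO (i + j)) D"
proof
  fix L assume "L \<in> rel (NEXPO i) (rel (EXPO j) D)"
  then obtain A B where "A \<in> D" "B \<in> EXPO j A" "L \<in> NEXPO i B" unfolding rel_def by blast
  then show "L \<in> rel (EXPO (i + j)) D" using NEXPO_EXPO_subset[OF _ _ assms] unfolding rel_def by blast
qed

lemma rel_EXPO_subset:
  assumes "k \<le> l"
  shows "rel (EXPO l) D \<subseteq> rel (NEXPO1 k) (rel (EXPO (l - k)) D)"
proof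
  fix L assume "L \<in> rel (EXPO l) D"
  then obtain A where A: "A \<in> D" "L \<in> EXPO l A" unfolding rel_def by blast
  from EXPO_padding[OF A(2) assms] obtain B where "B \<in> EXPO (l - k) A" "L \<in> NEXPO1 k B" by metis
  then show "L \<in> rel (NEXPO1 k) (rel (EXPO (l - k)) D)" using A(1) unfolding rel_def by blast
qed

lemma rel_NEXPO1_subset: "rel (NEXPO1 i) D \<subseteq> rel (NEXPO i) D"
  unfolding rel_def by (rule UN_mono[OF order_refl NEXPO1_subset])

theorem mainTheorem4:
  shows "(\<forall>i j k c :: nat. j \<ge> 1 \<longrightarrow> k \<le> i + j \<longrightarrow>
            rel (NEXPO i) (rel (EXPO j) (SigmaP c)) \<subseteq> rel (EXPO (i + j)) (SigmaP c) \<and>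
            rel (EXPO (i + j)) (SigmaP c) \<subseteq> rel (NEXPO1 k) (rel (EXPO (i + j - k)) (SigmaP c)))
       \<and> (\<forall>i i' j j' l c :: nat. j \<ge> 1 \<longrightarrow> j' \<ge> 1 \<longrightarrow> i + j = l \<longrightarrow> i' + j' = l \<longrightarrow>
            rel (NEXPO i) (rel (EXPO j) (SigmaP c)) = rel (EXPO l) (SigmaP c) \<and>
            rel (EXPO l) (SigmaP c) = rel (NEXPO1 i') (rel (EXPO j') (SigmaP c)))"
proof (intro conjI allI impI)
  fix i j k c :: nat assume "j \<ge> 1" "k \<le> i + j"
  then show "rel (NEXPO i) (rel (EXPO j) (SigmaP c)) \<subseteq> rel (EXPO (i + j)) (SigmaP c)"
    "rel (EXPO (i + j)) (SigmaP c) \<subseteq> rel (NEXPO1 k) (rel (EXPO (i + j - k)) (SigmaP c))"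
    using rel_NEXPO_subset rel_EXPO_subset by auto
next
  \<comment> \<open>A circle of inclusions: one query is a special case of many, the search leads to
    \<open>EXPO (i + j)\<close>, and padding with \<open>k = i\<close> leads back, as
    \<open>i + j - i = j\<close>.\<close>
  have eqs: "rel (NEXPO1 i) (rel (EXPO j) D) = rel (EXPO (i + j)) D \<and> rel (NEXPO i) (rel (EXPO j) D) = rel (EXPO (i + j)) D"
    if "j \<ge> 1" for i j D
    using rel_NEXPO_subset[OF that, of i D] rel_EXPO_subset[of i "i + j" D] rel_NEXPO1_subset[of i "rel (EXPO j) D"] by auto
  fix i i' j j' l c :: nat assume "j \<ge> 1" "j' \<ge> 1" "i + j = l" "i' + j' = l"
  then show "rel (NEXPO i) (rel (EXPO j) (SigmaP c)) = rel (EXPO l) (SigmaP c)"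
    "rel (EXPO l) (SigmaP c) = rel (NEXPO1 i') (rel (EXPO j') (SigmaP c))"
    using eqs[of j i] eqs[of j' i'] by auto
qed

end
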